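(* Let $G$ be a finitely generated amenable group. Let $\rho:[0,\infty)\to[1,\infty)$ be a continuous increasing function with $$\rho(t)\simeq\left(\int_t^\infty\frac{ds}{(1+s)\ell(s)}\right)^{-1},$$ where $\ell:[0,\infty)\to[1,\infty)$ is continuous, increasing, slowly varying, $\int_0^\infty\frac{ds}{(1+s)\ell(s)}<\infty$, and $\ell(t^a)\simeq\ell(t)$ for all $a>0$. Let $\psi$ be the complete Bernstein function associated with $\rho$ (described in the context) and $\mathbf u_\psi=\sum_{n\ge1}c(\psi,n)\mathbf u^{(n)}$. There are constants $c=c(G,|S^*|,\rho)$ and $C=C(G,|S^*|,\rho)$ in $(0,\infty)$ such that $W(\rho,\mathbf u_\psi)\le C<\infty$ and $$\frac{c}{\rho(1/\Lambda_{\mathbf u}(v))}\le\Lambda_{\mathbf u_\psi}(v)\le\frac{C}{\rho(1/\Lambda_{\mathbf u}(v))}.$$ Further, for any symmetric probability measure $\phi$ on $G$ with $W(\rho,\phi)\le K$, $$\Lambda_\phi(v)\le\frac{CK}{\rho(1/\Lambda_{\mathbf u}(v))}.$$ In particular, the extremal profile $\widetilde{\boldsymbol\Lambda}_{G,\rho}$ satisfies $$\widetilde{\boldsymbol\Lambda}_{G,\rho}(v)\simeq\frac1{\rho(1/\Lambda_G(v))}.$$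
   Context: $G$ is equipped with a fixed generating tuple $S=(s_1,\dots,s_k)$; $S^*=\{e,s_1^{\pm1},\dots,s_k^{\pm1}\}$, $|\cdot|$ is the associated word length, $\mathbf u$ is the uniform probability measure on $S^*$ and $\mathbf u^{(n)}$ its convolution powers. For a symmetric probability measure $\phi$ on $G$, $\mathcal E_\phi(f,f)=\frac12\sum_{x,y}|f(xy)-f(x)|^2\phi(y)$ and, for $v\ge1$, $\Lambda_\phi(v)=\inf\{\mathcal E_\phi(f,f):|\mathrm{support}(f)|\le v,\|f\|_2=1\}$. $\Lambda_G$ is the $\simeq$-class of $\Lambda_{\mathbf u}$. $W(\rho,\mu)=\sup_{s>0}\{s\mu(\{g:\rho(|g|)>s\})\}$, and $\widetilde{\boldsymbol\Lambda}_{G,\rho}(v)=\sup\{\Lambda_\phi(v)\}$ over all symmetric probability measures $\phi$ on $G$ with $W(\rho,\phi)\le2\rho(0)$. A Bernstein function is $f(s)=a+bs+\int_{(0,\infty)}(1-e^{-st})\nu(dt)$ with $a,b\ge0$ and $\nu$ a measure on $(0,\infty)$ with $\int\min(1,t)\nu(dt)<\infty$. A complete Bernstein function is a Bernstein function of the form $f(s)=s^2\int_0^\infty e^{-ts}g(t)dt$ with $g$ a Bernstein function. The function $\psi$ associated with $\rho$ is a complete Bernstein function with $\psi(0)=0$, $\psi(1)=1$, $\psi(s)\sim c_0\int_0^s\frac{dx}{x\,\ell(1/x)}$ as $s\to0^+$ for some $c_0>0$, so that $\rho(t)\asymp1/\psi(1/t)$; its coefficients, defined by $1-\psi(1-x)=\sum_{n\ge1}c(\psi,n)x^n$,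 satisfy $c(\psi,n)\ge0$ and $c(\psi,n)\sim \frac{c_1}{n\ell(n)}$ as $n\to\infty$ for some $c_1>0$ (such $\psi$ exists). $f\asymp g$ means two-sided bounds by constant multiples. For monotone functions near infinity, $f\simeq g$ means there are $c_i\in(0,\infty)$ with $c_1f(c_2t)\le g(t)\le c_3f(c_4t)$. When $\Lambda_{\mathbf u}(v)=0$, $1/\rho(1/\Lambda_{\mathbf u}(v))$ is read as $0$. *)

theory Defs
  imports
    "HOL-Algebra.Generated_Groups"
    "HOL-Probability.Probability"
    "HOL-Library.Landau_Symbols"
begin

unbundle asymp_equiv_syntax

section \<open>Groups\<close>

definition generating_tuple :: "('a, 'b) monoid_scheme \<Rightarrow> 'a list \<Rightarrow> bool" where
  "generating_tuple G S \<longleftrightarrow> set S \<subseteq> carrier G \<and> generate G (set S) = carrier G"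

definition finitely_generated :: "('a, 'b) monoid_scheme \<Rightarrow> bool" where
  "finitely_generated G \<longleftrightarrow> (\<exists>S. generating_tuple G S)"

text \<open>Amenability in the sense of von Neumann: a left-invariant finitely additive probability
  measure defined on all subsets.\<close>

definition amenable :: "('a, 'b) monoid_scheme \<Rightarrow> bool" where
  "amenable G \<longleftrightarrow> (\<exists>m :: 'a set \<Rightarrow> real.
      (\<forall>A \<subseteq> carrier G. 0 \<le> m A) \<and>
      m (carrier G) = 1 \<and>
      (\<forall>A B. A \<subseteq> carrier G \<longrightarrow> B \<subseteq> carrier G \<longrightarrow> A \<inter> B = {} \<longrightarrow> m (A \<union> B) = m A + m B) \<and>
      (\<forall>g \<in> carrier G. \<forall>A \<subseteq> carrier G. m ((\<lambda>x. g \<otimes>\<^bsub>G\<^esub> x) ` A) = m A))"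

definition letters :: "('a, 'b) monoid_scheme \<Rightarrow> 'a list \<Rightarrow> 'a set" where
  "letters G S = set S \<union> (\<lambda>s. inv\<^bsub>G\<^esub> s) ` set S"

definition S_star :: "('a, 'b) monoid_scheme \<Rightarrow> 'a list \<Rightarrow> 'a set" where
  "S_star G S = insert \<one>\<^bsub>G\<^esub> (letters G S)"

definition word_length :: "('a, 'b) monoid_scheme \<Rightarrow> 'a list \<Rightarrow> 'a \<Rightarrow> nat" where
  "word_length G S x =
     (LEAST n. \<exists>w. length w = n \<and> set w \<subseteq> letters G S \<and> foldr (\<lambda>a b. a \<otimes>\<^bsub>G\<^esub> b) w \<one>\<^bsub>G\<^esub> = x)"


section \<open>Probability measures on a group\<close>

definition symmetric_measure :: "('a, 'b) monoid_scheme \<Rightarrow> 'a pmf \<Rightarrow> bool" where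
  "symmetric_measure G \<phi> \<longleftrightarrow>
     set_pmf \<phi> \<subseteq> carrier G \<and> (\<forall>x \<in> carrier G. pmf \<phi> (inv\<^bsub>G\<^esub> x) = pmf \<phi> x)"

definition uniform_step :: "('a, 'b) monoid_scheme \<Rightarrow> 'a list \<Rightarrow> 'a pmf" where
  "uniform_step G S = pmf_of_set (S_star G S)"

definition convolution :: "('a, 'b) monoid_scheme \<Rightarrow> 'a pmf \<Rightarrow> 'a pmf \<Rightarrow> 'a pmf" where
  "convolution G p q = map_pmf (\<lambda>(x, y). x \<otimes>\<^bsub>G\<^esub> y) (pair_pmf p q)"

primrec convolution_power :: "('a, 'b) monoid_scheme \<Rightarrow> 'a pmf \<Rightarrow> nat \<Rightarrow> 'a pmf" where
  "convolution_power G p 0 = return_pmf \<one>\<^bsub>G\<^esub>"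
| "convolution_power G p (Suc n) = convolution G p (convolution_power G p n)"

text \<open>The mixture \<open>\<Sum>n\<ge>1. c n \<cdot> p\<^sup>(\<^sup>n\<^sup>)\<close>. The use of \<open>embed_pmf\<close> is meaningful when the weights
  \<open>c n\<close>, \<open>n \<ge> 1\<close>, are nonnegative with sum 1; see \<open>pmf_subordinated\<close>. For the coefficients of a
  Bernstein function \<open>\<psi>\<close> the sum is \<open>1 - \<psi> 0\<close>.\<close>

definition subordinated :: "('a, 'b) monoid_scheme \<Rightarrow> (nat \<Rightarrow> real) \<Rightarrow> 'a pmf \<Rightarrow> 'a pmf" where
  "subordinated G c p = embed_pmf (\<lambda>x. \<Sum>n. c (Suc n) * pmf (convolution_power G p (Suc n)) x)"

lemma pmf_subordinated:
  assumes nonneg: "\<And>n. n \<ge> 1 \<Longrightarrow> c n \<ge> 0" and sum1: "(\<lambda>n. c (Suc n)) sums 1"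
  shows "pmf (subordinated G c p) x = (\<Sum>n. c (Suc n) * pmf (convolution_power G p (Suc n)) x)"
proof -
  let ?q = "\<lambda>n. convolution_power G p (Suc n)"
  have summ: "summable (\<lambda>n. c (Suc n) * pmf (?q n) x)" for x
    by (rule summable_comparison_test'[OF sums_summable[OF sum1], of 0])
       (auto simp del: convolution_power.simps
             simp: nonneg abs_mult intro!: mult_left_le pmf_le_1)
  have pos: "0 \<le> (\<Sum>n. c (Suc n) * pmf (?q n) x)" for x
    by (intro suminf_nonneg summ mult_nonneg_nonneg nonneg) auto
  have "(\<integral>\<^sup>+x. ennreal (\<Sum>n. c (Suc n) * pmf (?q n) x) \<partial>count_space UNIV) =
        (\<integral>\<^sup>+x. (\<Sum>n. ennreal (c (Suc n)) * ennreal (pmf (?q n) x)) \<partial>count_space UNIV)"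
    by (intro nn_integral_cong)
       (subst suminf_ennreal2[symmetric],
        auto simp del: convolution_power.simps simp: summ nonneg ennreal_mult)
  also have "\<dots> = (\<Sum>n. ennreal (c (Suc n)) * (\<integral>\<^sup>+x. ennreal (pmf (?q n) x) \<partial>count_space UNIV))"
    by (subst nn_integral_suminf) (auto simp del: convolution_power.simps simp: nn_integral_cmult)
  also have "\<dots> = (\<Sum>n. ennreal (c (Suc n)))"
    by (simp del: convolution_power.simps add: nn_integral_pmf_eq_1)
  also have "\<dots> = 1"
    using sum1 nonneg by (subst suminf_ennreal2) (auto simp: sums_iff)
  finally show ?thesis
    unfolding subordinated_def using pos by (subst pmf_embed_pmf) auto
qed


section \<open>Dirichlet forms, profiles and weak moments\<close>

definition dirichlet_form :: "('a, 'b) monoid_scheme \<Rightarrow> 'a pmf \<Rightarrow> ('a \<Rightarrow> real) \<Rightarrow> real" where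
  "dirichlet_form G \<phi> f =
     1/2 * (\<Sum>\<^sub>\<infinity>(x, y) \<in> carrier G \<times> carrier G. \<bar>f (x \<otimes>\<^bsub>G\<^esub> y) - f x\<bar>\<^sup>2 * pmf \<phi> y)"

definition spectral_profile :: "('a, 'b) monoid_scheme \<Rightarrow> 'a pmf \<Rightarrow> real \<Rightarrow> real" where
  "spectral_profile G \<phi> v =
     Inf {dirichlet_form G \<phi> f | f.
            finite {x \<in> carrier G. f x \<noteq> 0} \<and>
            real (card {x \<in> carrier G. f x \<noteq> 0}) \<le> v \<and>
            (\<Sum>\<^sub>\<infinity>x \<in> carrier G. \<bar>f x\<bar>\<^sup>2) = 1}"

definition weak_moment ::
    "('a, 'b) monoid_scheme \<Rightarrow> 'a list \<Rightarrow> (real \<Rightarrow> real) \<Rightarrow> 'a pmf \<Rightarrow> ennreal" where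
  "weak_moment G S \<rho> \<mu> =
     (SUP s \<in> {0<..}. ennreal (s *
        measure_pmf.prob \<mu> {g \<in> carrier G. \<rho> (real (word_length G S g)) > s}))"

definition extremal_profile ::
    "('a, 'b) monoid_scheme \<Rightarrow> 'a list \<Rightarrow> (real \<Rightarrow> real) \<Rightarrow> real \<Rightarrow> real" where
  "extremal_profile G S \<rho> v =
     Sup {spectral_profile G \<phi> v | \<phi>.
            symmetric_measure G \<phi> \<and> weak_moment G S \<rho> \<phi> \<le> ennreal (2 * \<rho> 0)}"

definition recip_rho :: "(real \<Rightarrow> real) \<Rightarrow> real \<Rightarrow> real" where
  "recip_rho \<rho> r = (if r = 0 then 0 else 1 / \<rho> (1 / r))"


section \<open>Comparison of functions near infinity\<close>

definition simeq :: "(real \<Rightarrow> real) \<Rightarrow> (real \<Rightarrow> real) \<Rightarrow> bool"  (infix \<open>\<simeq>\<close> 50) where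
  "f \<simeq> g \<longleftrightarrow> (\<exists>c1>0. \<exists>c2>0. \<exists>c3>0. \<exists>c4>0. \<forall>\<^sub>F t in at_top.
      c1 * f (c2 * t) \<le> g t \<and> g t \<le> c3 * f (c4 * t))"

text \<open>The \<open>\<simeq>\<close>-class of the (nonincreasing) profile of the uniform measure.\<close>

definition Lambda_class :: "('a, 'b) monoid_scheme \<Rightarrow> 'a list \<Rightarrow> (real \<Rightarrow> real) set" where
  "Lambda_class G S =
     {F. (\<exists>v0. antimono_on {v0..} F) \<and> F \<simeq> spectral_profile G (uniform_step G S)}"

definition slowly_varying :: "(real \<Rightarrow> real) \<Rightarrow> bool" where
  "slowly_varying l \<longleftrightarrow> (\<forall>a>0. ((\<lambda>t. l (a * t) / l t) \<longlongrightarrow> 1) at_top)"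


section \<open>Bernstein functions\<close>

text \<open>Bernstein functions on \<open>(0, \<infinity>)\<close> are extended by continuity to 0, where the value is \<open>a\<close>.\<close>

definition bernstein :: "(real \<Rightarrow> real) \<Rightarrow> bool" where
  "bernstein f \<longleftrightarrow> (\<exists>a b. \<exists>\<nu> :: real measure.
      a \<ge> 0 \<and> b \<ge> 0 \<and> sets \<nu> = sets (restrict_space borel {0<..}) \<and>
      (\<integral>\<^sup>+t. ennreal (min 1 t) \<partial>\<nu>) < \<infinity> \<and>
      (\<forall>s\<ge>0. f s = a + b * s + (LINT t|\<nu>. 1 - exp (- (s * t)))))"

definition complete_bernstein :: "(real \<Rightarrow> real) \<Rightarrow> bool" where
  "complete_bernstein f \<longleftrightarrow> bernstein f \<and>
     (\<exists>g. bernstein g \<and> (\<forall>s>0. f s = s\<^sup>2 * (LINT t:{0<..}|lborel. exp (- (t * s)) * g t)))"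

text \<open>\<open>psi_coeffs \<psi> c\<close>: the \<open>c n\<close>, \<open>n \<ge> 1\<close>, are the coefficients of \<open>1 - \<psi> (1 - x)\<close>; the value
  \<open>c 0\<close> is irrelevant.\<close>

definition psi_coeffs :: "(real \<Rightarrow> real) \<Rightarrow> (nat \<Rightarrow> real) \<Rightarrow> bool" where
  "psi_coeffs \<psi> c \<longleftrightarrow>
     (\<forall>x. \<bar>x\<bar> < 1 \<longrightarrow> (\<lambda>n. c (Suc n) * x ^ Suc n) sums (1 - \<psi> (1 - x)))"

text \<open>\<open>\<psi>\<close> is a complete Bernstein function associated with \<open>\<rho>\<close> (which enters through \<open>l\<close>), and \<open>c\<close>
  is its coefficient sequence.\<close>

definition associated_bernstein :: "(real \<Rightarrow> real) \<Rightarrow> (real \<Rightarrow> real) \<Rightarrow> (nat \<Rightarrow> real) \<Rightarrow> bool" where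
  "associated_bernstein l \<psi> c \<longleftrightarrow>
     complete_bernstein \<psi> \<and> \<psi> 0 = 0 \<and> \<psi> 1 = 1 \<and>
     (\<exists>c0>0. \<psi> \<sim>[at_right 0] (\<lambda>s. c0 * (LINT x:{0<..<s}|lborel. 1 / (x * l (1 / x))))) \<and>
     psi_coeffs \<psi> c \<and> (\<forall>n\<ge>1. c n \<ge> 0) \<and>
     (\<exists>c1>0. c \<sim>[at_top] (\<lambda>n. c1 / (real n * l (real n))))"

end

theory Submission
  imports Defs
begin

text \<open>
  Write \<open>E\<^sub>\<phi>\<close> for the Dirichlet form of \<open>\<phi>\<close>, \<open>N\<close> for the number of elements of \<open>S\<^sup>*\<close> and \<open>T(t)\<close> for the
  integral of \<open>1 / ((1 + s) l(s))\<close> over \<open>[t, \<infinity>)\<close>. Since \<open>l(t\<^sup>a)\<close> is comparable to \<open>l(t)\<close>, so is \<open>T(t\<^sup>a)\<close>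
  to \<open>T(t)\<close> (\<open>tail_power\<close>), and the function \<open>\<rho>\<close>, comparable to \<open>1 / T\<close>, does not see the difference
  between a large number and a power of it. Every estimate of a time or of a radius below is therefore
  needed only up to a polynomial.

  Upper bound. Let \<open>f\<close> have norm 1 and finite support. Then \<open>E\<^sub>\<phi>(f, f)\<close> is half the \<open>\<phi>\<close>-mean of
  \<open>\<parallel>f(\<cdot> y) - f\<parallel>\<^sup>2\<close>, which is at most 4 and, by the triangle inequality along a shortest word for \<open>y\<close>, at
  most \<open>2 N |y|\<^sup>2 E\<^sub>u(f, f)\<close> (\<open>grad2_word_le\<close>). Cutting at \<open>|y| = r\<close>, the weak moment bounds the far part
  by a multiple of \<open>K / \<rho>(r)\<close>; with \<open>r\<close> a small power of \<open>1 / E\<^sub>u(f, f)\<close> the near part is of no larger order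
  (\<open>form_upper\<close>). As \<open>u\<^sup>(\<^sup>k\<^sup>)\<close> lives in the ball of radius \<open>k\<close> and the tail sums of the coefficients are
  comparable to \<open>T\<close> (\<open>weights_tail\<close>), the measure \<open>u\<^sub>\<psi>\<close> has a finite weak moment, so its upper bound is a
  special case.

  Lower bound. The form of \<open>u\<^sub>\<psi>\<close> is the sum over \<open>n\<close> of \<open>c(n) (\<parallel>f\<parallel>\<^sup>2 - \<langle>P\<^sup>n f, f\<rangle>)\<close>, where \<open>P\<close> averages over
  \<open>S\<^sup>*\<close>. It suffices that \<open>\<parallel>P\<^sup>m f\<parallel>\<^sup>2 < 1/2\<close> for some \<open>m\<close> that is polynomial in \<open>1 / \<Lambda>\<^sub>u(v)\<close>, when \<open>f\<close> has
  support of size at most \<open>v\<close>. Otherwise some \<open>P\<^sup>j f\<close> with \<open>j < m\<close> has energy at most \<open>N / (2 m)\<close>, and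
  truncation at a suitable height reduces its support to at most \<open>8 v\<close> points
  (\<open>slow_decay_imp_small_energy\<close>). That bounds \<open>\<Lambda>\<^sub>u(8 v)\<close>, whereas \<open>\<Lambda>\<^sub>u(v)\<close> is wanted.

  The two are polynomially related in an infinite group (\<open>foelner_halving\<close>). By Cheeger's inequality it is
  enough to find, for a finite set \<open>A\<close> with small relative boundary, a set of at most half the size
  with a relative boundary of the order of the square root. The candidates are the sets \<open>A \<inter> g A\<close> and
  \<open>A - g A\<close>: right boundaries do not grow under left translation. If all of them fail, every \<open>g\<close> either
  almost fixes \<open>A\<close> or moves it almost off itself, and the first kind form a finite subgroup \<open>H\<close>.
  Averaging over \<open>g\<close> then shows that \<open>A\<close> nearly fills one coset \<open>H b\<close>. Having small boundary, this
  coset meets its translates by the generators, so it is invariant under them and is the whole group, which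
  would be finite. Three halvings lead from \<open>8 v\<close> to \<open>v\<close>.

  In a finite group \<open>\<Lambda>\<^sub>u(v) = 0\<close> as soon as \<open>v\<close> reaches the order; for smaller \<open>v\<close> the profile of \<open>u\<^sub>\<psi>\<close> is
  bounded below because \<open>u\<^sub>\<psi>\<close> charges every element, and only finitely many sets \<open>S\<^sup>*\<close> occur. Finally, a
  mixture of \<open>u\<^sub>\<psi>\<close> with the point mass at the identity meets the constraint \<open>W \<le> 2 \<rho>(0)\<close> at the cost of a
  constant factor, which gives the extremal profile.
\<close>

section \<open>Tails of the weight function\<close>

definition tail :: "(real \<Rightarrow> real) \<Rightarrow> real \<Rightarrow> real" where
  "tail l t = (LINT s:{t..}|lborel. 1 / ((1 + s) * l s))"

locale log_regular =
  fixes l :: "real \<Rightarrow> real"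
  assumes l_cont: "continuous_on {0..} l"
    and l_mono: "mono_on {0..} l"
    and l_ge_1: "\<And>t. 0 \<le> t \<Longrightarrow> 1 \<le> l t"
    and l_integrable: "set_integrable lborel {0..} (\<lambda>s. 1 / ((1 + s) * l s))"
    and l_powr: "\<forall>a>0. (\<lambda>t. l (t powr a)) \<simeq> l"
begin

abbreviation T :: "real \<Rightarrow> real" where "T \<equiv> tail l"

abbreviation dens :: "real \<Rightarrow> real" where "dens s \<equiv> 1 / ((1 + s) * l s)"

lemma l_monoD: "0 \<le> x \<Longrightarrow> x \<le> y \<Longrightarrow> l x \<le> l y"
  using l_mono by (auto simp: mono_on_def)

lemma dens_pos: "0 \<le> s \<Longrightarrow> 0 < dens s"
  using l_ge_1[of s] by auto

lemma dens_antimono: "0 \<le> x \<Longrightarrow> x \<le> y \<Longrightarrow> dens y \<le> dens x"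
  using l_ge_1[of x] l_ge_1[of y] l_monoD[of x y]
  by (intro divide_left_mono mult_mono) auto

lemma dens_cont: "continuous_on {0..} dens"
  using l_ge_1 by (intro continuous_intros l_cont) force

lemma dens_integrable: "0 \<le> a \<Longrightarrow> A \<in> sets borel \<Longrightarrow> A \<subseteq> {a..} \<Longrightarrow> set_integrable lborel A dens"
  by (rule set_integrable_subset[OF l_integrable]) auto

lemma tail_split:
  assumes "0 \<le> a" "a \<le> b"
  shows "T a = (LINT s:{a..b}|lborel. dens s) + T b"
proof -
  have "{a..} = {a..<b} \<union> {b..}" using assms by auto
  then have "T a = (LINT s:{a..<b}|lborel. dens s) + T b"
    unfolding tail_def using assms
    by (simp only:) (intro set_integral_Un dens_integrable[of a], auto)
  also have "(LINT s:{a..<b}|lborel. dens s) = (LINT s:{a..b}|lborel. dens s)"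
    unfolding set_lebesgue_integral_def
  proof (intro integral_cong_AE)
    show "AE x in lborel. indicator {a..<b} x *\<^sub>R dens x = indicator {a..b} x *\<^sub>R dens x"
      using AE_lborel_singleton[of b] by eventually_elim (auto simp: indicator_def)
    show "(\<lambda>x. indicator {a..<b} x *\<^sub>R dens x) \<in> borel_measurable lborel"
      "(\<lambda>x. indicator {a..b} x *\<^sub>R dens x) \<in> borel_measurable lborel"
      using assms by (intro borel_measurable_integrable dens_integrable[of a, unfolded set_integrable_def]; auto)+
  qed
  finally show ?thesis .
qed

text \<open>The density is nonincreasing, so its integral over an interval lies between the two rectangles. The
  comparison of sums with \<open>T\<close> rests on this.\<close>

lemma dens_sandwich:
  assumes "0 \<le> a" "a \<le> b"
  shows "(b - a) * dens b \<le> T a - T b" and "T a - T b \<le> (b - a) * dens a"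
proof -
  have int: "set_integrable lborel {a..b} dens"
    using assms by (intro dens_integrable[of a]) auto
  have const: "(LINT s:{a..b}|lborel. k) = (b - a) * k" "set_integrable lborel {a..b} (\<lambda>_. k)" for k :: real
    using assms by (auto simp: set_integrable_def set_lebesgue_integral_def)
  have "(LINT s:{a..b}|lborel. dens b) \<le> (LINT s:{a..b}|lborel. dens s)"
    by (intro set_integral_mono const int dens_antimono) (use assms in auto)
  moreover have "(LINT s:{a..b}|lborel. dens s) \<le> (LINT s:{a..b}|lborel. dens a)"
    by (intro set_integral_mono const int dens_antimono) (use assms in auto)
  ultimately show "(b - a) * dens b \<le> T a - T b" "T a - T b \<le> (b - a) * dens a"
    using tail_split[OF assms] const(1) by auto
qed

lemma tail_antimono: "0 \<le> a \<Longrightarrow> a \<le> b \<Longrightarrow> T b \<le> T a"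
  using dens_sandwich(1)[of a b] dens_pos[of b] by (smt (verit) mult_nonneg_nonneg)

lemma tail_tendsto_0: "(T \<longlongrightarrow> 0) at_top"
proof -
  have "((\<lambda>b. LINT s:{0..b}|lborel. dens s) \<longlongrightarrow> T 0) at_top"
    unfolding tail_def by (rule tendsto_set_lebesgue_integral_at_top[OF _ l_integrable]) auto
  then have "((\<lambda>b. T 0 - (LINT s:{0..b}|lborel. dens s)) \<longlongrightarrow> T 0 - T 0) at_top"
    by (intro tendsto_intros)
  then have "((\<lambda>b. T 0 - (LINT s:{0..b}|lborel. dens s)) \<longlongrightarrow> 0) at_top"
    by simp
  then show ?thesis
  proof (rule Lim_transform_eventually)
    show "\<forall>\<^sub>F b in at_top. T 0 - (LINT s:{0..b}|lborel. dens s) = T b"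
      using eventually_ge_at_top[of 0] by eventually_elim (simp add: tail_split)
  qed
qed

lemma tail_pos: "0 \<le> t \<Longrightarrow> 0 < T t"
proof -
  assume t: "0 \<le> t"
  have "0 \<le> T (t + 1)"
  proof (rule tendsto_upperbound[OF tail_tendsto_0])
    show "\<forall>\<^sub>F x in at_top. T x \<le> T (t + 1)"
      using eventually_ge_at_top[of "t+1"] by eventually_elim (use t tail_antimono in auto)
  qed auto
  then show ?thesis
    using dens_sandwich(1)[of t "t+1"] dens_pos[of "t+1"] t
    by (auto simp del: times_divide_eq_right divide_less_eq_1 zero_less_divide_iff zero_less_divide_1_iff)
qed

lemma tail_deriv:
  assumes "0 < t"
  shows "(T has_real_derivative - dens t) (at t)"
proof -
  have cont: "continuous_on {0..t+1} dens"
    using dens_cont by (rule continuous_on_subset) auto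
  have "((\<lambda>u. integral {0..u} dens) has_real_derivative dens t) (at t within {0..t+1})"
    using assms by (intro integral_has_real_derivative[OF cont]) auto
  then have "((\<lambda>u. integral {0..u} dens) has_real_derivative dens t) (at t)"
    using assms by (simp add: at_within_Icc_at)
  then have "((\<lambda>u. T 0 - integral {0..u} dens) has_real_derivative 0 - dens t) (at t)"
    by (intro DERIV_diff DERIV_const)
  then have "((\<lambda>u. T 0 - integral {0..u} dens) has_real_derivative - dens t) (at t)" by simp
  then show ?thesis
  proof (rule DERIV_cong_ev[THEN iffD1, rotated -1])
    show "\<forall>\<^sub>F x in nhds t. T 0 - integral {0..x} dens = T x"
    proof -
      have "\<forall>\<^sub>F x in nhds t. x \<in> {0<..}"
        using assms by (intro eventually_nhds_in_open) auto
      then show ?thesis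
      proof eventually_elim
        fix x :: real assume "x \<in> {0<..}"
        then have "T 0 = (LINT s:{0..x}|lborel. dens s) + T x" by (intro tail_split) auto
        also have "(LINT s:{0..x}|lborel. dens s) = integral {0..x} dens"
          by (intro set_borel_integral_eq_integral dens_integrable[of 0]) auto
        finally show "T 0 - integral {0..x} dens = T x" by simp
      qed
    qed
  qed auto
qed

text \<open>Of the given exponents, \<open>1/4\<close> serves better than \<open>1/2\<close>: a constant factor inside the power is absorbed
  by the remaining power of \<open>t\<close>.\<close>

lemma l_square: "\<exists>K>0. \<forall>\<^sub>F t in at_top. l (t\<^sup>2) \<le> K * l t"
proof -
  obtain c1 c2 c3 c4 where c: "c3 > 0" "c4 > 0"
    and ev: "\<forall>\<^sub>F t in at_top. c1 * l ((c2 * t) powr (1/4)) \<le> l t \<and> l t \<le> c3 * l ((c4 * t) powr (1/4))"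
    using l_powr[rule_format, of "1/4"] unfolding simeq_def by auto
  have sq: "filterlim (\<lambda>t::real. t\<^sup>2) at_top at_top"
    by (intro filterlim_pow_at_top filterlim_ident) auto
  have "\<forall>\<^sub>F t in at_top. l (t\<^sup>2) \<le> c3 * l t"
    using eventually_compose_filterlim[OF ev sq] eventually_ge_at_top[of "max 1 (c4)"]
  proof eventually_elim
    fix t assume H: "c1 * l ((c2 * t\<^sup>2) powr (1 / 4)) \<le> l (t\<^sup>2) \<and> l (t\<^sup>2) \<le> c3 * l ((c4 * t\<^sup>2) powr (1 / 4))"
      and t: "max 1 (c4) \<le> t"
    have "c4 * t\<^sup>2 \<le> t ^ 4"
    proof -
      have "c4 \<le> t * t" using t mult_mono[of 1 t c4 t] c by auto
      then have "c4 * t\<^sup>2 \<le> (t * t) * t\<^sup>2" by (intro mult_right_mono) auto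
      then show ?thesis by (simp add: power2_eq_square numeral_eq_Suc mult_ac)
    qed
    then have "(c4 * t\<^sup>2) powr (1/4) \<le> (t ^ 4) powr (1/4)"
      using c by (intro powr_mono2) auto
    also have "\<dots> = t"
    proof -
      have "t ^ 4 = t powr real 4" using t by (subst powr_realpow) auto
      also have "\<dots> powr (1/4) = t" using t by (subst powr_powr) auto
      finally show ?thesis .
    qed
    finally have "l ((c4 * t\<^sup>2) powr (1/4)) \<le> l t" by (intro l_monoD) auto
    then show "l (t\<^sup>2) \<le> c3 * l t" using H c by (smt (verit) mult_left_mono)
  qed
  then show ?thesis using c by auto
qed

text \<open>The derivative of \<open>K T(t\<^sup>2) - T(t)\<close> is eventually nonpositive because \<open>l(t\<^sup>2) \<le> K l(t)\<close>;
  as this function tends to 0, it is eventually nonnegative.\<close>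

lemma tail_square: "\<exists>C>0. \<forall>t\<ge>1. T t \<le> C * T (t\<^sup>2)"
proof -
  obtain K t0 where K: "K > 0" and t0: "\<And>t. t \<ge> t0 \<Longrightarrow> l (t\<^sup>2) \<le> K * l t"
    using l_square by (auto simp: eventually_at_top_linorder)
  define s where "s = max 1 t0"
  have s: "s \<ge> 1" "\<And>t. t \<ge> s \<Longrightarrow> l (t\<^sup>2) \<le> K * l t" using t0 by (auto simp: s_def)
  define D where "D t = K * T (t\<^sup>2) - T t" for t
  have deriv: "(D has_real_derivative (K * (- dens (t\<^sup>2) * (2 * t)) - (- dens t))) (at t)" if "t \<ge> s" for t
    unfolding D_def using that s
    by (intro DERIV_diff DERIV_cmult tail_deriv DERIV_chain2[where f = "T"]) (auto intro!: derivative_eq_intros)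
  have neg: "K * (- dens (t\<^sup>2) * (2 * t)) - (- dens t) \<le> 0" if "t \<ge> s" for t
  proof -
    have t: "t \<ge> 1" using that s by auto
    have l1: "l t \<ge> 1" "l (t\<^sup>2) \<ge> 1" using t by (auto intro: l_ge_1)
    have "1 + t\<^sup>2 \<le> 2 * t * (1 + t)"
      using t by (simp add: power2_eq_square algebra_simps)
         (smt (verit) mult_left_mono mult_cancel_left1)
    then have "(1 + t\<^sup>2) * l (t\<^sup>2) \<le> (2 * t * (1 + t)) * (K * l t)"
      using s(2)[OF that] t l1 by (intro mult_mono) auto
    then have "dens t \<le> K * (2 * t) * dens (t\<^sup>2)"
      using t l1 K by (simp add: field_simps add_pos_nonneg)
    then show ?thesis by (simp add: algebra_simps)
  qed
  have Dlim: "(D \<longlongrightarrow> K * 0 - 0) at_top"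
    unfolding D_def
    by (intro tendsto_intros tail_tendsto_0 filterlim_compose[OF tail_tendsto_0]
          filterlim_pow_at_top filterlim_ident) auto
  have D0: "0 \<le> D t" if "t \<ge> s" for t
  proof (rule tendsto_upperbound)
    show "(D \<longlongrightarrow> 0) at_top" using Dlim by simp
    show "\<forall>\<^sub>F x in at_top. D x \<le> D t"
      using eventually_ge_at_top[of t]
    proof eventually_elim
      fix x assume "t \<le> x"
      then show "D x \<le> D t"
      proof (rule DERIV_nonpos_imp_nonincreasing)
        fix y assume "t \<le> y"
        then have "y \<ge> s" using that by linarith
        from deriv[OF this] neg[OF this]
        show "\<exists>d. (D has_real_derivative d) (at y) \<and> d \<le> 0" by blast
      qed
    qed
  qed auto
  define C where "C = max K (T 0 / T (s\<^sup>2))"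
  have "T t \<le> C * T (t\<^sup>2)" if "t \<ge> 1" for t
  proof (cases "t \<ge> s")
    case True
    then have "T t \<le> K * T (t\<^sup>2)" using D0[OF True] by (simp add: D_def)
    also have "\<dots> \<le> C * T (t\<^sup>2)"
      using tail_pos[of "t\<^sup>2"] by (intro mult_right_mono) (auto simp: C_def)
    finally show ?thesis .
  next
    case False
    have "T t \<le> T 0" using that by (intro tail_antimono) auto
    also have "\<dots> = T 0 / T (s\<^sup>2) * T (s\<^sup>2)" using tail_pos[of "s\<^sup>2"] by auto
    also have "\<dots> \<le> C * T (t\<^sup>2)"
      using tail_pos[of "s\<^sup>2"] tail_pos[of 0] that False K
      by (intro mult_mono tail_antimono power_mono) (auto simp: C_def)
    finally show ?thesis .
  qed
  moreover have "C > 0" using K by (auto simp: C_def)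
  ultimately show ?thesis by auto
qed

lemma tail_power: "\<exists>C>0. \<forall>t\<ge>1. T t \<le> C * T (t ^ 2 ^ k)"
proof (induction k)
  case 0
  show ?case by (intro exI[of _ 1]) auto
next
  case (Suc k)
  then obtain C where C: "C > 0" "\<And>t. t \<ge> 1 \<Longrightarrow> T t \<le> C * T (t ^ 2 ^ k)" by auto
  obtain C' where C': "C' > 0" "\<And>t. t \<ge> 1 \<Longrightarrow> T t \<le> C' * T (t\<^sup>2)" using tail_square by auto
  have "T t \<le> (C * C') * T (t ^ 2 ^ Suc k)" if "t \<ge> 1" for t
  proof -
    have "T t \<le> C * T (t ^ 2 ^ k)" using C that by auto
    also have "T (t ^ 2 ^ k) \<le> C' * T ((t ^ 2 ^ k)\<^sup>2)" using that by (intro C') simp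
    also have "(t ^ 2 ^ k)\<^sup>2 = t ^ 2 ^ Suc k" by (simp add: power_mult[symmetric] mult.commute)
    finally show ?thesis using C by (simp add: mult_ac)
  qed
  then show ?case using C C' by (intro exI[of _ "C * C'"]) auto
qed

text \<open>The form in which the invariance under powers is used: \<open>s\<close> may exceed \<open>t\<close> polynomially, and the
  shift by 1 makes the bound uniform down to \<open>t = 0\<close>.\<close>

lemma tail_poly: "\<exists>C>0. \<forall>s t. 0 \<le> t \<longrightarrow> 0 \<le> s \<longrightarrow> s \<le> A * (1 + t) ^ p \<longrightarrow> T t \<le> C * T s"
proof -
  define B where "B = max 1 A"
  have "p + 1 \<le> 2 ^ p" by (simp add: Suc_leI)
  then obtain C where C: "C > 0" "\<And>t. t \<ge> 1 \<Longrightarrow> T t \<le> C * T (t ^ 2 ^ p)" using tail_power by blast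
  define t1 where "t1 = B * 2 ^ p"
  have t1: "t1 \<ge> 1" unfolding t1_def B_def using mult_mono[of 1 "max 1 A" 1 "2 ^ p :: real"] by auto
  define s1 where "s1 = B * (1 + t1) ^ p"
  have s1: "s1 \<ge> 0" using t1 by (auto simp: s1_def B_def)
  define C2 where "C2 = max C (T 0 / T s1)"
  have C2: "C2 > 0" using C by (auto simp: C2_def)
  have key: "T t \<le> C2 * T s" if "0 \<le> t" "0 \<le> s" "s \<le> A * (1 + t) ^ p" for s t
  proof -
    have "A * (1 + t) ^ p \<le> B * (1 + t) ^ p" using that(1) by (intro mult_right_mono) (auto simp: B_def)
    then have sB: "s \<le> B * (1 + t) ^ p" using that by linarith
    show ?thesis
    proof (cases "t \<ge> t1")
      case True
      then have t: "t \<ge> 1" using t1 by simp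
      have "B * (1 + t) ^ p \<le> B * (2 * t) ^ p"
        using t by (intro mult_left_mono power_mono) (auto simp: B_def)
      also have "\<dots> = t1 * t ^ p" by (simp add: t1_def power_mult_distrib)
      also have "\<dots> \<le> t ^ (p + 1)" using True t by (simp add: mult_right_mono)
      also have "\<dots> \<le> t ^ 2 ^ p" using t \<open>p + 1 \<le> 2 ^ p\<close> by (intro power_increasing) auto
      finally have "T (t ^ 2 ^ p) \<le> T s" using sB that by (intro tail_antimono) auto
      then have "C * T (t ^ 2 ^ p) \<le> C2 * T s"
        using C(1) C2 tail_pos[of "t ^ 2 ^ p"] t by (intro mult_mono) (auto simp: C2_def)
      then show ?thesis using C(2)[OF t] by linarith
    next
      case False
      have "B * (1 + t) ^ p \<le> s1"
        unfolding s1_def using that False by (intro mult_left_mono power_mono) (auto simp: B_def)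
      then have "T s1 \<le> T s" using sB that by (intro tail_antimono) auto
      moreover have "T t \<le> T 0" using that by (intro tail_antimono) auto
      moreover have "T 0 = T 0 / T s1 * T s1" using tail_pos[OF s1] by auto
      moreover have "\<dots> \<le> C2 * T s"
        using tail_pos[OF s1] C2 calculation(1) by (intro mult_mono) (auto simp: C2_def)
      ultimately show ?thesis by linarith
    qed
  qed
  then show ?thesis using C2 by (intro exI[of _ C2]) auto
qed

text \<open>For large \<open>n\<close> the weight \<open>c n\<close> lies between multiples of \<open>T n - T (n + 1)\<close> and
  \<open>T (n - 1) - T n\<close>, and these differences telescope. The finitely many remaining \<open>n\<close> only change
  the constants.\<close>

lemma weights_tail:
  fixes c :: "nat \<Rightarrow> real"
  assumes nonneg: "\<And>n. n \<ge> 1 \<Longrightarrow> 0 \<le> c n"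
    and sm: "summable c" and asymp: "c1 > 0" "c \<sim>[at_top] (\<lambda>n. c1 / (real n * l (real n)))"
  shows "\<exists>a>0. \<exists>b>0. \<forall>n\<ge>1. a * T n \<le> (\<Sum>k. c (k + n)) \<and> (\<Sum>k. c (k + n)) \<le> b * T n"
proof -
  let ?d = "\<lambda>n::nat. 1 / (real n * l (real n))"
  have "\<forall>\<^sub>F n in at_top. c n / (c1 / (real n * l (real n))) \<in> {1/2<..<2}"
  proof -
    have nz: "\<forall>\<^sub>F n in at_top. c1 / (real n * l (real n)) \<noteq> 0"
      using eventually_gt_at_top[of 0]
    proof eventually_elim
      case (elim n)
      then show ?case using l_ge_1[of "real n"] asymp(1) by auto
    qed
    have "((\<lambda>n. c n / (c1 / (real n * l (real n)))) \<longlongrightarrow> 1) at_top"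
      by (rule asymp_equivD_strong[OF asymp(2)]) (use nz in eventually_elim, simp)
    then show ?thesis by (rule topological_tendstoD) auto
  qed
  then obtain m where m: "\<And>n. n \<ge> m \<Longrightarrow> c n / (c1 / (real n * l (real n))) \<in> {1/2<..<2}"
    by (auto simp: eventually_at_top_linorder)
  define n0 where "n0 = max m 2"
  have c_bd: "c1 / 2 * ?d n \<le> c n \<and> c n \<le> 2 * c1 * ?d n" if "n \<ge> n0" for n
  proof -
    have "real n * l (real n) > 0" using that l_ge_1[of "real n"] by (auto simp: n0_def)
    then show ?thesis using m[of n] that asymp(1) by (auto simp: n0_def field_simps)
  qed
  have tel: "(\<lambda>k. T (real (k + n)) - T (real (Suc k + n))) sums T (real n)" for n
  proof -
    have "(\<lambda>k. T (real (k + n))) \<longlonglongrightarrow> 0"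
      by (intro filterlim_compose[OF tail_tendsto_0] filterlim_compose[OF filterlim_real_sequentially]
            filterlim_add_const_nat_at_top)
    from telescope_sums'[OF this] show ?thesis by simp
  qed
  have sm': "summable (\<lambda>k. c (k + n))" for n using sm by (simp add: summable_iff_shift)
  have low: "c1 / 2 * T (real n) \<le> (\<Sum>k. c (k + n))" if "n \<ge> n0" for n
  proof -
    have "c1 / 2 * T (real n) = (\<Sum>k. c1 / 2 * (T (real (k + n)) - T (real (Suc k + n))))"
      using sums_mult[OF tel, of "c1/2" n] by (simp add: sums_iff)
    also have "\<dots> \<le> (\<Sum>k. c (k + n))"
    proof (intro suminf_le sm')
      show "summable (\<lambda>k. c1 / 2 * (T (real (k + n)) - T (real (Suc k + n))))"
        using sums_mult[OF tel, of "c1/2" n] by (simp only: sums_iff)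
      fix k
      have n: "real (k + n) > 0" using that by (auto simp: n0_def)
      have "T (real (k + n)) - T (real (Suc k + n)) \<le> dens (real (k + n))"
        using dens_sandwich(2)[of "real (k+n)" "real (Suc k+n)"] by simp
      also have "\<dots> \<le> ?d (k + n)"
        using n l_ge_1[of "real (k+n)"] by (intro divide_left_mono mult_right_mono mult_pos_pos) auto
      finally have "c1 / 2 * (T (real (k + n)) - T (real (Suc k + n))) \<le> c1 / 2 * ?d (k + n)"
        using asymp(1) by (intro mult_left_mono) auto
      then show "c1 / 2 * (T (real (k + n)) - T (real (Suc k + n))) \<le> c (k + n)"
        using c_bd[of "k+n"] that by linarith
    qed
    finally show ?thesis .
  qed
  obtain Cd where Cd: "Cd > 0" "\<And>s t. 0 \<le> t \<Longrightarrow> 0 \<le> s \<Longrightarrow> s \<le> 1 * (1 + t) ^ 1 \<Longrightarrow> T t \<le> Cd * T s"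
    using tail_poly[of 1 1] by auto
  have up: "(\<Sum>k. c (k + n)) \<le> (4 * c1 * Cd) * T (real n)" if "n \<ge> n0" for n
  proof -
    have n2: "n \<ge> 2" using that by (auto simp: n0_def)
    have "(\<Sum>k. c (k + n)) \<le> (\<Sum>k. 4 * c1 * (T (real (k + (n-1))) - T (real (Suc k + (n-1)))))"
    proof (intro suminf_le sm')
      show "summable (\<lambda>k. 4 * c1 * (T (real (k + (n-1))) - T (real (Suc k + (n-1)))))"
        using sums_mult[OF tel, of "4*c1" "n-1"] by (simp only: sums_iff)
      fix k
      have n: "real (k + n) \<ge> 1" using n2 by auto
      have e: "real (k + (n-1)) = real (k + n) - 1" "real (Suc k + (n-1)) = real (k + n)" using n2 by auto
      have "?d (k + n) \<le> 2 * dens (real (k + n))"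
      proof -
        have "x * L > 0 \<and> 1 / (x * L) \<le> 2 * (1 / ((1 + x) * L))" if "x \<ge> 1" "L \<ge> 1" for x L :: real
        proof -
          have "(1 + x) * L \<le> 2 * x * L" "x * L > 0" "(1 + x) * L > 0"
            using that by (intro mult_right_mono mult_pos_pos; simp)+
          then show ?thesis using that by (simp add: divide_simps)
        qed
        from this[of "real (k+n)" "l (real (k+n))"] show ?thesis
          using n l_ge_1[of "real (k+n)"] by simp
      qed
      also have "dens (real (k + n)) \<le> T (real (k + n) - 1) - T (real (k + n))"
        using dens_sandwich(1)[of "real (k+n) - 1" "real (k+n)"] n by simp
      finally have "2 * c1 * ?d (k + n) \<le> 2 * c1 * (2 * (T (real (k + n) - 1) - T (real (k + n))))"
        using asymp(1) by (intro mult_left_mono) auto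
      then show "c (k + n) \<le> 4 * c1 * (T (real (k + (n-1))) - T (real (Suc k + (n-1))))"
        using c_bd[of "k+n"] that unfolding e by linarith
    qed
    also have "\<dots> = 4 * c1 * T (real (n - 1))"
      using sums_mult[OF tel, of "4*c1" "n-1"] by (simp only: sums_iff)
    also have "\<dots> \<le> 4 * c1 * (Cd * T (real n))"
      using asymp(1) n2 by (intro mult_left_mono Cd) auto
    finally show ?thesis by (simp add: mult_ac)
  qed
  define a where "a = min (c1/2) (c1 / 2 * T (real n0) / T 0)"
  define b where "b = max (4 * c1 * Cd) ((\<Sum>k. c (k + 1)) / T (real n0))"
  have ab: "a > 0" "b > 0"
    using asymp(1) Cd(1) tail_pos[of 0] tail_pos[of "real n0"]
    by (auto simp: a_def b_def less_max_iff_disj)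
  have anti: "(\<Sum>k. c (k + n)) \<le> (\<Sum>k. c (k + m))" if "1 \<le> m" "m \<le> n" for m n
  proof -
    have "(\<Sum>k. c (k + m)) = (\<Sum>k. c (k + (n - m) + m)) + (\<Sum>k<n - m. c (k + m))"
      by (rule suminf_split_initial_segment[OF sm'])
    moreover have "(\<Sum>k<n - m. c (k + m)) \<ge> 0" using that by (intro sum_nonneg nonneg) auto
    ultimately show ?thesis using that by (simp add: add.assoc)
  qed
  have "a * T n \<le> (\<Sum>k. c (k + n)) \<and> (\<Sum>k. c (k + n)) \<le> b * T n" if "n \<ge> 1" for n :: nat
  proof (cases "n \<ge> n0")
    case True
    have "a * T n \<le> c1 / 2 * T n" "4 * c1 * Cd * T n \<le> b * T n"
      using tail_pos[of "real n"] by (intro mult_right_mono; auto simp: a_def b_def)+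
    then show ?thesis using low[OF True] up[OF True] by linarith
  next
    case False
    have "a * T n \<le> c1 / 2 * T (real n0) / T 0 * T 0"
      using tail_antimono[of 0 "real n"] ab tail_pos[of "real n"] by (intro mult_mono) (auto simp: a_def)
    also have "\<dots> = c1 / 2 * T n0" using tail_pos[of 0] by simp
    also have "\<dots> \<le> (\<Sum>k. c (k + n0))" using low by simp
    also have "\<dots> \<le> (\<Sum>k. c (k + n))" using anti[of n n0] that False by auto
    finally have 1: "a * T n \<le> (\<Sum>k. c (k + n))" .
    have "(\<Sum>k. c (k + n)) \<le> (\<Sum>k. c (k + 1))" using anti[of 1 n] that by auto
    also have "\<dots> = (\<Sum>k. c (k + 1)) / T n0 * T n0" using tail_pos[of "real n0"] by simp
    also have "\<dots> \<le> b * T n"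
      using tail_antimono[of "real n" "real n0"] ab tail_pos[of "real n0"] False
      by (intro mult_mono) (auto simp: b_def)
    finally show ?thesis using 1 by simp
  qed
  then show ?thesis using ab by blast
qed

lemma rho_tail:
  assumes rho_mono: "mono_on {0..} \<rho>" and rho1: "\<forall>t\<ge>0. 1 \<le> \<rho> t"
    and rho: "\<rho> \<simeq> (\<lambda>t. inverse (T t))"
  shows "\<exists>a>0. \<exists>b>0. \<forall>t\<ge>0. a \<le> \<rho> t * T t \<and> \<rho> t * T t \<le> b"
proof -
  have mono: "0 \<le> x \<Longrightarrow> x \<le> y \<Longrightarrow> \<rho> x \<le> \<rho> y" for x y using rho_mono by (auto simp: mono_on_def)
  obtain c1 c2 c3 c4 where c: "c1 > 0" "c2 > 0" "c3 > 0" "c4 > 0" and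
    "\<forall>\<^sub>F t in at_top. c1 * \<rho> (c2 * t) \<le> inverse (T t) \<and> inverse (T t) \<le> c3 * \<rho> (c4 * t)"
    using rho unfolding simeq_def by auto
  then obtain t0 where t0: "\<And>t. t \<ge> t0 \<Longrightarrow> c1 * \<rho> (c2 * t) \<le> inverse (T t)"
      "\<And>t. t \<ge> t0 \<Longrightarrow> inverse (T t) \<le> c3 * \<rho> (c4 * t)"
    by (auto simp: eventually_at_top_linorder)
  define t1 where "t1 = max 0 (max (c2 * t0) (c4 * t0))"
  obtain C where C: "C > 0" "\<And>s t. 0 \<le> t \<Longrightarrow> 0 \<le> s \<Longrightarrow> s \<le> max (1/c2) c4 * (1 + t) ^ 1 \<Longrightarrow> T t \<le> C * T s"
    using tail_poly[of "max (1/c2) c4" 1] by auto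
  define a where "a = min (1 / (c3 * C)) (T t1)"
  define b where "b = max (C / c1) (\<rho> t1 * T 0)"
  have ab: "a > 0" "b > 0"
    using c C tail_pos[of t1] by (auto simp: a_def b_def t1_def less_max_iff_disj)
  have "a \<le> \<rho> t * T t \<and> \<rho> t * T t \<le> b" if "t \<ge> 0" for t
  proof (cases "t \<ge> t1")
    case True
    have T: "T t > 0" "T (t / c2) > 0" "T (t / c4) > 0"
      using that c by (auto intro!: tail_pos)
    have m: "1 / c2 * t \<le> max (1/c2) c4 * (1 + t)" "c4 * (t / c4) \<le> max (1/c2) c4 * (1 + t / c4)"
      using that c by (intro mult_mono; auto)+
    have "c1 * \<rho> t \<le> inverse (T (t / c2))"
      using t0(1)[of "t / c2"] True c by (auto simp: t1_def field_simps)
    then have "c1 * \<rho> t * T (t / c2) \<le> 1" using T by (simp add: field_simps)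
    moreover have "T t \<le> C * T (t / c2)" using C(2)[of t "t / c2"] m that c by simp
    then have "c1 * \<rho> t * T t \<le> c1 * \<rho> t * (C * T (t / c2))"
      using c rho1 that by (intro mult_left_mono) (auto intro: order_trans[of 0 1])
    ultimately have "c1 * \<rho> t * T t \<le> C"
      using mult_left_mono[of "c1 * \<rho> t * T (t / c2)" 1 C, OF _ less_imp_le[OF C(1)]]
      by (simp add: mult_ac)
    then have up: "\<rho> t * T t \<le> C / c1" using c by (simp add: field_simps)
    have "inverse (T (t / c4)) \<le> c3 * \<rho> t"
      using t0(2)[of "t / c4"] True c by (auto simp: t1_def field_simps)
    then have "1 \<le> c3 * \<rho> t * T (t / c4)" using T by (simp add: field_simps)
    also have "\<dots> \<le> c3 * \<rho> t * (C * T t)"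
      using c rho1 that C(2)[of "t / c4" t] m
      by (intro mult_left_mono) (auto intro: order_trans[of 0 1])
    finally have "1 / (c3 * C) \<le> \<rho> t * T t" using c C by (simp add: field_simps)
    then show ?thesis using up by (auto simp: a_def b_def)
  next
    case False
    then have t: "t \<le> t1" by simp
    have "1 * T t1 \<le> \<rho> t * T t"
      using rho1 that tail_antimono[OF that t] tail_pos[of t1] t by (intro mult_mono) (auto intro: order_trans[of 0 1])
    moreover have "\<rho> t * T t \<le> \<rho> t1 * T 0"
      using mono[OF that t] tail_antimono[of 0 t] that tail_pos[of t] rho1 t
      by (intro mult_mono) (auto intro: order_trans[of 0 1])
    ultimately show ?thesis by (auto simp: a_def b_def)
  qed
  then show ?thesis using ab by blast
qed

end

text \<open>By dominated convergence \<open>\<psi>(s) \<rightarrow> \<psi>(0) = 0\<close> as \<open>s \<rightarrow> 0\<close>. Hence the power series with the nonnegative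
  coefficients \<open>c\<close> tends to 1 at the boundary point 1, and its coefficients sum to 1.\<close>

lemma bernstein_coeffs_sums_1:
  assumes bern: "bernstein \<psi>" and psi0: "\<psi> 0 = 0" and coeffs: "psi_coeffs \<psi> c"
    and nonneg: "\<forall>n\<ge>1. 0 \<le> c n"
  shows "(\<lambda>n. c (Suc n)) sums 1"
proof -
  obtain a b and \<nu> :: "real measure" where ab: "a \<ge> 0" "b \<ge> 0"
    and sets: "sets \<nu> = sets (restrict_space borel {0<..})"
    and fin: "(\<integral>\<^sup>+t. ennreal (min 1 t) \<partial>\<nu>) < \<infinity>"
    and psi: "\<And>s. s \<ge> 0 \<Longrightarrow> \<psi> s = a + b * s + (LINT t|\<nu>. 1 - exp (- (s * t)))"
    using bern unfolding bernstein_def by blast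
  have a0: "a = 0" using psi[of 0] psi0 by simp
  have sp: "space \<nu> = {0<..}" using sets_eq_imp_space_eq[OF sets] by (simp add: space_restrict_space)
  have meas: "f \<in> borel_measurable \<nu>" if "f \<in> borel_measurable borel" for f :: "real \<Rightarrow> real"
    using measurable_restrict_space1[OF that] by (subst measurable_cong_sets[OF sets refl])
  have psi_nonneg: "\<psi> s \<ge> 0" if "s \<ge> 0" for s
    unfolding psi[OF that] using ab that
    by (intro add_nonneg_nonneg integral_nonneg_AE mult_nonneg_nonneg AE_I2) (auto simp: sp)
  define s where "s k = 1 / real (k + 2)" for k
  have s: "s k > 0" "s k < 1" for k by (auto simp: s_def)
  have s_lim: "s \<longlonglongrightarrow> 0" unfolding s_def
    by (intro real_tendsto_divide_at_top[OF tendsto_const] filterlim_compose[OF filterlim_real_sequentially]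
         filterlim_add_const_nat_at_top)
  have w: "integrable \<nu> (\<lambda>t. min 1 t)"
  proof (rule integrableI_bounded)
    have "(\<integral>\<^sup>+t. ennreal (norm (min 1 t)) \<partial>\<nu>) = (\<integral>\<^sup>+t. ennreal (min 1 t) \<partial>\<nu>)"
      by (intro nn_integral_cong) (auto simp: sp min_def)
    then show "(\<integral>\<^sup>+t. ennreal (norm (min 1 t)) \<partial>\<nu>) < \<infinity>" using fin by simp
  qed (intro meas, measurable)
  have "(\<lambda>k. LINT t|\<nu>. 1 - exp (- (s k * t))) \<longlonglongrightarrow> (LINT t|\<nu>. 0)"
  proof (rule integral_dominated_convergence[OF _ _ w])
    show "AE t in \<nu>. (\<lambda>k. 1 - exp (- (s k * t))) \<longlonglongrightarrow> 0"
    proof (rule AE_I2)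
      fix t
      have "(\<lambda>k. 1 - exp (- (s k * t))) \<longlonglongrightarrow> 1 - exp (- (0 * t))" by (intro tendsto_intros s_lim)
      then show "(\<lambda>k. 1 - exp (- (s k * t))) \<longlonglongrightarrow> 0" by simp
    qed
    show "AE t in \<nu>. norm (1 - exp (- (s k * t))) \<le> min 1 t" for k
    proof (rule AE_I2)
      fix t assume "t \<in> space \<nu>"
      then have t: "t > 0" by (simp add: sp)
      have "1 - s k * t \<le> exp (- (s k * t))" using exp_ge_add_one_self[of "- (s k * t)"] by simp
      moreover have "s k * t \<le> t" using s[of k] t mult_right_mono[of "s k" 1 t] by simp
      ultimately have "1 - exp (- (s k * t)) \<le> t" by linarith
      then show "norm (1 - exp (- (s k * t))) \<le> min 1 t" using s[of k] t by simp
    qed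
  qed (intro meas, measurable)+
  then have "(\<lambda>k. a + b * s k + (LINT t|\<nu>. 1 - exp (- (s k * t)))) \<longlonglongrightarrow> a + b * 0 + (LINT t|\<nu>. 0)"
    by (intro tendsto_intros s_lim)
  then have psi_lim: "(\<lambda>k. \<psi> (s k)) \<longlonglongrightarrow> 0"
    using psi s by (simp add: a0 less_imp_le)
  have ser: "(\<lambda>n. c (Suc n) * (1 - s k) ^ Suc n) sums (1 - \<psi> (s k))" for k
    using coeffs[unfolded psi_coeffs_def, rule_format, of "1 - s k"] s[of k] by simp
  have part: "(\<Sum>n<m. c (Suc n)) \<le> 1" for m
  proof (rule tendsto_upperbound)
    have "(\<lambda>k. \<Sum>n<m. c (Suc n) * (1 - s k) ^ Suc n) \<longlonglongrightarrow> (\<Sum>n<m. c (Suc n) * (1 - 0) ^ Suc n)"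
      by (intro tendsto_intros s_lim)
    then show "(\<lambda>k. \<Sum>n<m. c (Suc n) * (1 - s k) ^ Suc n) \<longlonglongrightarrow> (\<Sum>n<m. c (Suc n))"
      by simp
    show "\<forall>\<^sub>F k in sequentially. (\<Sum>n<m. c (Suc n) * (1 - s k) ^ Suc n) \<le> 1"
    proof (rule always_eventually, rule allI)
      fix k
      have "(\<Sum>n<m. c (Suc n) * (1 - s k) ^ Suc n) \<le> (\<Sum>n. c (Suc n) * (1 - s k) ^ Suc n)"
        using ser[of k] s[of k] nonneg by (intro sum_le_suminf) (auto simp: sums_iff less_imp_le)
      also have "\<dots> = 1 - \<psi> (s k)" using ser[of k] by (simp only: sums_iff)
      finally show "(\<Sum>n<m. c (Suc n) * (1 - s k) ^ Suc n) \<le> 1"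
        using psi_nonneg[of "s k"] s[of k] by linarith
    qed
  qed auto
  have sm: "summable (\<lambda>n. c (Suc n))"
    using nonneg part by (intro summableI_nonneg_bounded[where x = 1]) auto
  have "(\<Sum>n. c (Suc n)) \<le> 1" using part sm by (intro suminf_le_const) auto
  moreover have "1 - 0 \<le> (\<Sum>n. c (Suc n))"
  proof (rule tendsto_upperbound)
    show "(\<lambda>k. 1 - \<psi> (s k)) \<longlonglongrightarrow> 1 - 0" by (intro tendsto_intros psi_lim)
    show "\<forall>\<^sub>F k in sequentially. 1 - \<psi> (s k) \<le> (\<Sum>n. c (Suc n))"
    proof (rule always_eventually, rule allI)
      fix k
      have "1 - \<psi> (s k) = (\<Sum>n. c (Suc n) * (1 - s k) ^ Suc n)" using ser[of k] by (simp only: sums_iff)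
      also have "\<dots> \<le> (\<Sum>n. c (Suc n))"
        using ser[of k] sm s[of k] nonneg
        by (intro suminf_le) (auto simp: sums_iff less_imp_le intro!: mult_left_le power_le_one mult_le_one)
      finally show "1 - \<psi> (s k) \<le> (\<Sum>n. c (Suc n))" .
    qed
  qed auto
  ultimately show ?thesis using sm by (simp add: sums_iff)
qed

section \<open>Moment functions\<close>

text \<open>The estimates on the group need two things of \<open>\<rho>\<close> besides monotonicity: polynomial changes of the argument
  cost a constant factor, and \<open>\<rho>\<close> is unbounded.\<close>

locale moment_scale =
  fixes \<rho> :: "real \<Rightarrow> real"
  assumes rho_mono: "\<And>s t. 0 \<le> s \<Longrightarrow> s \<le> t \<Longrightarrow> \<rho> s \<le> \<rho> t"
    and rho_ge_1: "\<And>t. 0 \<le> t \<Longrightarrow> 1 \<le> \<rho> t"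
    and rho_poly: "\<And>A p. \<exists>C>0. \<forall>s t. 0 \<le> t \<longrightarrow> 0 \<le> s \<longrightarrow> s \<le> A * (1 + t) ^ p \<longrightarrow> \<rho> s \<le> C * \<rho> t"
    and rho_unbounded: "\<And>M. \<exists>t\<ge>0. M < \<rho> t"
begin

lemma rho_pos: "0 \<le> t \<Longrightarrow> 0 < \<rho> t"
  using rho_ge_1[of t] by linarith

text \<open>Doubling the argument multiplies \<open>\<rho>\<close> by at most a constant.\<close>

lemma rho_growth: "\<exists>C>0. \<exists>p. \<forall>t\<ge>0. \<rho> t \<le> C * (1 + t) ^ p"
proof -
  obtain C where C: "C > 0" "\<And>s t. 0 \<le> t \<Longrightarrow> 0 \<le> s \<Longrightarrow> s \<le> 2 * (1 + t) ^ 1 \<Longrightarrow> \<rho> s \<le> C * \<rho> t"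
    using rho_poly[of 2 1] by blast
  obtain p where p: "C < 2 ^ p" using real_arch_pow[of 2 C] by auto
  have dbl: "\<rho> (2 ^ n) \<le> (2 ^ n) ^ p * \<rho> 1" for n
  proof (induction n)
    case (Suc n)
    have "\<rho> (2 ^ Suc n) \<le> C * \<rho> (2 ^ n)" by (intro C) auto
    also have "\<dots> \<le> 2 ^ p * ((2 ^ n) ^ p * \<rho> 1)"
      using Suc p C(1) rho_pos[of "2 ^ n"] by (intro mult_mono) auto
    finally show ?case by (simp add: power_mult_distrib mult.assoc)
  qed simp
  have "\<rho> t \<le> (4 ^ p * \<rho> 1) * (1 + t) ^ p" if t: "t \<ge> 0" for t
  proof -
    define k where "k = nat \<lceil>1 + t\<rceil>"
    have k: "1 + t \<le> real k" "real k \<le> 2 + t" using t unfolding k_def by linarith+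
    then have "1 \<le> k" using t by linarith
    then obtain n where n: "2 ^ n \<le> k" "k < 2 ^ (n + 1)" using ex_power_ivl1[of 2 k] by auto
    have "real (2 ^ n) \<le> real k" using n(1) by (simp only: of_nat_le_iff)
    have n1: "t \<le> 2 ^ (n + 1)"
    proof -
      have "real k \<le> real (2 ^ (n + 1))" using n(2) by (simp only: of_nat_le_iff)
      then show ?thesis using k by simp
    qed
    have n2: "2 ^ (n + 1) \<le> (2::real) * (2 * (1 + t))"
    proof -
      define q where "q = real (2 ^ n)"
      have "q \<le> real k" unfolding q_def by (rule \<open>real (2 ^ n) \<le> real k\<close>)
      also have "\<dots> \<le> 2 + t" by (rule k(2))
      also have "\<dots> \<le> 2 * (1 + t)" using t by simp
      finally have "q \<le> 2 * (1 + t)" .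
      then show ?thesis by (simp add: q_def)
    qed
    have "\<rho> t \<le> \<rho> (2 ^ (n + 1))" using t n1 by (rule rho_mono)
    also have "\<dots> \<le> (2 ^ (n + 1)) ^ p * \<rho> 1" by (rule dbl)
    also have "\<dots> \<le> (2 * (2 * (1 + t))) ^ p * \<rho> 1"
      using n2 rho_pos[of 1] by (intro mult_right_mono power_mono) auto
    also have "\<dots> = (4 ^ p * \<rho> 1) * (1 + t) ^ p" by (simp add: power_mult_distrib[symmetric] mult_ac)
    finally show ?thesis .
  qed
  then show ?thesis using rho_pos[of 1] by (intro exI[of _ "4 ^ p * \<rho> 1"] conjI exI[of _ p]) auto
qed

abbreviation recip :: "real \<Rightarrow> real" where "recip \<equiv> recip_rho \<rho>"

lemma recip_nonneg: "0 \<le> r \<Longrightarrow> 0 \<le> recip r"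
  using rho_pos[of "1 / r"] by (auto simp: recip_rho_def)

lemma recip_le_1: "0 \<le> r \<Longrightarrow> recip r \<le> 1"
  using rho_ge_1[of "1 / r"] by (auto simp: recip_rho_def)

lemma recip_doubling: "\<exists>C>0. \<forall>r s. 0 \<le> r \<longrightarrow> r \<le> A * s \<longrightarrow> 0 \<le> s \<longrightarrow> recip r \<le> C * recip s"
proof -
  obtain C where C: "C > 0" "\<And>s t. 0 \<le> t \<Longrightarrow> 0 \<le> s \<Longrightarrow> s \<le> max A 0 * (1 + t) ^ 1 \<Longrightarrow> \<rho> s \<le> C * \<rho> t"
    using rho_poly[of "max A 0" 1] by blast
  have "recip r \<le> C * recip s" if "0 \<le> r" "r \<le> A * s" "0 \<le> s" for r s
  proof (cases "r = 0")
    case True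
    then show ?thesis using recip_nonneg[OF that(3)] C(1) by (simp add: recip_rho_def)
  next
    case False
    then have r: "0 < r" using that by simp
    have s: "0 < s" using that r by (cases "s = 0") auto
    have "1 / s \<le> A * (1 / r)" using that(2) r s by (simp add: field_simps)
    also have "\<dots> \<le> max A 0 * (1 + 1 / r)" using r by (intro mult_mono) auto
    also have "\<dots> = max A 0 * (1 + 1 / r) ^ 1" by simp
    finally have "\<rho> (1 / s) \<le> C * \<rho> (1 / r)" using r s by (intro C(2)) auto
    then show ?thesis using r s rho_pos[of "1 / r"] rho_pos[of "1 / s"]
      by (simp add: recip_rho_def field_simps)
  qed
  then show ?thesis using C(1) by blast
qed

text \<open>A constant factor in the argument of \<open>recip\<close> costs only a constant factor in the value, so \<open>L\<close>
  can be replaced by any function equivalent to it.\<close>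

lemma simeq_recip:
  assumes k: "0 < k1" "0 < k2"
    and E: "\<And>v. 1 \<le> v \<Longrightarrow> k1 * recip (L v) \<le> E v" "\<And>v. 1 \<le> v \<Longrightarrow> E v \<le> k2 * recip (L v)"
    and L: "\<And>v. 1 \<le> v \<Longrightarrow> 0 \<le> L v" and F: "F \<simeq> L"
  shows "E \<simeq> (\<lambda>v. recip (F v))"
proof -
  obtain a1 a2 a3 a4 where a: "a1 > 0" "a2 > 0" "a3 > 0" "a4 > 0"
    and "\<forall>\<^sub>F t in at_top. a1 * F (a2 * t) \<le> L t \<and> L t \<le> a3 * F (a4 * t)"
    using F unfolding simeq_def by auto
  then obtain t0 where t0: "\<And>t. t \<ge> t0 \<Longrightarrow> a1 * F (a2 * t) \<le> L t" "\<And>t. t \<ge> t0 \<Longrightarrow> L t \<le> a3 * F (a4 * t)"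
    by (auto simp: eventually_at_top_linorder)
  obtain D1 where D1: "D1 > 0" "\<And>r s. 0 \<le> r \<Longrightarrow> r \<le> (1 / a1) * s \<Longrightarrow> 0 \<le> s \<Longrightarrow> recip r \<le> D1 * recip s"
    using recip_doubling[of "1 / a1"] by blast
  obtain D3 where D3: "D3 > 0" "\<And>r s. 0 \<le> r \<Longrightarrow> r \<le> a3 * s \<Longrightarrow> 0 \<le> s \<Longrightarrow> recip r \<le> D3 * recip s"
    using recip_doubling[of a3] by blast
  define t1 where "t1 = max (max t0 1 * a4) (max t0 1 * a2)"
  have "1 / (k2 * D3) * E (1 / a4 * t) \<le> recip (F t) \<and> recip (F t) \<le> D1 / k1 * E (1 / a2 * t)"
    if t: "t \<ge> t1" for t
  proof -
    have t4: "t / a4 \<ge> t0" "t / a4 \<ge> 1" and t2: "t / a2 \<ge> t0" "t / a2 \<ge> 1"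
    proof -
      have "max t0 1 * a4 \<le> t" "max t0 1 * a2 \<le> t" using t by (auto simp: t1_def)
      then have "max t0 1 \<le> t / a4" "max t0 1 \<le> t / a2" using a by (simp_all only: pos_le_divide_eq)
      then show "t / a4 \<ge> t0" "t / a4 \<ge> 1" "t / a2 \<ge> t0" "t / a2 \<ge> 1" by auto
    qed
    have L4: "L (t / a4) \<le> a3 * F t" using t0(2)[OF t4(1)] a by simp
    have "0 \<le> a3 * F t" using L[OF t4(2)] L4 by linarith
    then have F0: "0 \<le> F t" using a by (simp add: zero_le_mult_iff)
    have L2: "F t \<le> (1 / a1) * L (t / a2)" using t0(1)[OF t2(1)] a by (simp add: field_simps)
    have "E (t / a4) \<le> k2 * recip (L (t / a4))" by (rule E(2)[OF t4(2)])
    also have "\<dots> \<le> k2 * (D3 * recip (F t))"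
      using k L[OF t4(2)] L4 F0 by (intro mult_left_mono D3) auto
    finally have 1: "1 / (k2 * D3) * E (t / a4) \<le> recip (F t)" using k D3(1) by (simp add: field_simps)
    have "recip (F t) \<le> D1 * recip (L (t / a2))"
      by (rule D1(2)[OF F0 L2 L[OF t2(2)]])
    also have "\<dots> = D1 / k1 * (k1 * recip (L (t / a2)))" using k by simp
    also have "\<dots> \<le> D1 / k1 * E (t / a2)" using k D1(1) by (intro mult_left_mono E(1)[OF t2(2)]) auto
    finally show ?thesis using 1 by simp
  qed
  then show ?thesis
    unfolding simeq_def eventually_at_top_linorder
    by (intro exI[of _ "1 / (k2 * D3)"] exI[of _ "1 / a4"] exI[of _ "D1 / k1"] exI[of _ "1 / a2"] exI[of _ t1] conjI)
       (use k a D1(1) D3(1) in auto)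
qed

end

lemma (in log_regular) moment_scale_rho:
  assumes mono: "mono_on {0..} \<rho>" and ge1: "\<forall>t\<ge>0. 1 \<le> \<rho> t"
    and rho: "\<rho> \<simeq> (\<lambda>t. inverse (T t))"
  shows "moment_scale \<rho>"
proof
  obtain a b where ab: "a > 0" "b > 0" and r: "\<And>t. t \<ge> 0 \<Longrightarrow> a \<le> \<rho> t * T t" "\<And>t. t \<ge> 0 \<Longrightarrow> \<rho> t * T t \<le> b"
    using rho_tail[OF assms] by blast
  show "0 \<le> s \<Longrightarrow> s \<le> t \<Longrightarrow> \<rho> s \<le> \<rho> t" for s t using mono by (auto simp: mono_on_def)
  show "0 \<le> t \<Longrightarrow> 1 \<le> \<rho> t" for t using ge1 by auto
  show "\<exists>C>0. \<forall>s t. 0 \<le> t \<longrightarrow> 0 \<le> s \<longrightarrow> s \<le> A * (1 + t) ^ p \<longrightarrow> \<rho> s \<le> C * \<rho> t" for A :: real and p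
  proof -
    obtain C where C: "C > 0" "\<And>s t. 0 \<le> t \<Longrightarrow> 0 \<le> s \<Longrightarrow> s \<le> A * (1 + t) ^ p \<Longrightarrow> T t \<le> C * T s"
      using tail_poly[of A p] by blast
    have "\<rho> s \<le> (b * C / a) * \<rho> t" if "0 \<le> t" "0 \<le> s" "s \<le> A * (1 + t) ^ p" for s t
    proof -
      have T: "T s > 0" "T t > 0" using that tail_pos by auto
      have "\<rho> s \<le> b / T s" using r(2)[OF that(2)] T by (simp add: field_simps)
      also have "\<dots> \<le> b * C / T t" using C(2)[OF that] T ab by (simp add: field_simps)
      also have "\<dots> = b * C / a * (a / T t)" using ab by simp
      also have "\<dots> \<le> b * C / a * \<rho> t"
        using r(1)[OF that(1)] T ab C(1) by (intro mult_left_mono) (auto simp: field_simps)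
      finally show ?thesis .
    qed
    then show ?thesis using ab C(1) by (intro exI[of _ "b * C / a"]) auto
  qed
  show "\<exists>t\<ge>0. M < \<rho> t" for M
  proof -
    have "\<forall>\<^sub>F t in at_top. T t < a / (\<bar>M\<bar> + 1)"
      using ab by (intro order_tendstoD(2)[OF tail_tendsto_0]) auto
    then have "\<forall>\<^sub>F t in at_top. t \<ge> 0 \<and> T t < a / (\<bar>M\<bar> + 1)"
      using eventually_ge_at_top[of 0] by eventually_elim auto
    then obtain t where t: "t \<ge> 0" "T t < a / (\<bar>M\<bar> + 1)"
      unfolding eventually_at_top_linorder by blast
    have "(\<bar>M\<bar> + 1) * T t < a" using t(2) by (simp add: field_simps)
    also have "\<dots> \<le> \<rho> t * T t" using r(1) t by auto
    finally have "\<bar>M\<bar> + 1 < \<rho> t" using tail_pos[OF t(1)] by simp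
    then show ?thesis using t(1) by (intro exI[of _ t]) auto
  qed
qed

section \<open>Dirichlet forms of finitely supported functions\<close>

text \<open>The support is taken within the carrier, because the forms see only the values there.\<close>

definition fin_nz :: "('a, 'b) monoid_scheme \<Rightarrow> ('a \<Rightarrow> real) \<Rightarrow> bool" where
  "fin_nz G f \<longleftrightarrow> finite {x \<in> carrier G. f x \<noteq> 0}"

context group
begin

abbreviation supp :: "('a \<Rightarrow> real) \<Rightarrow> 'a set" where
  "supp f \<equiv> {x \<in> carrier G. f x \<noteq> 0}"

abbreviation total :: "('a \<Rightarrow> real) \<Rightarrow> real" where
  "total f \<equiv> (\<Sum>\<^sub>\<infinity>x\<in>carrier G. f x)"

abbreviation ip :: "('a \<Rightarrow> real) \<Rightarrow> ('a \<Rightarrow> real) \<Rightarrow> real" where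
  "ip f g \<equiv> total (\<lambda>x. f x * g x)"

abbreviation sq :: "('a \<Rightarrow> real) \<Rightarrow> real" where
  "sq f \<equiv> total (\<lambda>x. (f x)\<^sup>2)"

abbreviation form :: "'a pmf \<Rightarrow> ('a \<Rightarrow> real) \<Rightarrow> real" where "form \<equiv> dirichlet_form G"

abbreviation profile :: "'a pmf \<Rightarrow> real \<Rightarrow> real" where "profile \<equiv> spectral_profile G"

abbreviation mean :: "'a pmf \<Rightarrow> ('a \<Rightarrow> real) \<Rightarrow> real" where "mean \<equiv> measure_pmf.expectation"

abbreviation prob :: "'a pmf \<Rightarrow> 'a set \<Rightarrow> real" where "prob \<equiv> measure_pmf.prob"

definition grad2 :: "('a \<Rightarrow> real) \<Rightarrow> 'a \<Rightarrow> real" where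
  "grad2 f y = total (\<lambda>x. (f (x \<otimes> y) - f x)\<^sup>2)"

text \<open>The autocorrelation of \<open>f\<close>, which expresses every Dirichlet form at \<open>f\<close>: it vanishes outside a
  finite set that depends on \<open>f\<close> alone, so forms depend linearly on finitely many values of the
  measure (\<open>dirichlet_finite_sum\<close>).\<close>

definition corr :: "('a \<Rightarrow> real) \<Rightarrow> 'a \<Rightarrow> real" where
  "corr f y = total (\<lambda>x. f x * f (x \<otimes> y))"

lemma fin_nz_mono:
  "fin_nz G f \<Longrightarrow> (\<And>x. x \<in> carrier G \<Longrightarrow> f x = 0 \<Longrightarrow> g x = 0) \<Longrightarrow> fin_nz G g"
  unfolding fin_nz_def by (erule finite_subset[rotated]) auto

lemma fin_nz_const [intro, simp]: "fin_nz G (\<lambda>_. 0)"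
  by (simp add: fin_nz_def)

lemma fin_nz_add [intro, simp]: "fin_nz G f \<Longrightarrow> fin_nz G g \<Longrightarrow> fin_nz G (\<lambda>x. f x + g x)"
  unfolding fin_nz_def
  by (rule finite_subset[of _ "supp f \<union> supp g"]) auto

lemma fin_nz_diff [intro, simp]: "fin_nz G f \<Longrightarrow> fin_nz G g \<Longrightarrow> fin_nz G (\<lambda>x. f x - g x)"
  unfolding fin_nz_def
  by (rule finite_subset[of _ "supp f \<union> supp g"]) auto

lemma fin_nz_mult_left [intro, simp]: "fin_nz G f \<Longrightarrow> fin_nz G (\<lambda>x. f x * g x)"
  by (erule fin_nz_mono) auto

lemma fin_nz_mult_right [intro, simp]: "fin_nz G f \<Longrightarrow> fin_nz G (\<lambda>x. g x * f x)"
  by (erule fin_nz_mono) auto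

lemma fin_nz_divide [intro, simp]: "fin_nz G f \<Longrightarrow> fin_nz G (\<lambda>x. f x / c)"
  by (erule fin_nz_mono) auto

lemma fin_nz_uminus [intro, simp]: "fin_nz G f \<Longrightarrow> fin_nz G (\<lambda>x. - f x)"
  by (erule fin_nz_mono) auto

lemma fin_nz_power2 [intro, simp]: "fin_nz G f \<Longrightarrow> fin_nz G (\<lambda>x. (f x)\<^sup>2)"
  by (erule fin_nz_mono) auto

lemma fin_nz_abs [intro, simp]: "fin_nz G f \<Longrightarrow> fin_nz G (\<lambda>x. \<bar>f x\<bar>)"
  by (erule fin_nz_mono) auto

lemma fin_nz_sum [intro, simp]:
  assumes "\<And>i. i \<in> I \<Longrightarrow> fin_nz G (f i)"
  shows "fin_nz G (\<lambda>x. \<Sum>i\<in>I. f i x)"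
  using assms by (induction I rule: infinite_finite_induct) auto

lemma fin_nz_shift [intro, simp]:
  assumes "fin_nz G f" "y \<in> carrier G"
  shows "fin_nz G (\<lambda>x. f (x \<otimes> y))"
  unfolding fin_nz_def
proof (rule finite_subset)
  show "{x \<in> carrier G. f (x \<otimes> y) \<noteq> 0} \<subseteq> (\<lambda>z. z \<otimes> inv y) ` supp f"
  proof
    fix x assume "x \<in> {x \<in> carrier G. f (x \<otimes> y) \<noteq> 0}"
    then show "x \<in> (\<lambda>z. z \<otimes> inv y) ` supp f"
      using assms(2) by (intro image_eqI[of _ _ "x \<otimes> y"]) (auto simp: m_assoc)
  qed
  show "finite ((\<lambda>z. z \<otimes> inv y) ` supp f)"
    using assms(1) by (simp add: fin_nz_def)
qed

lemma fin_nz_indicator [intro, simp]: "finite A \<Longrightarrow> fin_nz G (indicator A)"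
  unfolding fin_nz_def by (rule finite_subset[of _ A]) (auto simp: indicator_def)

lemma fin_nz_summable: "fin_nz G f \<Longrightarrow> f summable_on carrier G"
  unfolding fin_nz_def by (rule finite_nonzero_values_imp_summable_on)

lemma total_eq_sum:
  assumes "finite A" "A \<subseteq> carrier G" "\<And>x. x \<in> carrier G \<Longrightarrow> x \<notin> A \<Longrightarrow> h x = 0"
  shows "total h = sum h A"
proof -
  have "total h = infsum h A" by (rule infsum_cong_neutral) (use assms in auto)
  then show ?thesis using assms by simp
qed

lemma total_add: "fin_nz G f \<Longrightarrow> fin_nz G g \<Longrightarrow> total (\<lambda>x. f x + g x) = total f + total g"
  by (intro infsum_add fin_nz_summable)

lemma total_cmult: "total (\<lambda>x. c * f x) = c * total f"
  by (rule infsum_cmult_right')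

lemma total_diff: "fin_nz G f \<Longrightarrow> fin_nz G g \<Longrightarrow> total (\<lambda>x. f x - g x) = total f - total g"
  using total_add[of f "\<lambda>x. -1 * g x"] total_cmult[of "-1" g] by simp

lemma total_sum:
  assumes "finite I" "\<And>i. i \<in> I \<Longrightarrow> fin_nz G (f i)"
  shows "total (\<lambda>x. \<Sum>i\<in>I. f i x) = (\<Sum>i\<in>I. total (f i))"
  using assms by (induction I rule: finite_induct) (auto simp: total_add)

lemma total_mono:
  "fin_nz G f \<Longrightarrow> fin_nz G g \<Longrightarrow> (\<And>x. x \<in> carrier G \<Longrightarrow> f x \<le> g x) \<Longrightarrow> total f \<le> total g"
  by (intro infsum_mono fin_nz_summable)

lemma total_nonneg: "(\<And>x. x \<in> carrier G \<Longrightarrow> 0 \<le> f x) \<Longrightarrow> 0 \<le> total f"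
  by (rule infsum_nonneg)

lemma total_shift:
  assumes "y \<in> carrier G"
  shows "total (\<lambda>x. h (x \<otimes> y)) = total h"
proof (rule infsum_reindex_bij_betw)
  show "bij_betw (\<lambda>x. x \<otimes> y) (carrier G) (carrier G)"
    using assms by (intro bij_betwI[where g = "\<lambda>x. x \<otimes> inv y"]) (auto simp: m_assoc)
qed

lemma total_indicator: "finite A \<Longrightarrow> A \<subseteq> carrier G \<Longrightarrow> total (indicator A) = real (card A)"
  by (subst total_eq_sum[of A]) auto

lemma total_pos_imp_nz: "total f \<noteq> 0 \<Longrightarrow> \<exists>x\<in>carrier G. f x \<noteq> 0"
  using infsum_0[of "carrier G" f] by blast

lemma sq_nonneg: "0 \<le> sq f" by (rule total_nonneg) auto

lemma ip_le_half:
  assumes "fin_nz G f" "fin_nz G g"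
  shows "ip f g \<le> (sq f + sq g) / 2"
proof -
  have "0 \<le> sq (\<lambda>x. f x - g x)" by (rule sq_nonneg)
  also have "\<dots> = total (\<lambda>x. ((f x)\<^sup>2 + (g x)\<^sup>2) - 2 * (f x * g x))"
    by (intro infsum_cong) (simp add: power2_eq_square algebra_simps)
  also have "\<dots> = (sq f + sq g) - 2 * ip f g"
    using assms by (subst total_diff, simp, simp, subst total_add, simp, simp, subst total_cmult, simp)
  finally show ?thesis by simp
qed

lemma sq_shift: "y \<in> carrier G \<Longrightarrow> sq (\<lambda>x. f (x \<otimes> y)) = sq f"
  using total_shift[of y "\<lambda>x. (f x)\<^sup>2"] by simp

lemma grad2_nonneg: "0 \<le> grad2 f y"
  unfolding grad2_def by (rule total_nonneg) auto

lemma grad2_eq: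
  assumes "fin_nz G f" "y \<in> carrier G"
  shows "grad2 f y = 2 * sq f - 2 * corr f y"
proof -
  have "grad2 f y = total (\<lambda>x. ((f (x \<otimes> y))\<^sup>2 + (f x)\<^sup>2) - 2 * (f x * f (x \<otimes> y)))"
    unfolding grad2_def by (intro infsum_cong) (simp add: power2_eq_square algebra_simps)
  also have "\<dots> = (total (\<lambda>x. (f (x \<otimes> y))\<^sup>2) + sq f) - 2 * corr f y"
    using assms fin_nz_shift[OF assms] unfolding corr_def
    by (subst total_diff, simp, simp, subst total_add, simp, simp, subst total_cmult, simp)
  also have "total (\<lambda>x. (f (x \<otimes> y))\<^sup>2) = sq f" by (rule total_shift[OF assms(2)])
  finally show ?thesis by simp
qed

lemma corr_bounds:
  assumes "fin_nz G f" "y \<in> carrier G"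
  shows "corr f y \<le> sq f" "- sq f \<le> corr f y"
proof -
  note fy = fin_nz_shift[OF assms]
  show "corr f y \<le> sq f"
    using ip_le_half[OF assms(1) fy] sq_shift[OF assms(2), of f] by (simp add: corr_def)
  have "ip f (\<lambda>x. - f (x \<otimes> y)) = - corr f y"
    using total_cmult[of "- 1" "\<lambda>x. f x * f (x \<otimes> y)"] by (simp add: corr_def)
  then show "- sq f \<le> corr f y"
    using ip_le_half[OF assms(1) fin_nz_uminus[OF fy]] sq_shift[OF assms(2), of f] by simp
qed

lemma grad2_le:
  assumes "fin_nz G f" "y \<in> carrier G"
  shows "grad2 f y \<le> 4 * sq f"
  using grad2_eq[OF assms] corr_bounds(2)[OF assms] by simp

lemma corr_finite_support:
  assumes "fin_nz G f"
  obtains D where "finite D" "D \<subseteq> carrier G" "\<And>y. y \<in> carrier G \<Longrightarrow> y \<notin> D \<Longrightarrow> corr f y = 0"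
proof
  let ?A = "supp f"
  let ?D = "(\<lambda>(a, b). inv a \<otimes> b) ` (?A \<times> ?A)"
  show "finite ?D" using assms by (auto simp: fin_nz_def)
  show "?D \<subseteq> carrier G" by auto
  fix y assume y: "y \<in> carrier G" "y \<notin> ?D"
  show "corr f y = 0"
    unfolding corr_def
  proof (rule infsum_0)
    fix x assume x: "x \<in> carrier G"
    show "f x * f (x \<otimes> y) = 0"
    proof (rule ccontr)
      assume "f x * f (x \<otimes> y) \<noteq> 0"
      then have "x \<in> ?A" "x \<otimes> y \<in> ?A" using x y by auto
      moreover have "y = inv x \<otimes> (x \<otimes> y)" using x y by (simp add: m_assoc[symmetric])
      ultimately have "y \<in> ?D" by (intro image_eqI[of _ _ "(x, x \<otimes> y)"]) auto
      then show False using y by simp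
    qed
  qed
qed

lemma pmf_has_sum:
  assumes "set_pmf \<phi> \<subseteq> carrier G" "\<And>y. y \<in> carrier G \<Longrightarrow> \<bar>h y\<bar> \<le> B"
  shows "((\<lambda>y. h y * pmf \<phi> y) has_sum mean \<phi> h) (carrier G)"
proof -
  have int: "integrable (measure_pmf \<phi>) h"
    using assms by (intro measure_pmf.integrable_const_bound[where B = B]) (auto simp: AE_measure_pmf_iff)
  have "integrable (count_space UNIV) (\<lambda>y. pmf \<phi> y *\<^sub>R h y)"
    using int unfolding measure_pmf_eq_density by (subst (asm) integrable_density) auto
  then have "Infinite_Set_Sum.abs_summable_on (\<lambda>y. h y * pmf \<phi> y) UNIV"
    by (simp add: Infinite_Set_Sum.abs_summable_on_def mult.commute)
  then have abs: "Infinite_Set_Sum.abs_summable_on (\<lambda>y. h y * pmf \<phi> y) (carrier G)"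
    by (rule Infinite_Set_Sum.abs_summable_on_subset) auto
  have "mean \<phi> h = infsetsum (\<lambda>y. pmf \<phi> y *\<^sub>R h y) UNIV"
    by (simp add: measure_pmf_eq_density integral_density infsetsum_def)
  also have "\<dots> = infsetsum (\<lambda>y. h y * pmf \<phi> y) (carrier G)"
    using assms(1) by (intro infsetsum_cong_neutral) (auto simp: set_pmf_eq mult.commute)
  also have "\<dots> = infsum (\<lambda>y. h y * pmf \<phi> y) (carrier G)" using abs by (rule infsetsum_infsum)
  finally show ?thesis
    using abs by (metis abs_summable_equivalent abs_summable_summable has_sum_infsum)
qed

text \<open>For each \<open>y\<close> the sum over the first variable is finite and at most \<open>4 \<parallel>f\<parallel>\<^sup>2\<close>, so the nonnegative double sum
  may be rearranged.\<close>

lemma dirichlet_grad2: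
  assumes \<phi>: "set_pmf \<phi> \<subseteq> carrier G" and f: "fin_nz G f"
  shows "form \<phi> f = 1/2 * mean \<phi> (grad2 f)"
proof -
  let ?C = "carrier G"
  define H where "H = (\<lambda>(y, x). \<bar>f (x \<otimes> y) - f x\<bar>\<^sup>2 * pmf \<phi> y)"
  have inner: "((\<lambda>x. H (y, x)) has_sum grad2 f y * pmf \<phi> y) ?C" if "y \<in> ?C" for y
  proof -
    have "fin_nz G (\<lambda>x. (f (x \<otimes> y) - f x)\<^sup>2)" using f that by simp
    then have "((\<lambda>x. (f (x \<otimes> y) - f x)\<^sup>2) has_sum grad2 f y) ?C"
      unfolding grad2_def by (intro has_sum_infsum fin_nz_summable)
    from has_sum_cmult_left[OF this, of "pmf \<phi> y"] show ?thesis by (simp add: H_def)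
  qed
  have outer: "((\<lambda>y. grad2 f y * pmf \<phi> y) has_sum mean \<phi> (grad2 f)) ?C"
    using grad2_nonneg grad2_le[OF f] by (intro pmf_has_sum[OF \<phi>, where B = "4 * sq f"]) auto
  have summ: "H summable_on Sigma ?C (\<lambda>_. ?C)"
    by (rule summable_on_SigmaI[OF inner has_sum_imp_summable[OF outer]]) (auto simp: H_def)
  have "(H has_sum mean \<phi> (grad2 f)) (?C \<times> ?C)"
    by (rule has_sum_SigmaI[OF inner outer summ])
  moreover have "bij_betw prod.swap (?C \<times> ?C) (?C \<times> ?C)" by (simp add: bij_betw_def product_swap)
  ultimately have "((\<lambda>p. H (prod.swap p)) has_sum mean \<phi> (grad2 f)) (?C \<times> ?C)"
    by (simp add: has_sum_reindex_bij_betw)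
  then show ?thesis
    unfolding dirichlet_form_def by (simp add: H_def case_prod_unfold infsumI)
qed

lemma integrable_grad2:
  assumes \<phi>: "set_pmf \<phi> \<subseteq> carrier G" and f: "fin_nz G f"
  shows "integrable (measure_pmf \<phi>) (grad2 f)"
  using \<phi> grad2_le[OF f] grad2_nonneg
  by (intro measure_pmf.integrable_const_bound[where B = "4 * sq f"]) (auto simp: AE_measure_pmf_iff)

lemma dirichlet_corr:
  assumes \<phi>: "set_pmf \<phi> \<subseteq> carrier G" and f: "fin_nz G f"
  shows "form \<phi> f = sq f - mean \<phi> (corr f)"
proof -
  have int: "integrable (measure_pmf \<phi>) (corr f)"
  proof (rule measure_pmf.integrable_const_bound[where B = "sq f"])
    show "AE y in measure_pmf \<phi>. norm (corr f y) \<le> sq f"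
      unfolding AE_measure_pmf_iff
    proof
      fix y assume "y \<in> set_pmf \<phi>"
      then have "y \<in> carrier G" using \<phi> by auto
      from corr_bounds[OF f this] show "norm (corr f y) \<le> sq f" by simp
    qed
  qed simp
  have "mean \<phi> (grad2 f) = mean \<phi> (\<lambda>y. 2 * sq f - 2 * corr f y)"
    using \<phi> grad2_eq[OF f] by (intro integral_cong_AE) (auto simp: AE_measure_pmf_iff)
  also have "\<dots> = 2 * sq f - 2 * mean \<phi> (corr f)"
    using int by simp
  finally show ?thesis by (simp add: dirichlet_grad2[OF assms])
qed

lemma dirichlet_finite_sum:
  assumes f: "fin_nz G f"
  obtains D where "finite D" "D \<subseteq> carrier G"
    "\<And>\<phi>. set_pmf \<phi> \<subseteq> carrier G \<Longrightarrow> form \<phi> f = sq f - (\<Sum>y\<in>D. pmf \<phi> y * corr f y)"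
proof -
  obtain D where D: "finite D" "D \<subseteq> carrier G" "\<And>y. y \<in> carrier G \<Longrightarrow> y \<notin> D \<Longrightarrow> corr f y = 0"
    using corr_finite_support[OF f] by blast
  show ?thesis
  proof (rule that[OF D(1,2)])
    fix \<phi> assume \<phi>: "set_pmf \<phi> \<subseteq> carrier G"
    have "mean \<phi> (corr f) = (\<Sum>y\<in>D. pmf \<phi> y *\<^sub>R corr f y)"
      using D(3) \<phi> by (intro integral_measure_pmf[OF D(1)]) auto
    then show "form \<phi> f = sq f - (\<Sum>y\<in>D. pmf \<phi> y * corr f y)"
      by (simp add: dirichlet_corr[OF \<phi> f])
  qed
qed

lemma dirichlet_nonneg: "0 \<le> form \<phi> f"
  unfolding dirichlet_form_def by (auto intro!: mult_nonneg_nonneg infsum_nonneg)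

lemma dirichlet_le:
  assumes "set_pmf \<phi> \<subseteq> carrier G" and f: "fin_nz G f"
  shows "form \<phi> f \<le> 2 * sq f"
proof -
  have "mean \<phi> (grad2 f) \<le> 4 * sq f"
    using assms grad2_le[OF f] grad2_nonneg
    by (intro measure_pmf.integral_le_const integrable_grad2) (auto simp: AE_measure_pmf_iff)
  then show ?thesis by (simp add: dirichlet_grad2[OF assms])
qed

lemma dirichlet_abs_le:
  assumes \<phi>: "set_pmf \<phi> \<subseteq> carrier G" and f: "fin_nz G f"
  shows "form \<phi> (\<lambda>x. \<bar>f x\<bar>) \<le> form \<phi> f"
proof -
  have le: "grad2 (\<lambda>x. \<bar>f x\<bar>) y \<le> grad2 f y" if "y \<in> carrier G" for y
    unfolding grad2_def using f that
    by (intro total_mono) (auto simp: abs_le_square_iff[symmetric])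
  have "mean \<phi> (grad2 (\<lambda>x. \<bar>f x\<bar>)) \<le> mean \<phi> (grad2 f)"
    using \<phi> le f by (intro integral_mono_AE integrable_grad2) (auto simp: AE_measure_pmf_iff)
  then show ?thesis using \<phi> f by (simp add: dirichlet_grad2)
qed

text \<open>A form sees only finitely many values of the measure, so a mixture can be expanded term by term.\<close>

lemma dirichlet_mixture:
  fixes w :: "nat \<Rightarrow> real"
  assumes f: "fin_nz G f" and w: "w sums 1"
    and q: "\<And>n. set_pmf (q n) \<subseteq> carrier G" and \<phi>: "set_pmf \<phi> \<subseteq> carrier G"
    and mix: "\<And>y. (\<lambda>n. w n * pmf (q n) y) sums pmf \<phi> y"
  shows "(\<lambda>n. w n * form (q n) f) sums form \<phi> f"
proof -
  obtain D where D: "finite D"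
    "\<And>\<phi>. set_pmf \<phi> \<subseteq> carrier G \<Longrightarrow> form \<phi> f = sq f - (\<Sum>y\<in>D. pmf \<phi> y * corr f y)"
    using dirichlet_finite_sum[OF f] by metis
  have "(\<lambda>n. w n * sq f - (\<Sum>y\<in>D. (w n * pmf (q n) y) * corr f y)) sums
      (1 * sq f - (\<Sum>y\<in>D. pmf \<phi> y * corr f y))"
    by (intro sums_diff sums_sum sums_mult2 w mix)
  then show ?thesis
    by (simp add: D(2) q \<phi> right_diff_distrib sum_distrib_left mult.assoc)
qed

definition test_fun :: "real \<Rightarrow> ('a \<Rightarrow> real) \<Rightarrow> bool" where
  "test_fun v f \<longleftrightarrow> fin_nz G f \<and> real (card (supp f)) \<le> v \<and> sq f = 1"

lemma profile_eq: "profile \<phi> v = Inf {form \<phi> f | f. test_fun v f}"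
  by (simp add: spectral_profile_def test_fun_def fin_nz_def)

lemma profile_le: "test_fun v f \<Longrightarrow> profile \<phi> v \<le> form \<phi> f"
  unfolding profile_eq by (intro cInf_lower bdd_belowI[of _ 0]) (auto simp: dirichlet_nonneg)

lemma test_fun_delta: "1 \<le> v \<Longrightarrow> test_fun v (indicator {\<one>})"
proof -
  assume v: "1 \<le> v"
  have "{x \<in> carrier G. indicator {\<one>} x \<noteq> (0::real)} = {\<one>}" by (auto simp: indicator_def)
  moreover have "(\<lambda>x. (indicator {\<one>} x :: real)\<^sup>2) = indicator {\<one>}" by (auto simp: indicator_def)
  ultimately show ?thesis using v total_indicator[of "{\<one>}"] by (simp add: test_fun_def)
qed

lemma profile_greatest:
  assumes "1 \<le> v" "\<And>f. test_fun v f \<Longrightarrow> c \<le> form \<phi> f"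
  shows "c \<le> profile \<phi> v"
  unfolding profile_eq using assms test_fun_delta[of v] by (intro cInf_greatest) auto

lemma profile_nonneg: "1 \<le> v \<Longrightarrow> 0 \<le> profile \<phi> v"
  by (intro profile_greatest dirichlet_nonneg)

lemma profile_approx:
  assumes "1 \<le> v" "profile \<phi> v < e"
  obtains f where "test_fun v f" "form \<phi> f < e"
  using cInf_lessD[of "{form \<phi> f | f. test_fun v f}" e] test_fun_delta[of v] assms
  unfolding profile_eq by auto

lemma profile_le_2:
  assumes "1 \<le> v" "set_pmf \<phi> \<subseteq> carrier G"
  shows "profile \<phi> v \<le> 2"
  using profile_le[OF test_fun_delta[OF assms(1)], of \<phi>] dirichlet_le[OF assms(2), of "indicator {\<one>}"]
    test_fun_delta[OF assms(1)] by (simp add: test_fun_def)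

end

section \<open>The averaging operator of a symmetric set\<close>

locale symmetric_walk = group +
  fixes X :: "'a set"
  assumes X_finite: "finite X" and X_carrier: "X \<subseteq> carrier G" and X_one: "\<one> \<in> X"
    and X_inv: "\<And>x. x \<in> X \<Longrightarrow> inv x \<in> X"
begin

abbreviation N :: real where "N \<equiv> real (card X)"

abbreviation u :: "'a pmf" where "u \<equiv> pmf_of_set X"

abbreviation u_pow :: "nat \<Rightarrow> 'a pmf" where "u_pow \<equiv> convolution_power G u"

definition avg :: "('a \<Rightarrow> real) \<Rightarrow> 'a \<Rightarrow> real" where
  "avg f x = (\<Sum>y\<in>X. f (x \<otimes> y)) / N"

lemma X_nonempty: "X \<noteq> {}" using X_one by auto

lemma N_ge_1: "1 \<le> N"
  using X_finite X_nonempty by (metis One_nat_def Suc_leI card_gt_0_iff of_nat_1 of_nat_le_iff)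

lemma X_in_carrier: "y \<in> X \<Longrightarrow> y \<in> carrier G" using X_carrier by auto

lemma set_u: "set_pmf u = X" using X_finite X_nonempty by simp

lemma fin_nz_avg [intro, simp]: "fin_nz G f \<Longrightarrow> fin_nz G (avg f)"
  unfolding avg_def by (auto simp: X_in_carrier)

lemma fin_nz_avg_pow [intro, simp]: "fin_nz G f \<Longrightarrow> fin_nz G ((avg ^^ n) f)"
  by (induction n) auto

lemma total_avg: "fin_nz G f \<Longrightarrow> total (avg f) = total f"
proof -
  assume f: "fin_nz G f"
  have "total (avg f) = total (\<lambda>x. (1 / N) * (\<Sum>y\<in>X. f (x \<otimes> y)))" by (simp add: avg_def)
  also have "\<dots> = (1 / N) * (\<Sum>y\<in>X. total (\<lambda>x. f (x \<otimes> y)))"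
    using f by (simp only: total_cmult) (subst total_sum, auto simp: X_finite X_in_carrier)
  also have "(\<Sum>y\<in>X. total (\<lambda>x. f (x \<otimes> y))) = (\<Sum>y\<in>X. total f)"
    by (intro sum.cong total_shift refl X_in_carrier)
  also have "(1 / N) * \<dots> = total f" using N_ge_1 by simp
  finally show ?thesis .
qed

lemma total_avg_pow: "fin_nz G f \<Longrightarrow> total ((avg ^^ n) f) = total f"
  by (induction n) (auto simp: total_avg)

lemma ip_avg:
  assumes "fin_nz G f"
  shows "ip f (avg g) = (\<Sum>y\<in>X. ip f (\<lambda>x. g (x \<otimes> y))) / N"
proof -
  have "ip f (avg g) = total (\<lambda>x. (1 / N) * (\<Sum>y\<in>X. f x * g (x \<otimes> y)))"
    by (intro infsum_cong) (simp add: avg_def sum_distrib_left sum_divide_distrib)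
  also have "\<dots> = (1 / N) * (\<Sum>y\<in>X. ip f (\<lambda>x. g (x \<otimes> y)))"
    using assms by (simp only: total_cmult) (subst total_sum, auto simp: X_finite)
  finally show ?thesis by simp
qed

lemma sum_X_inv: "(\<Sum>y\<in>X. F (inv y)) = (\<Sum>y\<in>X. F y)"
  by (rule sum.reindex_bij_witness[of _ "\<lambda>y. inv y" "\<lambda>y. inv y"]) (auto simp: X_inv X_in_carrier)

lemma ip_avg_sym:
  assumes "fin_nz G f" "fin_nz G g"
  shows "ip f (avg g) = ip (avg f) g"
proof -
  have "ip f (\<lambda>x. g (x \<otimes> y)) = ip g (\<lambda>x. f (x \<otimes> inv y))" if "y \<in> X" for y
  proof -
    have y: "y \<in> carrier G" using that X_in_carrier by auto
    have "ip f (\<lambda>x. g (x \<otimes> y)) = total (\<lambda>x. (\<lambda>z. f z * g (z \<otimes> y)) (x \<otimes> inv y))"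
      using y by (subst total_shift) auto
    also have "\<dots> = ip g (\<lambda>x. f (x \<otimes> inv y))"
      using y by (intro infsum_cong) (auto simp: m_assoc)
    finally show ?thesis .
  qed
  then have "(\<Sum>y\<in>X. ip f (\<lambda>x. g (x \<otimes> y))) = (\<Sum>y\<in>X. ip g (\<lambda>x. f (x \<otimes> inv y)))"
    by (intro sum.cong) auto
  also have "\<dots> = (\<Sum>y\<in>X. ip g (\<lambda>x. f (x \<otimes> y)))" by (rule sum_X_inv)
  finally have "ip f (avg g) = ip g (avg f)" using assms by (simp add: ip_avg)
  then show ?thesis by (simp add: mult.commute)
qed

lemma ip_shift_le:
  assumes "fin_nz G f" "fin_nz G g" "y \<in> carrier G"
  shows "ip f (\<lambda>x. g (x \<otimes> y)) \<le> (sq f + sq g) / 2"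
  using ip_le_half[OF assms(1) fin_nz_shift[OF assms(2,3)]] sq_shift[OF assms(3), of g] by simp

lemma ip_avg_le:
  assumes "fin_nz G f" "fin_nz G g"
  shows "ip f (avg g) \<le> (sq f + sq g) / 2"
proof -
  have "(\<Sum>y\<in>X. ip f (\<lambda>x. g (x \<otimes> y))) \<le> (\<Sum>y\<in>X. (sq f + sq g) / 2)"
    by (intro sum_mono ip_shift_le assms X_in_carrier)
  then show ?thesis using N_ge_1 by (simp add: ip_avg[OF assms(1)] field_simps)
qed

text \<open>\<open>\<parallel>avg f\<parallel>\<^sup>2 = \<langle>avg f, avg f\<rangle>\<close> is at most the arithmetic mean of \<open>\<parallel>avg f\<parallel>\<^sup>2\<close> and \<open>\<parallel>f\<parallel>\<^sup>2\<close>.\<close>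

lemma sq_avg_le:
  assumes "fin_nz G f"
  shows "sq (avg f) \<le> sq f"
  using ip_avg_le[of "avg f" f] assms by (simp add: power2_eq_square)

lemma sq_avg_pow_antimono:
  assumes "fin_nz G f" "m \<le> n"
  shows "sq ((avg ^^ n) f) \<le> sq ((avg ^^ m) f)"
  using assms(2)
proof (induction n rule: dec_induct)
  case (step n)
  have "sq ((avg ^^ Suc n) f) \<le> sq ((avg ^^ n) f)" using assms(1) by (simp add: sq_avg_le)
  then show ?case using step by simp
qed simp

lemma dirichlet_u:
  assumes "fin_nz G f"
  shows "form u f = (\<Sum>y\<in>X. grad2 f y) / (2 * N)"
    and "form u f = sq f - ip f (avg f)"
proof -
  have u: "set_pmf u \<subseteq> carrier G" using set_u X_carrier by simp
  show "form u f = (\<Sum>y\<in>X. grad2 f y) / (2 * N)"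
    using X_finite X_nonempty by (simp add: dirichlet_grad2[OF u assms] integral_pmf_of_set)
  have "mean u (corr f) = ip f (avg f)"
    using X_finite X_nonempty assms by (simp add: integral_pmf_of_set ip_avg corr_def)
  then show "form u f = sq f - ip f (avg f)"
    by (simp add: dirichlet_corr[OF u assms])
qed

text \<open>The step by \<open>\<one>\<close>, taken with probability \<open>1 / N\<close>, makes the walk lazy. Without it the spectrum of the
  averaging operator could reach down to \<open>-1\<close>, where the norm does not drop although the energy is large.\<close>

lemma dirichlet_u_le_decrement:
  assumes "fin_nz G f"
  shows "form u f \<le> N * (sq f - sq (avg f))"
proof -
  have "sq (avg f) = ip (avg f) (avg f)" by (simp add: power2_eq_square)
  also have "\<dots> = (\<Sum>y\<in>X. ip (avg f) (\<lambda>x. f (x \<otimes> y))) / N"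
    using assms by (intro ip_avg) auto
  also have "(\<Sum>y\<in>X. ip (avg f) (\<lambda>x. f (x \<otimes> y)))
      = ip (avg f) (\<lambda>x. f (x \<otimes> \<one>)) + (\<Sum>y\<in>X - {\<one>}. ip (avg f) (\<lambda>x. f (x \<otimes> y)))"
    using X_finite X_one by (rule sum.remove)
  also have "ip (avg f) (\<lambda>x. f (x \<otimes> \<one>)) = ip (avg f) f"
    by (intro infsum_cong) simp
  also have "\<dots> = ip f (avg f)" by (simp add: mult.commute)
  finally have "N * sq (avg f) = ip f (avg f) + (\<Sum>y\<in>X - {\<one>}. ip (avg f) (\<lambda>x. f (x \<otimes> y)))"
    using N_ge_1 by (simp add: field_simps)
  also have "(\<Sum>y\<in>X - {\<one>}. ip (avg f) (\<lambda>x. f (x \<otimes> y))) \<le> (\<Sum>y\<in>X - {\<one>}. sq f)"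
  proof (rule sum_mono)
    fix y assume "y \<in> X - {\<one>}"
    then have "ip (avg f) (\<lambda>x. f (x \<otimes> y)) \<le> (sq (avg f) + sq f) / 2"
      using assms by (intro ip_shift_le) (auto simp: X_in_carrier)
    then show "ip (avg f) (\<lambda>x. f (x \<otimes> y)) \<le> sq f" using sq_avg_le[OF assms] by simp
  qed
  also have "\<dots> = (N - 1) * sq f"
    using X_finite X_one N_ge_1 by (simp add: card_Diff_singleton of_nat_diff)
  finally show ?thesis by (simp add: dirichlet_u(2)[OF assms] algebra_simps)
qed

lemma u_pow_Suc: "u_pow (Suc n) = bind_pmf u (\<lambda>a. map_pmf (\<lambda>y. a \<otimes> y) (u_pow n))"
  by (simp add: convolution_def pair_pmf_def map_bind_pmf map_pmf_def bind_assoc_pmf bind_return_pmf)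

declare convolution_power.simps(2) [simp del]

lemma u_pow_carrier: "set_pmf (u_pow n) \<subseteq> carrier G" and u_pow_finite: "finite (set_pmf (u_pow n))"
proof (induction n)
  case (Suc n)
  case 1 then show ?case
    using Suc X_carrier unfolding u_pow_Suc by (auto simp: set_u)
  case 2 then show ?case
    using Suc X_finite unfolding u_pow_Suc by (auto simp: set_u)
qed auto

lemma u_pow_expectation:
  assumes "x \<in> carrier G"
  shows "mean (u_pow n) (\<lambda>y. f (x \<otimes> y)) = (avg ^^ n) f x"
  using assms
proof (induction n arbitrary: x)
  case (Suc n)
  have "mean (u_pow (Suc n)) (\<lambda>y. f (x \<otimes> y))
      = (\<Sum>a\<in>X. pmf u a *\<^sub>R mean (map_pmf (\<lambda>y. a \<otimes> y) (u_pow n)) (\<lambda>y. f (x \<otimes> y)))"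
    unfolding u_pow_Suc using X_finite u_pow_finite by (intro pmf_expectation_bind) (auto simp: set_u)
  also have "\<dots> = (\<Sum>a\<in>X. (avg ^^ n) f (x \<otimes> a) / N)"
  proof (rule sum.cong[OF refl])
    fix a assume a: "a \<in> X"
    then have a': "a \<in> carrier G" by (rule X_in_carrier)
    have "mean (u_pow n) (\<lambda>y. f (x \<otimes> (a \<otimes> y)))
        = mean (u_pow n) (\<lambda>y. f (x \<otimes> a \<otimes> y))"
      using u_pow_carrier[of n] Suc.prems a'
      by (intro integral_cong_AE) (auto simp: AE_measure_pmf_iff m_assoc subset_iff)
    also have "\<dots> = (avg ^^ n) f (x \<otimes> a)" using Suc a' by auto
    finally show "pmf u a *\<^sub>R mean (map_pmf (\<lambda>y. a \<otimes> y) (u_pow n)) (\<lambda>y. f (x \<otimes> y))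
        = (avg ^^ n) f (x \<otimes> a) / N"
      using a X_finite X_nonempty by (simp add: pmf_of_set)
  qed
  also have "\<dots> = (avg ^^ Suc n) f x" by (simp add: avg_def sum_divide_distrib)
  finally show ?case .
qed auto

lemma dirichlet_u_pow:
  assumes f: "fin_nz G f"
  shows "form (u_pow n) f = sq f - ip f ((avg ^^ n) f)"
proof -
  let ?A = "supp f"
  have A: "finite ?A" using f by (simp add: fin_nz_def)
  have "corr f = (\<lambda>y. \<Sum>x\<in>?A. f x * f (x \<otimes> y))"
    unfolding corr_def using A by (intro ext total_eq_sum) auto
  then have "mean (u_pow n) (corr f)
      = mean (u_pow n) (\<lambda>y. \<Sum>x\<in>?A. f x * f (x \<otimes> y))" by simp
  also have "\<dots> = (\<Sum>x\<in>?A. f x * mean (u_pow n) (\<lambda>y. f (x \<otimes> y)))"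
    using u_pow_finite by (subst Bochner_Integration.integral_sum) (auto intro: integrable_measure_pmf_finite)
  also have "\<dots> = (\<Sum>x\<in>?A. f x * (avg ^^ n) f x)"
    by (intro sum.cong) (auto simp: u_pow_expectation)
  also have "\<dots> = ip f ((avg ^^ n) f)" using A by (subst total_eq_sum[of ?A]) auto
  finally show ?thesis by (simp add: dirichlet_corr[OF u_pow_carrier f])
qed

lemma ip_avg_pow:
  assumes "fin_nz G f" "fin_nz G g"
  shows "ip f ((avg ^^ n) g) = ip ((avg ^^ n) f) g"
  using assms
proof (induction n arbitrary: f)
  case (Suc n)
  have "ip f ((avg ^^ Suc n) g) = ip (avg f) ((avg ^^ n) g)"
    using Suc.prems by (simp add: ip_avg_sym)
  also have "\<dots> = ip ((avg ^^ Suc n) f) g" using Suc by (simp add: funpow_swap1)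
  finally show ?case .
qed simp

text \<open>Half of the steps are moved to the other factor. If \<open>n\<close> is odd, one averaging remains and is a
  contraction.\<close>

lemma ip_avg_pow_le:
  assumes f: "fin_nz G f" and n: "2 * m \<le> n"
  shows "ip f ((avg ^^ n) f) \<le> sq ((avg ^^ m) f)"
proof -
  define k where "k = n div 2"
  let ?g = "(avg ^^ k) f"
  have g: "fin_nz G ?g" using f by simp
  have k: "m \<le> k" using n by (simp add: k_def)
  have "ip f ((avg ^^ n) f) \<le> sq ?g"
  proof (cases "even n")
    case True
    then have "n = k + k" by (auto simp: k_def)
    then have "(avg ^^ n) f = (avg ^^ k) ?g" by (simp only: funpow_add o_apply)
    then show ?thesis using ip_avg_pow[OF f g, of k] by (simp add: power2_eq_square)
  next
    case False
    then have "n = k + Suc k" unfolding k_def by presburger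
    then have "(avg ^^ n) f = (avg ^^ k) (avg ?g)" by (simp only: funpow_add o_apply funpow.simps)
    then have "ip f ((avg ^^ n) f) = ip ?g (avg ?g)" using ip_avg_pow[OF f fin_nz_avg[OF g], of k] by simp
    then show ?thesis using ip_avg_le[OF g g] by simp
  qed
  then show ?thesis using sq_avg_pow_antimono[OF f k] by linarith
qed

lemma avg_nonneg: "(\<And>x. x \<in> carrier G \<Longrightarrow> 0 \<le> f x) \<Longrightarrow> x \<in> carrier G \<Longrightarrow> 0 \<le> avg f x"
  unfolding avg_def by (intro divide_nonneg_nonneg sum_nonneg) (auto simp: X_in_carrier)

lemma avg_pow_nonneg: "(\<And>x. x \<in> carrier G \<Longrightarrow> 0 \<le> f x) \<Longrightarrow> x \<in> carrier G \<Longrightarrow> 0 \<le> (avg ^^ n) f x"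
  by (induction n arbitrary: x) (auto intro!: avg_nonneg)

lemma total_le_sqrt:
  assumes f: "test_fun v f"
  shows "total f \<le> sqrt v"
proof -
  let ?A = "supp f"
  have A: "finite ?A" "real (card ?A) \<le> v" "sq f = 1" using f by (auto simp: test_fun_def fin_nz_def)
  have "(total f)\<^sup>2 = (\<Sum>x\<in>?A. f x * 1)\<^sup>2" using A by (subst total_eq_sum[of ?A]) auto
  also have "\<dots> \<le> (\<Sum>x\<in>?A. (f x)\<^sup>2) * (\<Sum>x\<in>?A. 1\<^sup>2)" by (rule Cauchy_Schwarz_ineq_sum)
  also have "(\<Sum>x\<in>?A. (f x)\<^sup>2) = sq f" using A by (subst total_eq_sum[of ?A]) auto
  also have "sq f * (\<Sum>x\<in>?A. 1\<^sup>2) \<le> v" using A by simp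
  finally show ?thesis by (rule real_le_rsqrt)
qed

text \<open>If \<open>m\<close> averagings remove at most half of the squared norm, one of them removes at most
  \<open>1 / (2 m)\<close>, which bounds the energy of the function \<open>F\<close> before this step. Averaging spreads the
  support, but it preserves the total, which is at most \<open>sqrt v\<close>; therefore \<open>F\<close> exceeds the height
  \<open>1 / (8 sqrt v)\<close> at no more than \<open>8 v\<close> points, and cutting it off below this height takes at most
  \<open>1/4\<close> from the squared norm.\<close>

lemma slow_decay_imp_small_energy:
  assumes f: "test_fun v f" and pos: "\<And>x. x \<in> carrier G \<Longrightarrow> 0 \<le> f x" and v: "1 \<le> v"
    and m: "1 \<le> m" and slow: "1/2 \<le> sq ((avg ^^ m) f)"
  obtains g where "fin_nz G g" "\<And>x. x \<in> carrier G \<Longrightarrow> 0 \<le> g x" "1/4 \<le> sq g"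
    "real (card (supp g)) \<le> 8 * v" "form u g \<le> N / (2 * real m)"
proof -
  have fin: "fin_nz G f" and sq1: "sq f = 1" using f by (auto simp: test_fun_def)
  let ?a = "\<lambda>j. sq ((avg ^^ j) f)"
  have "\<exists>j<m. ?a j - ?a (Suc j) \<le> 1 / (2 * real m)"
  proof (rule ccontr)
    assume "\<not> ?thesis"
    then have "(\<Sum>j<m. 1 / (2 * real m)) < (\<Sum>j<m. ?a j - ?a (Suc j))"
      using m by (intro sum_strict_mono) (auto simp: not_le lessThan_empty_iff)
    also have "\<dots> = ?a 0 - ?a m" by (rule sum_lessThan_telescope')
    finally show False using m slow sq1 by simp
  qed
  then obtain j where j: "j < m" "?a j - ?a (Suc j) \<le> 1 / (2 * real m)" by blast
  define F where "F = (avg ^^ j) f"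
  have F: "fin_nz G F" "\<And>x. x \<in> carrier G \<Longrightarrow> 0 \<le> F x"
    using fin avg_pow_nonneg[OF pos] by (auto simp: F_def)
  have "form u F \<le> N * (?a j - ?a (Suc j))"
    using dirichlet_u_le_decrement[OF F(1)] by (simp add: F_def)
  also have "\<dots> \<le> N * (1 / (2 * real m))" using j by (intro mult_left_mono) auto
  finally have EF: "form u F \<le> N / (2 * real m)" by simp
  have sqF: "1/2 \<le> sq F"
    using sq_avg_pow_antimono[OF fin, of j m] j slow by (simp add: F_def)
  have totF: "total F \<le> sqrt v"
    using total_avg_pow[OF fin] total_le_sqrt[OF f] by (simp add: F_def)
  define s where "s = 1 / (8 * sqrt v)"
  have s: "s > 0" using v by (simp add: s_def)
  define g where "g = (\<lambda>x. max (F x - s) 0)"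
  have nz: "F x \<noteq> 0 \<and> s \<le> F x" if "x \<in> carrier G" "g x \<noteq> 0" for x
    using that s by (auto simp: g_def max_def split: if_splits)
  have g: "fin_nz G g" using F(1) by (rule fin_nz_mono) (use s in \<open>auto simp: g_def\<close>)
  have "sq F - 2 * s * total F = total (\<lambda>x. (F x)\<^sup>2 - (2 * s) * F x)"
    using F(1) by (subst total_diff, simp, simp, subst total_cmult, simp)
  also have "\<dots> \<le> sq g"
  proof (intro total_mono)
    fix x assume x: "x \<in> carrier G"
    show "(F x)\<^sup>2 - (2 * s) * F x \<le> (g x)\<^sup>2"
    proof (cases "F x \<le> s")
      case True
      then have "F x * F x \<le> s * F x" using F(2)[OF x] by (intro mult_right_mono) auto
      moreover have "0 \<le> s * F x" using s F(2)[OF x] by simp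
      ultimately show ?thesis using True by (simp add: g_def power2_eq_square max_def)
    next
      case False
      then show ?thesis by (simp add: g_def power2_diff max_def)
    qed
  qed (use F g in auto)
  finally have "sq F - 2 * s * total F \<le> sq g" .
  moreover have "s * total F \<le> 1 / 8"
    using mult_left_mono[OF totF, of s] s v by (simp add: s_def)
  ultimately have sqg: "1/4 \<le> sq g" using sqF by linarith
  have "s * real (card (supp g)) = (\<Sum>x\<in>supp g. s)" by simp
  also have "\<dots> \<le> (\<Sum>x\<in>supp g. F x)" using nz by (intro sum_mono) auto
  also have "\<dots> \<le> (\<Sum>x\<in>supp F. F x)"
    using F nz by (intro sum_mono2) (auto simp: fin_nz_def)
  also have "\<dots> = total F" using F(1) by (subst total_eq_sum[of "supp F"]) (auto simp: fin_nz_def)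
  finally have "s * real (card (supp g)) \<le> sqrt v" using totF by linarith
  then have "real (card (supp g)) \<le> sqrt v / s"
    using s by (simp add: pos_le_divide_eq mult.commute)
  also have "sqrt v / s = 8 * (sqrt v * sqrt v)" by (simp add: s_def)
  finally have card: "real (card (supp g)) \<le> 8 * v" using v by simp
  have "grad2 g y \<le> grad2 F y" if "y \<in> X" for y
    unfolding grad2_def
  proof (intro total_mono)
    fix x
    have "\<bar>g (x \<otimes> y) - g x\<bar> \<le> \<bar>F (x \<otimes> y) - F x\<bar>" by (auto simp: g_def)
    then show "(g (x \<otimes> y) - g x)\<^sup>2 \<le> (F (x \<otimes> y) - F x)\<^sup>2" by (simp only: abs_le_square_iff)
  qed (use F(1) g X_in_carrier[OF that] in auto)
  then have "form u g \<le> form u F"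
    using F(1) g by (simp add: dirichlet_u(1) divide_right_mono sum_mono)
  then show ?thesis using EF by (intro that[OF g _ sqg card]) (auto simp: g_def)
qed

section \<open>Edge boundaries and the Cheeger inequality\<close>

text \<open>The size of the edge boundary in the right Cayley graph of \<open>X\<close>, on which left translations act as
  automorphisms.\<close>

definition bd :: "'a set \<Rightarrow> nat" where
  "bd A = (\<Sum>y\<in>X. card {x \<in> A. x \<otimes> y \<notin> A})"

lemma grad_indicator:
  assumes A: "finite A" "A \<subseteq> carrier G" and y: "y \<in> carrier G"
  shows "total (\<lambda>x. \<bar>indicator A (x \<otimes> y) - indicator A x\<bar>) = 2 * real (card {x \<in> A. x \<otimes> y \<notin> A})"
proof -
  let ?B = "{x \<in> A. x \<otimes> y \<notin> A}"
  have B: "finite ?B" "?B \<subseteq> carrier G" using A by auto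
  have "total (\<lambda>x. \<bar>indicator A (x \<otimes> y) - indicator A x\<bar>)
      = total (\<lambda>x. 2 * indicator ?B x + (indicator A (x \<otimes> y) - indicator A x))"
    by (intro infsum_cong) (auto simp: indicator_def)
  also have "\<dots> = 2 * total (indicator ?B) + (total (\<lambda>x. indicator A (x \<otimes> y)) - total (indicator A))"
    using fin_nz_indicator[OF A(1)] fin_nz_indicator[OF B(1)] y
    by (subst total_add, simp, simp, subst total_diff, simp, simp, subst total_cmult, simp)
  also have "total (\<lambda>x. indicator A (x \<otimes> y)) = total (indicator A)" by (rule total_shift[OF y])
  finally show ?thesis using total_indicator[OF B] by simp
qed

lemma dirichlet_indicator:
  assumes A: "finite A" "A \<subseteq> carrier G"
  shows "form u (indicator A) = real (bd A) / N"
proof -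
  have "grad2 (indicator A) y = 2 * real (card {x \<in> A. x \<otimes> y \<notin> A})" if "y \<in> X" for y
  proof -
    have "grad2 (indicator A) y = total (\<lambda>x. \<bar>indicator A (x \<otimes> y) - indicator A x\<bar>)"
      unfolding grad2_def by (intro infsum_cong) (auto simp: indicator_def)
    then show ?thesis using grad_indicator[OF A X_in_carrier[OF that]] by simp
  qed
  then have "(\<Sum>y\<in>X. grad2 (indicator A) y) = 2 * real (bd A)"
    by (simp add: bd_def sum_distrib_left)
  then show ?thesis using dirichlet_u(1)[OF fin_nz_indicator[OF A(1)]] by simp
qed

text \<open>Peel off the superlevel sets of \<open>g\<close> from the bottom: subtracting the smallest positive value on the
  whole support \<open>A\<close> lowers the left side of the hypothesis by a multiple of \<open>2 bd A\<close> and the total by the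
  same multiple of \<open>card A\<close>. So either \<open>A\<close> is good or the hypothesis survives with a smaller support.\<close>

lemma coarea:
  assumes "fin_nz G g" "\<And>x. x \<in> carrier G \<Longrightarrow> 0 \<le> g x" "0 < total g"
    and "(\<Sum>y\<in>X. total (\<lambda>x. \<bar>g (x \<otimes> y) - g x\<bar>)) \<le> \<eta> * total g"
  shows "\<exists>A \<subseteq> supp g. A \<noteq> {} \<and> 2 * real (bd A) \<le> \<eta> * real (card A)"
  using assms
proof (induction "card (supp g)" arbitrary: g rule: less_induct)
  case less
  define A where "A = supp g"
  have A: "finite A" "A \<subseteq> carrier G" using less.prems by (auto simp: A_def fin_nz_def)
  have "A \<noteq> {}" using total_pos_imp_nz[of g] less.prems by (auto simp: A_def)
  define c where "c = Min (g ` A)"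
  have gA: "0 < g x" if "x \<in> A" for x using less.prems(2)[of x] that by (auto simp: A_def less_le)
  have "c \<in> g ` A" unfolding c_def using A \<open>A \<noteq> {}\<close> by (intro Min_in) auto
  then obtain a where a: "a \<in> A" "g a = c" by auto
  have c0: "0 < c" using gA a by auto
  have c_le: "c \<le> g x" if "x \<in> A" for x unfolding c_def using A that by (intro Min_le) auto
  define g' where "g' = (\<lambda>x. g x - c * indicator A x)"
  have ind: "fin_nz G (indicator A)" using A by simp
  have fin': "fin_nz G g'" unfolding g'_def using less.prems(1) ind by simp
  have pos': "0 \<le> g' x" if "x \<in> carrier G" for x
    using that c_le less.prems(2) by (auto simp: g'_def indicator_def)
  have nz': "x \<in> A" if "x \<in> carrier G" "g' x \<noteq> 0" for x
    using that by (auto simp: g'_def A_def indicator_def)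
  have tot': "total g' = total g - c * real (card A)"
    unfolding g'_def using less.prems(1) ind total_indicator[OF A]
    by (subst total_diff, simp, simp, subst total_cmult, simp)
  have grad: "total (\<lambda>x. \<bar>g (x \<otimes> y) - g x\<bar>)
      = total (\<lambda>x. \<bar>g' (x \<otimes> y) - g' x\<bar>) + c * (2 * real (card {x \<in> A. x \<otimes> y \<notin> A}))" if "y \<in> X" for y
  proof -
    have y: "y \<in> carrier G" using that by (rule X_in_carrier)
    have "total (\<lambda>x. \<bar>g (x \<otimes> y) - g x\<bar>)
        = total (\<lambda>x. \<bar>g' (x \<otimes> y) - g' x\<bar> + c * \<bar>indicator A (x \<otimes> y) - indicator A x\<bar>)"
    proof (intro infsum_cong)
      fix x assume x: "x \<in> carrier G"
      have 0: "z \<in> carrier G \<Longrightarrow> z \<notin> A \<Longrightarrow> g z = 0" for z by (auto simp: A_def)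
      show "\<bar>g (x \<otimes> y) - g x\<bar> = \<bar>g' (x \<otimes> y) - g' x\<bar> + c * \<bar>indicator A (x \<otimes> y) - indicator A x\<bar>"
        using c_le[of x] c_le[of "x \<otimes> y"] c0 0[of x] 0[of "x \<otimes> y"] x y
        by (cases "x \<in> A"; cases "x \<otimes> y \<in> A") (auto simp: g'_def)
    qed
    also have "\<dots> = total (\<lambda>x. \<bar>g' (x \<otimes> y) - g' x\<bar>) + c * total (\<lambda>x. \<bar>indicator A (x \<otimes> y) - indicator A x\<bar>)"
      using fin' ind y by (subst total_add, simp, simp, subst total_cmult, simp)
    finally show ?thesis using grad_indicator[OF A y] by simp
  qed
  show ?case
  proof (cases "2 * real (bd A) \<le> \<eta> * real (card A)")
    case True
    then show ?thesis using \<open>A \<noteq> {}\<close> by (auto simp: A_def)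
  next
    case False
    have "(\<Sum>y\<in>X. total (\<lambda>x. \<bar>g (x \<otimes> y) - g x\<bar>))
        = (\<Sum>y\<in>X. total (\<lambda>x. \<bar>g' (x \<otimes> y) - g' x\<bar>)) + c * (2 * real (bd A))"
      by (simp add: grad bd_def sum.distrib sum_distrib_left)
    moreover have "c * (\<eta> * real (card A)) < c * (2 * real (bd A))" using False c0 by simp
    ultimately have less': "(\<Sum>y\<in>X. total (\<lambda>x. \<bar>g' (x \<otimes> y) - g' x\<bar>)) < \<eta> * total g'"
      using less.prems(4) by (simp add: tot' algebra_simps)
    have "0 \<le> (\<Sum>y\<in>X. total (\<lambda>x. \<bar>g' (x \<otimes> y) - g' x\<bar>))" by (intro sum_nonneg total_nonneg) auto
    then have "total g' \<noteq> 0" using less' by auto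
    then have tp: "0 < total g'" using total_nonneg[of g'] pos' by (auto simp: less_le)
    have "supp g' \<subset> A"
      using nz' a by (auto simp: g'_def A_def indicator_def)
    then have "card (supp g') < card (supp g)"
      using A(1) unfolding A_def by (intro psubset_card_mono)
    from less.hyps[OF this fin' pos' tp less_imp_le[OF less']]
    obtain B where "B \<subseteq> supp g'" "B \<noteq> {}" "2 * real (bd B) \<le> \<eta> * real (card B)" by auto
    then show ?thesis using nz' unfolding A_def by blast
  qed
qed

text \<open>Apply \<open>coarea\<close> to \<open>f\<^sup>2\<close>, whose differences factor, together with the Cauchy--Schwarz inequality.\<close>

lemma cheeger:
  assumes f: "fin_nz G f" and pos: "0 < sq f"
    and E: "form u f \<le> \<epsilon> * sq f" and \<epsilon>: "0 \<le> \<epsilon>"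
  shows "\<exists>A \<subseteq> supp f. A \<noteq> {} \<and> real (bd A) \<le> 2 * N\<^sup>2 * sqrt \<epsilon> * real (card A)"
proof -
  let ?g = "\<lambda>x. (f x)\<^sup>2"
  have cs: "total (\<lambda>x. \<bar>(f (x \<otimes> y))\<^sup>2 - (f x)\<^sup>2\<bar>) \<le> sqrt (grad2 f y) * (2 * sqrt (sq f))" if y: "y \<in> X" for y
  proof -
    have yc: "y \<in> carrier G" using y by (rule X_in_carrier)
    have fy: "fin_nz G (\<lambda>x. f (x \<otimes> y))" using f yc by simp
    let ?A = "supp f \<union> {x \<in> carrier G. f (x \<otimes> y) \<noteq> 0}"
    have A: "finite ?A" using f fy by (simp add: fin_nz_def)
    have "total (\<lambda>x. \<bar>(f (x \<otimes> y))\<^sup>2 - (f x)\<^sup>2\<bar>)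
        = (\<Sum>x\<in>?A. \<bar>f (x \<otimes> y) - f x\<bar> * \<bar>f (x \<otimes> y) + f x\<bar>)"
      using A by (subst total_eq_sum[of ?A]) (auto simp: abs_mult[symmetric] power2_eq_square algebra_simps)
    also have "\<dots> \<le> sqrt ((\<Sum>x\<in>?A. \<bar>f (x \<otimes> y) - f x\<bar>\<^sup>2) * (\<Sum>x\<in>?A. \<bar>f (x \<otimes> y) + f x\<bar>\<^sup>2))"
      by (rule real_le_rsqrt[OF Cauchy_Schwarz_ineq_sum])
    also have "(\<Sum>x\<in>?A. \<bar>f (x \<otimes> y) - f x\<bar>\<^sup>2) = grad2 f y"
      unfolding grad2_def using A by (subst total_eq_sum[of ?A]) auto
    also have "(\<Sum>x\<in>?A. \<bar>f (x \<otimes> y) + f x\<bar>\<^sup>2) = total (\<lambda>x. (f (x \<otimes> y) + f x)\<^sup>2)"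
      using A by (subst total_eq_sum[of ?A]) auto
    also have "sqrt (grad2 f y * total (\<lambda>x. (f (x \<otimes> y) + f x)\<^sup>2)) \<le> sqrt (grad2 f y * (4 * sq f))"
    proof (intro real_sqrt_le_mono mult_left_mono grad2_nonneg)
      have "total (\<lambda>x. (f (x \<otimes> y) + f x)\<^sup>2) \<le> total (\<lambda>x. 2 * (f (x \<otimes> y))\<^sup>2 + 2 * (f x)\<^sup>2)"
      proof (intro total_mono)
        fix x
        have "0 \<le> (f (x \<otimes> y) - f x)\<^sup>2" by simp
        then show "(f (x \<otimes> y) + f x)\<^sup>2 \<le> 2 * (f (x \<otimes> y))\<^sup>2 + 2 * (f x)\<^sup>2"
          by (simp add: power2_eq_square algebra_simps)
      qed (use f fy in auto)
      also have "\<dots> = 2 * sq (\<lambda>x. f (x \<otimes> y)) + 2 * sq f"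
        using f fy by (subst total_add, simp, simp, simp only: total_cmult)
      finally show "total (\<lambda>x. (f (x \<otimes> y) + f x)\<^sup>2) \<le> 4 * sq f" using sq_shift[OF yc, of f] by simp
    qed
    also have "\<dots> = sqrt (grad2 f y) * (2 * sqrt (sq f))" by (simp add: real_sqrt_mult)
    finally show ?thesis .
  qed
  have g2: "sqrt (grad2 f y) \<le> sqrt (2 * N * \<epsilon> * sq f)" if "y \<in> X" for y
  proof (rule real_sqrt_le_mono)
    have "grad2 f y \<le> (\<Sum>y\<in>X. grad2 f y)"
      using X_finite that grad2_nonneg by (intro member_le_sum) auto
    also have "\<dots> = 2 * N * form u f" using N_ge_1 by (simp add: dirichlet_u(1)[OF f])
    also have "\<dots> \<le> 2 * N * (\<epsilon> * sq f)" using E N_ge_1 by (intro mult_left_mono) auto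
    finally show "grad2 f y \<le> 2 * N * \<epsilon> * sq f" by simp
  qed
  have "(\<Sum>y\<in>X. total (\<lambda>x. \<bar>?g (x \<otimes> y) - ?g x\<bar>)) \<le> (\<Sum>y\<in>X. sqrt (2 * N * \<epsilon> * sq f) * (2 * sqrt (sq f)))"
  proof (rule sum_mono)
    fix y assume y: "y \<in> X"
    have "sqrt (grad2 f y) * (2 * sqrt (sq f)) \<le> sqrt (2 * N * \<epsilon> * sq f) * (2 * sqrt (sq f))"
      using sq_nonneg by (intro mult_right_mono g2 y) simp
    then show "total (\<lambda>x. \<bar>?g (x \<otimes> y) - ?g x\<bar>) \<le> sqrt (2 * N * \<epsilon> * sq f) * (2 * sqrt (sq f))"
      using cs[OF y] by linarith
  qed
  also have "\<dots> = (2 * N * sqrt (2 * N * \<epsilon>)) * sq f"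
    using sq_nonneg[of f] by (simp add: real_sqrt_mult)
  also have "\<dots> \<le> (4 * N\<^sup>2 * sqrt \<epsilon>) * sq f"
  proof (rule mult_right_mono[OF _ sq_nonneg])
    have "sqrt (2 * N) \<le> 2 * N"
      using N_ge_1 by (intro real_le_lsqrt) (auto simp: power2_eq_square)
    then have "(2 * N) * sqrt (2 * N) * sqrt \<epsilon> \<le> (2 * N) * (2 * N) * sqrt \<epsilon>"
      using N_ge_1 \<epsilon> by (intro mult_right_mono mult_left_mono) auto
    then show "2 * N * sqrt (2 * N * \<epsilon>) \<le> 4 * N\<^sup>2 * sqrt \<epsilon>"
      by (simp add: real_sqrt_mult power2_eq_square mult.assoc)
  qed
  finally have *: "(\<Sum>y\<in>X. total (\<lambda>x. \<bar>?g (x \<otimes> y) - ?g x\<bar>)) \<le> (4 * N\<^sup>2 * sqrt \<epsilon>) * sq f" .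
  have "\<exists>A \<subseteq> {x \<in> carrier G. ?g x \<noteq> 0}. A \<noteq> {} \<and> 2 * real (bd A) \<le> (4 * N\<^sup>2 * sqrt \<epsilon>) * real (card A)"
    using f pos * by (intro coarea) auto
  then obtain A where "A \<subseteq> {x \<in> carrier G. ?g x \<noteq> 0}" "A \<noteq> {}"
    "2 * real (bd A) \<le> (4 * N\<^sup>2 * sqrt \<epsilon>) * real (card A)" by blast
  then show ?thesis by (intro exI[of _ A]) (simp add: mult_ac)
qed

lemma bd_le: "finite A \<Longrightarrow> real (bd A) \<le> N * real (card A)"
proof -
  assume "finite A"
  then have "bd A \<le> (\<Sum>y\<in>X. card A)" unfolding bd_def by (intro sum_mono card_mono) auto
  then have "bd A \<le> card X * card A" by simp
  then show ?thesis unfolding of_nat_mult[symmetric] by (simp only: of_nat_le_iff)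
qed

lemma sum_card_swap:
  assumes "finite D" "finite Z" "\<And>x. x \<in> Z \<Longrightarrow> card {g \<in> D. R g x} \<le> k"
  shows "(\<Sum>g\<in>D. card {x \<in> Z. R g x}) \<le> card Z * k"
proof -
  have "(\<Sum>g\<in>D. card {x \<in> Z. R g x}) = (\<Sum>x\<in>Z. card {g \<in> D. R g x})"
    using assms by (intro sum_multicount_gen) auto
  also have "\<dots> \<le> (\<Sum>x\<in>Z. k)" by (intro sum_mono assms)
  finally show ?thesis by simp
qed

section \<open>Halving almost invariant sets\<close>

abbreviation translate :: "'a \<Rightarrow> 'a set \<Rightarrow> 'a set" where
  "translate g A \<equiv> (\<lambda>x. g \<otimes> x) ` A"

lemma inj_translate: "g \<in> carrier G \<Longrightarrow> A \<subseteq> carrier G \<Longrightarrow> inj_on (\<lambda>x. g \<otimes> x) A"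
  by (intro inj_onI) (auto simp: subset_iff)

lemma translate_mult:
  "g \<in> carrier G \<Longrightarrow> h \<in> carrier G \<Longrightarrow> A \<subseteq> carrier G \<Longrightarrow> translate g (translate h A) = translate (g \<otimes> h) A"
  unfolding image_image by (intro image_cong) (auto simp: m_assoc subset_iff)

lemma bd_translate:
  assumes g: "g \<in> carrier G" and A: "A \<subseteq> carrier G"
  shows "bd (translate g A) = bd A"
  unfolding bd_def
proof (rule sum.cong[OF refl])
  fix y assume y: "y \<in> X"
  have "g \<otimes> b \<otimes> y \<in> translate g A \<longleftrightarrow> b \<otimes> y \<in> A" if "b \<in> A" for b
    using inj_on_image_mem_iff[OF inj_translate[OF g order_refl], of "b \<otimes> y" A] that g A X_in_carrier[OF y]
    by (auto simp: m_assoc subset_iff)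
  then have "{x \<in> translate g A. x \<otimes> y \<notin> translate g A} = translate g {x \<in> A. x \<otimes> y \<notin> A}" by auto
  moreover have "inj_on (\<lambda>x. g \<otimes> x) {x \<in> A. x \<otimes> y \<notin> A}" using g A by (intro inj_translate) auto
  ultimately show "card {x \<in> translate g A. x \<otimes> y \<notin> translate g A} = card {x \<in> A. x \<otimes> y \<notin> A}"
    by (simp add: card_image)
qed

lemma bd_Int:
  assumes "finite A" "finite B"
  shows "bd (A \<inter> B) \<le> bd A + bd B"
  unfolding bd_def sum.distrib[symmetric]
  using assms by (intro sum_mono order_trans[OF card_mono card_Un_le]) auto

text \<open>A point of \<open>A - B\<close> from which a step leads into \<open>B\<close> is reached by the inverse step out of \<open>B\<close>.\<close>

lemma bd_Diff:
  assumes A: "finite A" "A \<subseteq> carrier G" and B: "finite B"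
  shows "bd (A - B) \<le> bd A + bd B"
proof -
  have "card {x \<in> A - B. x \<otimes> y \<notin> A - B} \<le> card {x \<in> A. x \<otimes> y \<notin> A} + card {x \<in> B. x \<otimes> inv y \<notin> B}"
    if y: "y \<in> X" for y
  proof -
    have e: "x = x \<otimes> y \<otimes> inv y" if "x \<in> A" for x
      using that A X_in_carrier[OF y] by (auto simp: m_assoc subset_iff)
    have "{x \<in> A - B. x \<otimes> y \<notin> A - B} \<subseteq> {x \<in> A. x \<otimes> y \<notin> A} \<union> (\<lambda>z. z \<otimes> inv y) ` {x \<in> B. x \<otimes> inv y \<notin> B}"
    proof
      fix x assume x: "x \<in> {x \<in> A - B. x \<otimes> y \<notin> A - B}"
      show "x \<in> {x \<in> A. x \<otimes> y \<notin> A} \<union> (\<lambda>z. z \<otimes> inv y) ` {x \<in> B. x \<otimes> inv y \<notin> B}"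
      proof (cases "x \<otimes> y \<in> A")
        case True
        then have "x \<otimes> y \<in> {x \<in> B. x \<otimes> inv y \<notin> B}" using x e[of x] by auto
        then show ?thesis using e[of x] x by blast
      qed (use x in auto)
    qed
    then have "card {x \<in> A - B. x \<otimes> y \<notin> A - B}
        \<le> card ({x \<in> A. x \<otimes> y \<notin> A} \<union> (\<lambda>z. z \<otimes> inv y) ` {x \<in> B. x \<otimes> inv y \<notin> B})"
      using A B by (intro card_mono) auto
    also have "\<dots> \<le> card {x \<in> A. x \<otimes> y \<notin> A} + card {x \<in> B. x \<otimes> inv y \<notin> B}"
      using B by (intro order_trans[OF card_Un_le] add_mono order_refl card_image_le) auto
    finally show ?thesis .
  qed
  then have "bd (A - B) \<le> (\<Sum>y\<in>X. card {x \<in> A. x \<otimes> y \<notin> A} + card {x \<in> B. x \<otimes> inv y \<notin> B})"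
    unfolding bd_def by (intro sum_mono)
  also have "\<dots> = bd A + bd B"
    using sum_X_inv[of "\<lambda>y. card {x \<in> B. x \<otimes> y \<notin> B}"] by (simp add: sum.distrib bd_def)
  finally show ?thesis .
qed

text \<open>A boundary pair of \<open>A \<inter> g A\<close> comes from a boundary pair of \<open>A\<close> whose base point lies in \<open>g A\<close>, or is the
  \<open>g\<close>-translate of a boundary pair of \<open>A\<close> with base point moved into \<open>A\<close>. For each boundary pair of \<open>A\<close>, each
  of the two happens for at most \<open>card A\<close> elements \<open>g\<close>. As the sizes of the sets \<open>A \<inter> g A\<close> add up to
  the square of \<open>card A\<close>, their relative boundary is on average at most twice that of \<open>A\<close>.\<close>

lemma sum_bd_Int_translates:
  assumes A: "finite A" "A \<subseteq> carrier G" and D: "finite D" "D \<subseteq> carrier G"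
  shows "(\<Sum>g\<in>D. bd (A \<inter> translate g A)) \<le> 2 * bd A * card A"
proof -
  let ?Out = "\<lambda>y. {x \<in> A. x \<otimes> y \<notin> A}"
  have cnt1: "card {g \<in> D. x \<in> translate g A} \<le> card A" if "x \<in> A" for x
  proof -
    have "{g \<in> D. x \<in> translate g A} \<subseteq> (\<lambda>b. x \<otimes> inv b) ` A" using D(2) A(2) by (force simp: m_assoc)
    then show ?thesis using A(1) by (intro order_trans[OF card_mono card_image_le]) auto
  qed
  have cnt2: "card {g \<in> D. g \<otimes> b \<in> A} \<le> card A" if b: "b \<in> A" for b
  proof -
    have "g = g \<otimes> b \<otimes> inv b" if "g \<in> D" for g using that b D(2) A(2) by (auto simp: m_assoc subset_iff)
    then have "{g \<in> D. g \<otimes> b \<in> A} \<subseteq> (\<lambda>a. a \<otimes> inv b) ` A" by blast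
    then show ?thesis using A(1) by (intro order_trans[OF card_mono card_image_le]) auto
  qed
  have "bd (A \<inter> translate g A) \<le> (\<Sum>y\<in>X. card {x \<in> ?Out y. x \<in> translate g A} + card {b \<in> ?Out y. g \<otimes> b \<in> A})"
    if g: "g \<in> D" for g
    unfolding bd_def
  proof (rule sum_mono)
    fix y assume y: "y \<in> X"
    have gb: "g \<otimes> b \<otimes> y = g \<otimes> (b \<otimes> y)" if "b \<in> A" for b
      using that g D(2) A(2) X_in_carrier[OF y] by (auto simp: m_assoc subset_iff)
    have "{x \<in> A \<inter> translate g A. x \<otimes> y \<notin> A \<inter> translate g A}
        \<subseteq> {x \<in> ?Out y. x \<in> translate g A} \<union> translate g {b \<in> ?Out y. g \<otimes> b \<in> A}"
      using gb by auto
    then have "card {x \<in> A \<inter> translate g A. x \<otimes> y \<notin> A \<inter> translate g A}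
        \<le> card ({x \<in> ?Out y. x \<in> translate g A} \<union> translate g {b \<in> ?Out y. g \<otimes> b \<in> A})"
      using A(1) by (intro card_mono) auto
    also have "\<dots> \<le> card {x \<in> ?Out y. x \<in> translate g A} + card {b \<in> ?Out y. g \<otimes> b \<in> A}"
      using A(1) by (intro order_trans[OF card_Un_le] add_mono order_refl card_image_le) auto
    finally show "card {x \<in> A \<inter> translate g A. x \<otimes> y \<notin> A \<inter> translate g A}
        \<le> card {x \<in> ?Out y. x \<in> translate g A} + card {b \<in> ?Out y. g \<otimes> b \<in> A}" .
  qed
  then have "(\<Sum>g\<in>D. bd (A \<inter> translate g A))
      \<le> (\<Sum>g\<in>D. \<Sum>y\<in>X. card {x \<in> ?Out y. x \<in> translate g A} + card {b \<in> ?Out y. g \<otimes> b \<in> A})"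
    by (rule sum_mono)
  also have "\<dots> = (\<Sum>y\<in>X. \<Sum>g\<in>D. card {x \<in> ?Out y. x \<in> translate g A} + card {b \<in> ?Out y. g \<otimes> b \<in> A})"
    by (rule sum.swap)
  also have "\<dots> \<le> (\<Sum>y\<in>X. card (?Out y) * card A + card (?Out y) * card A)"
    unfolding sum.distrib using D(1) A(1) cnt1 cnt2 by (intro sum_mono add_mono sum_card_swap) auto
  also have "\<dots> = 2 * bd A * card A" by (simp add: bd_def sum.distrib flip: sum_distrib_right)
  finally show ?thesis .
qed

text \<open>If no \<open>A \<inter> g A\<close> and no \<open>A - g A\<close> will do, left translations by the elements of \<open>G\<close> split into those
  that almost preserve \<open>A\<close>, which form a finite subgroup \<open>H\<close>, and those that almost displace it. On average
  over \<open>g\<close>, weighted by \<open>card (A \<inter> g A)\<close>, the intersections have a relative boundary of at most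
  \<open>2 \<eta>\<close>, so nearly all the weight must sit on \<open>H\<close>; this makes \<open>A\<close> almost equal to a coset \<open>H b\<close>. A coset
  with small boundary is invariant under \<open>X\<close>, so \<open>G\<close> would be finite. For an expanding finite group the
  statement fails.\<close>

lemma foelner_halving:
  assumes gen: "generate G X = carrier G" and inf: "infinite (carrier G)"
    and A: "finite A" "A \<subseteq> carrier G" "A \<noteq> {}"
    and \<eta>: "0 < \<eta>" "\<eta> \<le> 1/4" and bdA: "real (bd A) \<le> \<eta> * real (card A)"
  shows "\<exists>B \<subseteq> carrier G. finite B \<and> B \<noteq> {} \<and> 2 * card B \<le> card A \<and>
           real (bd B) \<le> 4 * sqrt \<eta> * real (card B)"
proof (rule ccontr)
  assume no: "\<not> ?thesis"
  define \<sigma> where "\<sigma> = sqrt \<eta>"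
  have \<sigma>: "0 < \<sigma>" "\<sigma> \<le> 1/2" "\<sigma> * \<sigma> = \<eta>"
    using \<eta> real_sqrt_le_mono[of \<eta> "1/4"] by (auto simp: \<sigma>_def real_sqrt_divide)
  define n where "n = real (card A)"
  have n: "n > 0" using A by (auto simp: n_def card_gt_0_iff)
  let ?T = "\<lambda>g. translate g A"
  have T: "?T g \<subseteq> carrier G" "finite (?T g)" "card (?T g) = card A" if "g \<in> carrier G" for g
    using that A inj_translate[OF that A(2)] by (auto simp: card_image)
  have bd_T: "bd (A \<inter> ?T g) \<le> 2 * bd A" "bd (A - ?T g) \<le> 2 * bd A" if g: "g \<in> carrier G" for g
    using bd_Int[OF A(1) T(2)[OF g]] bd_Diff[OF A(1,2) T(2)[OF g]] bd_translate[OF g A(2)] by auto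
  \<comment> \<open>Each of \<open>A \<inter> g A\<close> and \<open>A - g A\<close> is either tiny or larger than half of \<open>A\<close>; they cannot both be large.\<close>
  have no': "4 * \<sigma> * real (card B) < real (bd B)"
    if "B \<subseteq> carrier G" "finite B" "B \<noteq> {}" "2 * card B \<le> card A" for B
  proof (rule ccontr)
    assume "\<not> ?thesis"
    then have "real (bd B) \<le> 4 * sqrt \<eta> * real (card B)" by (simp add: \<sigma>_def)
    then show False using no that by blast
  qed
  have small: "real (card B) \<le> \<sigma> / 2 * n"
    if B: "B \<subseteq> carrier G" "finite B" "bd B \<le> 2 * bd A" "2 * card B \<le> card A" for B
  proof (cases "B = {}")
    case False
    then have "4 * \<sigma> * real (card B) < real (bd B)" using B by (intro no')
    also have "\<dots> \<le> 2 * (\<eta> * n)" using B(3) bdA by (simp add: n_def)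
    also have "\<dots> = 4 * \<sigma> * (\<sigma> / 2 * n)" using \<sigma>(3) by simp
    finally show ?thesis using \<sigma>(1) by simp
  qed (use \<sigma> n in auto)
  define H where "H = {g \<in> carrier G. real (card (A - ?T g)) \<le> \<sigma> / 2 * n}"
  have split: "real (card (A \<inter> ?T g)) + real (card (A - ?T g)) = n" for g
    using card_Int_Diff[OF A(1), of "?T g"] by (simp add: n_def)
  have notH: "real (card (A \<inter> ?T g)) \<le> \<sigma> / 2 * n" if g: "g \<in> carrier G" "g \<notin> H" for g
  proof (cases "2 * card (A \<inter> ?T g) \<le> card A")
    case True
    then show ?thesis using A bd_T(1)[OF g(1)] by (intro small) auto
  next
    case False
    then have "2 * card (A - ?T g) \<le> card A" using split[of g] unfolding n_def by linarith
    then have "real (card (A - ?T g)) \<le> \<sigma> / 2 * n" using A bd_T(2)[OF g(1)] by (intro small) auto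
    then show ?thesis using g by (simp add: H_def)
  qed
  have \<sigma>n: "\<sigma> * n \<le> n / 2" using \<sigma> n by (simp add: field_simps)
  have T_diff: "card (?T g - ?T (g \<otimes> h)) = card (A - ?T h)" if "g \<in> carrier G" "h \<in> carrier G" for g h
  proof -
    have "?T g - ?T (g \<otimes> h) = (\<lambda>x. g \<otimes> x) ` (A - ?T h)"
      unfolding translate_mult[OF that A(2), symmetric]
      using that A T(1)[OF that(2)] by (subst inj_on_image_set_diff[OF inj_translate[OF that(1) order_refl]]) auto
    then show ?thesis using that A by (simp add: card_image inj_translate subset_iff)
  qed
  have T_one: "?T \<one> = A" using A by force
  have sub: "subgroup H G"
  proof (rule subgroupI)
    show "H \<subseteq> carrier G" by (auto simp: H_def)
    have "\<one> \<in> H" using \<sigma> n by (simp add: H_def T_one)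
    then show "H \<noteq> {}" by auto
  next
    fix g assume g: "g \<in> H"
    then have gc: "g \<in> carrier G" "real (card (A - ?T g)) \<le> \<sigma> / 2 * n" by (auto simp: H_def)
    have "card (A - ?T (inv g)) = card (?T g - ?T (g \<otimes> inv g))" using T_diff[of g "inv g"] gc by simp
    also have "?T (g \<otimes> inv g) = A" using gc T_one by simp
    also have "card (?T g - A) = card (?T g) - card (?T g \<inter> A)"
      using T[OF gc(1)] by (simp add: card_Diff_subset_Int)
    also have "\<dots> = card (A - ?T g)"
      using T[OF gc(1)] A by (simp add: card_Diff_subset_Int Int_commute)
    finally show "inv g \<in> H" using gc by (simp add: H_def)
  next
    fix g h assume "g \<in> H" "h \<in> H"
    then have gh: "g \<in> carrier G" "h \<in> carrier G" "real (card (A - ?T g)) \<le> \<sigma> / 2 * n"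
      "real (card (A - ?T h)) \<le> \<sigma> / 2 * n" by (auto simp: H_def)
    show "g \<otimes> h \<in> H"
    proof (rule ccontr)
      assume "g \<otimes> h \<notin> H"
      then have 1: "real (card (A \<inter> ?T (g \<otimes> h))) \<le> \<sigma> / 2 * n" using gh by (intro notH) auto
      have "card A \<le> card ((A \<inter> ?T (g \<otimes> h)) \<union> (A - ?T g) \<union> (?T g - ?T (g \<otimes> h)))"
        using A T(2)[OF gh(1)] by (intro card_mono) auto
      also have "\<dots> \<le> card (A \<inter> ?T (g \<otimes> h)) + card (A - ?T g) + card (?T g - ?T (g \<otimes> h))"
        by (intro order_trans[OF card_Un_le] add_mono card_Un_le order_refl)
      finally have "n \<le> real (card (A \<inter> ?T (g \<otimes> h))) + real (card (A - ?T g)) + real (card (A - ?T h))"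
        using T_diff[OF gh(1,2)] by (simp add: n_def)
      then show False using 1 gh \<sigma>n n by linarith
    qed
  qed
  \<comment> \<open>Only \<open>g\<close> in the finite set \<open>D\<close> of quotients of elements of \<open>A\<close> have \<open>A \<inter> g A\<close> nonempty.\<close>
  define D where "D = (\<lambda>(a, b). a \<otimes> inv b) ` (A \<times> A)"
  have D: "finite D" "D \<subseteq> carrier G" using A by (auto simp: D_def)
  have D_I: "g \<in> D" if "g \<in> carrier G" "b \<in> A" "g \<otimes> b \<in> A" for g b
    using that A by (auto simp: D_def m_assoc dest: subsetD intro!: image_eqI[of _ _ "(g \<otimes> b, b)"])
  have H_D: "H \<subseteq> D"
  proof
    fix g assume g: "g \<in> H"
    then have "A \<inter> ?T g \<noteq> {}" using split[of g] \<sigma>n n by (auto simp: H_def)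
    then obtain b where "b \<in> A" "g \<otimes> b \<in> A" by auto
    then show "g \<in> D" using g by (intro D_I) (auto simp: H_def)
  qed
  let ?D = "D - H"
  have "real (\<Sum>g\<in>?D. bd (A \<inter> ?T g)) \<le> real (2 * bd A * card A)"
    unfolding of_nat_le_iff using A D by (intro sum_bd_Int_translates) auto
  also have "\<dots> = 2 * real (bd A) * n" by (simp add: n_def)
  also have "\<dots> \<le> 2 * (\<eta> * n) * n" using bdA n by (intro mult_right_mono mult_left_mono) (auto simp: n_def)
  finally have sum_bd: "(\<Sum>g\<in>?D. real (bd (A \<inter> ?T g))) \<le> 2 * \<eta> * n * n" by simp
  have "4 * \<sigma> * (\<Sum>g\<in>?D. real (card (A \<inter> ?T g))) \<le> (\<Sum>g\<in>?D. real (bd (A \<inter> ?T g)))"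
    unfolding sum_distrib_left
  proof (rule sum_mono)
    fix g assume g: "g \<in> ?D"
    then have gc: "g \<in> carrier G" "g \<notin> H" using D by auto
    have "2 * real (card (A \<inter> ?T g)) \<le> n" using notH[OF gc] \<sigma>n n by linarith
    then have "2 * card (A \<inter> ?T g) \<le> card A" unfolding n_def by linarith
    then show "4 * \<sigma> * real (card (A \<inter> ?T g)) \<le> real (bd (A \<inter> ?T g))"
    proof (cases "A \<inter> ?T g = {}")
      case False
      then show ?thesis using no'[of "A \<inter> ?T g"] A \<open>2 * card (A \<inter> ?T g) \<le> card A\<close>
        by (simp add: le_infI1)
    qed simp
  qed
  also note sum_bd
  also have "2 * \<eta> * n * n = 4 * \<sigma> * (\<sigma> / 2 * n * n)" using \<sigma>(3) by simp
  finally have sum_card: "(\<Sum>g\<in>?D. real (card (A \<inter> ?T g))) \<le> \<sigma> / 2 * n * n" using \<sigma>(1) by simp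
  have Int_card: "card (A \<inter> ?T g) = card {b \<in> A. g \<otimes> b \<in> A}" if "g \<in> carrier G" for g
  proof -
    have "A \<inter> ?T g = (\<lambda>x. g \<otimes> x) ` {b \<in> A. g \<otimes> b \<in> A}" by auto
    moreover have "inj_on (\<lambda>x. g \<otimes> x) {b \<in> A. g \<otimes> b \<in> A}" using that A by (intro inj_translate) auto
    ultimately show ?thesis by (simp add: card_image)
  qed
  have "(\<Sum>b\<in>A. card {a \<in> A. a \<otimes> inv b \<notin> H}) \<le> (\<Sum>b\<in>A. card {g \<in> ?D. g \<otimes> b \<in> A})"
  proof (rule sum_mono)
    fix b assume b: "b \<in> A"
    have bc: "b \<in> carrier G" using b A by auto
    have "(\<lambda>a. a \<otimes> inv b) ` {a \<in> A. a \<otimes> inv b \<notin> H} \<subseteq> {g \<in> ?D. g \<otimes> b \<in> A}"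
    proof (rule image_subsetI)
      fix a assume a: "a \<in> {a \<in> A. a \<otimes> inv b \<notin> H}"
      then have ac: "a \<in> carrier G" using A by auto
      have e: "a \<otimes> inv b \<otimes> b = a" using ac bc by (simp add: m_assoc)
      then have "a \<otimes> inv b \<in> D" using a b ac bc by (intro D_I[of _ b]) auto
      then show "a \<otimes> inv b \<in> {g \<in> ?D. g \<otimes> b \<in> A}" using a e by simp
    qed
    moreover have "inj_on (\<lambda>a. a \<otimes> inv b) {a \<in> A. a \<otimes> inv b \<notin> H}"
      using bc A(2) by (intro inj_onI) (auto simp: subset_iff)
    moreover have "finite {g \<in> ?D. g \<otimes> b \<in> A}" using D(1) by simp
    ultimately show "card {a \<in> A. a \<otimes> inv b \<notin> H} \<le> card {g \<in> ?D. g \<otimes> b \<in> A}"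
      by (intro card_inj_on_le)
  qed
  also have "\<dots> = (\<Sum>g\<in>?D. card {b \<in> A. g \<otimes> b \<in> A})"
    using A(1) D(1) by (intro sum_multicount_gen[symmetric]) auto
  also have "\<dots> = (\<Sum>g\<in>?D. card (A \<inter> ?T g))"
    using D(2) by (intro sum.cong refl Int_card[symmetric]) auto
  finally have "real (\<Sum>b\<in>A. card {a \<in> A. a \<otimes> inv b \<notin> H}) \<le> real (\<Sum>g\<in>?D. card (A \<inter> ?T g))"
    by (simp only: of_nat_le_iff)
  then have sumA: "(\<Sum>b\<in>A. real (card {a \<in> A. a \<otimes> inv b \<notin> H})) \<le> \<sigma> / 2 * n * n" using sum_card by simp
  \<comment> \<open>For this \<open>b\<close> all but a small part of \<open>A\<close> lies in \<open>H b\<close>.\<close>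
  have "\<exists>b\<in>A. real (card {a \<in> A. a \<otimes> inv b \<notin> H}) \<le> \<sigma> / 2 * n"
  proof (rule ccontr)
    assume "\<not> ?thesis"
    then have "(\<Sum>b\<in>A. \<sigma> / 2 * n) < (\<Sum>b\<in>A. real (card {a \<in> A. a \<otimes> inv b \<notin> H}))"
      using A by (intro sum_strict_mono) (auto simp: not_le)
    then show False using sumA by (simp add: n_def mult_ac)
  qed
  then obtain b where b: "b \<in> A" "real (card {a \<in> A. a \<otimes> inv b \<notin> H}) \<le> \<sigma> / 2 * n" by auto
  have bc: "b \<in> carrier G" using b A by auto
  have cancel: "inv p \<otimes> (p \<otimes> q) = q" if "p \<in> carrier G" "q \<in> carrier G" for p q
    using that by (simp add: m_assoc[symmetric])
  have conj: "b \<otimes> y \<otimes> inv b \<in> H" if y: "y \<in> X" for y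
  proof -
    have yc: "y \<in> carrier G" using y by (rule X_in_carrier)
    let ?V = "{a \<in> A. a \<otimes> inv b \<notin> H}" and ?W = "{a \<in> A. a \<otimes> inv b \<in> H}"
    have "\<exists>x\<in>?W. x \<otimes> y \<in> ?W"
    proof (rule ccontr)
      assume c: "\<not> ?thesis"
      have injy: "inj_on (\<lambda>x. x \<otimes> inv y) ?V"
        using yc A(2) by (intro inj_onI) (auto simp: subset_iff)
      have "A \<subseteq> ?V \<union> {x \<in> A. x \<otimes> y \<notin> A} \<union> (\<lambda>x. x \<otimes> inv y) ` ?V"
      proof
        fix x assume x: "x \<in> A"
        have e: "x = x \<otimes> y \<otimes> inv y" using x yc A by (auto simp: m_assoc dest: subsetD)
        show "x \<in> ?V \<union> {x \<in> A. x \<otimes> y \<notin> A} \<union> (\<lambda>x. x \<otimes> inv y) ` ?V"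
        proof (cases "x \<in> ?V \<or> x \<otimes> y \<notin> A")
          case False
          then have "x \<otimes> y \<in> ?V" using c x by auto
          then show ?thesis using e by blast
        qed (use x in auto)
      qed
      then have "card A \<le> card (?V \<union> {x \<in> A. x \<otimes> y \<notin> A} \<union> (\<lambda>x. x \<otimes> inv y) ` ?V)"
        using A(1) by (intro card_mono) auto
      also have "\<dots> \<le> card ?V + card {x \<in> A. x \<otimes> y \<notin> A} + card ((\<lambda>x. x \<otimes> inv y) ` ?V)"
        by (intro order_trans[OF card_Un_le] add_mono card_Un_le order_refl)
      also have "card ((\<lambda>x. x \<otimes> inv y) ` ?V) = card ?V" by (rule card_image[OF injy])
      also have "card {x \<in> A. x \<otimes> y \<notin> A} \<le> bd A"
        unfolding bd_def using X_finite y
        by (intro member_le_sum[where f = "\<lambda>y. card {x \<in> A. x \<otimes> y \<notin> A}"]) auto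
      finally have "n \<le> 2 * real (card ?V) + real (bd A)" by (simp add: n_def)
      also have "\<dots> \<le> \<sigma> * n + \<eta> * n" using b bdA by (simp add: n_def)
      also have "\<eta> * n \<le> 1/4 * n" using \<eta> n by (intro mult_right_mono) auto
      finally show False using \<sigma>n n by linarith
    qed
    then obtain x where x: "x \<in> A" "x \<otimes> inv b \<in> H" "x \<otimes> y \<otimes> inv b \<in> H" by auto
    have xc: "x \<in> carrier G" using x A by auto
    have "inv (x \<otimes> inv b) \<otimes> (x \<otimes> y \<otimes> inv b) \<in> H"
      by (rule subgroup.m_closed[OF sub subgroup.m_inv_closed[OF sub x(2)] x(3)])
    also have "inv (x \<otimes> inv b) \<otimes> (x \<otimes> y \<otimes> inv b) = b \<otimes> y \<otimes> inv b"
      using xc yc bc cancel[of x "y \<otimes> inv b"] by (simp add: inv_mult_group m_assoc)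
    finally show ?thesis .
  qed
  have conj_all: "b \<otimes> y \<otimes> inv b \<in> H" if "y \<in> generate G X" for y
    using that
  proof (induction rule: generate.induct)
    case one
    show ?case using subgroup.one_closed[OF sub] bc by simp
  next
    case (eng y z)
    then have c: "y \<in> carrier G" "z \<in> carrier G" using generate_in_carrier[OF X_carrier] by auto
    have "(b \<otimes> y \<otimes> inv b) \<otimes> (b \<otimes> z \<otimes> inv b) = b \<otimes> (y \<otimes> z) \<otimes> inv b"
      using c bc cancel[of b "z \<otimes> inv b"] by (simp add: m_assoc)
    then show ?case using subgroup.m_closed[OF sub eng.IH] by simp
  qed (auto intro: conj X_inv)
  have "carrier G \<subseteq> H"
  proof
    fix g assume g: "g \<in> carrier G"
    then have "b \<otimes> (inv b \<otimes> g \<otimes> b) \<otimes> inv b \<in> H" using gen bc by (intro conj_all) auto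
    moreover have "b \<otimes> (inv b \<otimes> g \<otimes> b) \<otimes> inv b = g"
      using g bc cancel[of "inv b" g] by (simp add: m_assoc)
    ultimately show "g \<in> H" by simp
  qed
  then show False using H_D D(1) inf by (meson finite_subset)
qed

section \<open>Slow decay forces a small profile\<close>

definition has_foelner :: "real \<Rightarrow> real \<Rightarrow> bool" where
  "has_foelner w \<eta> \<longleftrightarrow> (\<exists>B \<subseteq> carrier G. finite B \<and> B \<noteq> {} \<and> real (card B) \<le> w \<and>
     real (bd B) \<le> \<eta> * real (card B))"

lemma has_foelner_mono: "has_foelner w \<eta> \<Longrightarrow> \<eta> \<le> \<eta>' \<Longrightarrow> has_foelner w \<eta>'"
  unfolding has_foelner_def by (meson mult_right_mono of_nat_0_le_iff order_trans)

text \<open>The factor \<open>16 N\<^sup>2\<close> is large enough to reproduce itself, so repeated halving only takes square roots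
  of \<open>x\<close>, and large enough for a single point to do when the given boundary is not small.\<close>

lemma has_foelner_half:
  assumes gen: "generate G X = carrier G" and inf: "infinite (carrier G)"
    and w: "1 \<le> w" and x: "0 < x" and big: "has_foelner (2 * w) (16 * N\<^sup>2 * x)"
  shows "has_foelner w (16 * N\<^sup>2 * sqrt x)"
proof (cases "16 * N\<^sup>2 * x \<le> 1/4")
  case True
  obtain A where A: "A \<subseteq> carrier G" "finite A" "A \<noteq> {}" "real (card A) \<le> 2 * w"
    "real (bd A) \<le> 16 * N\<^sup>2 * x * real (card A)"
    using big by (auto simp: has_foelner_def)
  have "0 < 16 * N\<^sup>2 * x" using x N_ge_1 by simp
  from foelner_halving[OF gen inf A(2,1,3) this True A(5)]
  obtain B where B: "B \<subseteq> carrier G" "finite B" "B \<noteq> {}" "2 * card B \<le> card A"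
    "real (bd B) \<le> 4 * sqrt (16 * N\<^sup>2 * x) * real (card B)" by blast
  have "4 * sqrt (16 * N\<^sup>2 * x) = 16 * N * sqrt x" by (simp add: real_sqrt_mult)
  also have "\<dots> \<le> 16 * N\<^sup>2 * sqrt x"
    using N_ge_1 x by (intro mult_right_mono) (auto simp: power2_eq_square)
  finally have "real (bd B) \<le> 16 * N\<^sup>2 * sqrt x * real (card B)"
    using B(5) by (meson mult_right_mono of_nat_0_le_iff order_trans)
  moreover have "real (card B) \<le> w" using B(4) A(4) by linarith
  ultimately show ?thesis using B unfolding has_foelner_def by blast
next
  case False
  have sq1: "1 \<le> (8 * N * sqrt x)\<^sup>2" using False x by (simp add: power_mult_distrib)
  have "1 \<le> 8 * N * sqrt x"
  proof (rule power2_le_imp_le)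
    show "1\<^sup>2 \<le> (8 * N * sqrt x)\<^sup>2" using sq1 by (simp only: power_one)
    show "0 \<le> 8 * N * sqrt x" using x by simp
  qed
  then have "N * 1 \<le> N * (16 * N * sqrt x)" using N_ge_1 x by (intro mult_left_mono) auto
  then have "N \<le> 16 * N\<^sup>2 * sqrt x" by (simp add: power2_eq_square)
  moreover have "real (bd {\<one>}) \<le> N * real (card {\<one>})" by (rule bd_le) simp
  ultimately show ?thesis unfolding has_foelner_def using w by (intro exI[of _ "{\<one>}"]) auto
qed

lemma dirichlet_scale: "form \<phi> (\<lambda>x. c * f x) = c\<^sup>2 * form \<phi> f"
proof -
  have "(\<lambda>(x, y). \<bar>c * f (x \<otimes> y) - c * f x\<bar>\<^sup>2 * pmf \<phi> y)
      = (\<lambda>p. c\<^sup>2 * (case p of (x, y) \<Rightarrow> \<bar>f (x \<otimes> y) - f x\<bar>\<^sup>2 * pmf \<phi> y))"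
    by (auto simp: fun_eq_iff power2_eq_square algebra_simps)
  then show ?thesis unfolding dirichlet_form_def by (simp add: infsum_cmult_right')
qed

lemma profile_le_quotient:
  assumes f: "fin_nz G f" "0 < sq f" "real (card (supp f)) \<le> v"
  shows "profile \<phi> v \<le> form \<phi> f / sq f"
proof -
  define c where "c = 1 / sqrt (sq f)"
  have c: "c \<noteq> 0" "c\<^sup>2 = 1 / sq f" using f(2) by (auto simp: c_def power_divide)
  have "sq (\<lambda>x. c * f x) = c\<^sup>2 * sq f" by (simp add: power_mult_distrib total_cmult)
  then have "test_fun v (\<lambda>x. c * f x)" using f c by (simp add: test_fun_def)
  from profile_le[OF this, of \<phi>] show ?thesis by (simp add: dirichlet_scale c)
qed

lemma profile_le_foelner:
  assumes "has_foelner v \<eta>"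
  shows "profile u v \<le> \<eta> / N"
proof -
  obtain B where B: "B \<subseteq> carrier G" "finite B" "B \<noteq> {}" "real (card B) \<le> v"
    "real (bd B) \<le> \<eta> * real (card B)"
    using assms by (auto simp: has_foelner_def)
  have supp: "{x \<in> carrier G. indicator B x \<noteq> (0::real)} = B" using B(1) by (auto simp: indicator_def)
  have "(\<lambda>x. (indicator B x :: real)\<^sup>2) = indicator B" by (auto simp: indicator_def)
  then have sq: "sq (indicator B) = real (card B)" using total_indicator[OF B(2,1)] by simp
  have c: "real (card B) > 0" using B by (simp add: card_gt_0_iff)
  have "profile u v \<le> form u (indicator B) / sq (indicator B)"
    using B supp c by (intro profile_le_quotient) (auto simp: sq)
  also have "\<dots> = real (bd B) / real (card B) / N" using B by (simp add: dirichlet_indicator sq)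
  also have "\<dots> \<le> \<eta> / N" using B(5) c N_ge_1 by (intro divide_right_mono) (auto simp: field_simps)
  finally show ?thesis .
qed

text \<open>Cheeger's inequality and three halvings each take a square root, which explains the exponent 16.\<close>

lemma slow_decay_imp_small_profile:
  assumes gen: "generate G X = carrier G" and inf: "infinite (carrier G)"
    and f: "test_fun v f" and pos: "\<And>x. x \<in> carrier G \<Longrightarrow> 0 \<le> f x" and v: "1 \<le> v"
    and m: "1 \<le> m" and slow: "1/2 \<le> sq ((avg ^^ m) f)"
  shows "profile u v ^ 16 * real m \<le> 2 * N * (16 * N) ^ 16"
proof -
  obtain g where g: "fin_nz G g" "1/4 \<le> sq g" "real (card (supp g)) \<le> 8 * v"
    "form u g \<le> N / (2 * real m)"
    using slow_decay_imp_small_energy[OF f pos v m slow] by blast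
  define e where "e = 2 * N / real m"
  have e: "e > 0" using N_ge_1 m by (simp add: e_def)
  have "N / (2 * real m) = e * (1/4)" by (simp add: e_def)
  also have "\<dots> \<le> e * sq g" using g e by (intro mult_left_mono) auto
  finally have "form u g \<le> e * sq g" using g by linarith
  then obtain A where A: "A \<subseteq> supp g" "A \<noteq> {}"
    "real (bd A) \<le> 2 * N\<^sup>2 * sqrt e * real (card A)"
    using cheeger[of g e] g e by auto
  have fin: "finite (supp g)" using g by (simp add: fin_nz_def)
  have "card A \<le> card (supp g)" using A fin by (intro card_mono)
  then have "real (card A) \<le> 2 * (4 * v)" using g(3) by simp
  then have "has_foelner (2 * (4 * v)) (2 * N\<^sup>2 * sqrt e)"
    unfolding has_foelner_def using A fin finite_subset[OF A(1) fin] by (intro exI[of _ A]) auto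
  then have "has_foelner (2 * (4 * v)) (16 * N\<^sup>2 * sqrt e)"
    by (rule has_foelner_mono) (use e in simp)
  then have "has_foelner (4 * v) (16 * N\<^sup>2 * sqrt (sqrt e))"
    using v e has_foelner_half[OF gen inf, of "4 * v" "sqrt e"] by simp
  then have "has_foelner (2 * v) (16 * N\<^sup>2 * sqrt (sqrt (sqrt e)))"
    using v e has_foelner_half[OF gen inf, of "2 * v" "sqrt (sqrt e)"] by simp
  then have "has_foelner v (16 * N\<^sup>2 * sqrt (sqrt (sqrt (sqrt e))))"
    using v e has_foelner_half[OF gen inf, of "v" "sqrt (sqrt (sqrt e))"] by simp
  then have "profile u v \<le> 16 * N\<^sup>2 * sqrt (sqrt (sqrt (sqrt e))) / N"
    by (rule profile_le_foelner)
  also have "\<dots> = 16 * N * sqrt (sqrt (sqrt (sqrt e)))" using N_ge_1 by (simp add: power2_eq_square)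
  finally have "profile u v ^ 16 \<le> (16 * N * sqrt (sqrt (sqrt (sqrt e)))) ^ 16"
    using profile_nonneg[OF v] by (intro power_mono)
  also have "\<dots> = (16 * N) ^ 16 * ((((sqrt (sqrt (sqrt (sqrt e))))\<^sup>2)\<^sup>2)\<^sup>2)\<^sup>2"
    by (simp only: power_mult_distrib power_mult[symmetric]) simp
  also have "((((sqrt (sqrt (sqrt (sqrt e))))\<^sup>2)\<^sup>2)\<^sup>2)\<^sup>2 = e" using e by simp
  finally show ?thesis using m by (simp add: e_def field_simps)
qed

lemma u_pow_form_lower:
  assumes f: "test_fun v f" and decay: "sq ((avg ^^ m) f) \<le> 1/2" and n: "2 * m \<le> n"
  shows "1/2 \<le> form (u_pow n) f"
  using ip_avg_pow_le[of f m n] assms by (simp add: dirichlet_u_pow test_fun_def)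

section \<open>Differences along words\<close>

lemma grad2_X_le:
  assumes f: "fin_nz G f" and "y \<in> X"
  shows "grad2 f y \<le> 2 * N * form u f"
proof -
  have "grad2 f y \<le> (\<Sum>y\<in>X. grad2 f y)"
    using X_finite assms grad2_nonneg by (intro member_le_sum) auto
  then show ?thesis using N_ge_1 by (simp add: dirichlet_u(1)[OF f])
qed

lemma square_add_weighted:
  fixes p q k :: real
  assumes "0 < k"
  shows "(p + q)\<^sup>2 \<le> (1 + 1 / k) * p\<^sup>2 + (1 + k) * q\<^sup>2"
proof -
  have "0 \<le> (p - k * q)\<^sup>2 / k" using assms by simp
  also have "\<dots> = p\<^sup>2 / k - 2 * p * q + k * q\<^sup>2"
    using assms by (simp add: power2_eq_square field_simps)
  finally show ?thesis by (simp add: power2_eq_square algebra_simps)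
qed

lemma word_closed: "set w \<subseteq> X \<Longrightarrow> foldr (\<otimes>) w \<one> \<in> carrier G"
  by (induction w) (auto simp: X_in_carrier)

text \<open>The triangle inequality along the word, in squared form. With the weights of
  \<open>square_add_weighted\<close> for \<open>k = length w\<close> the induction passes from \<open>k\<^sup>2\<close> to exactly \<open>(k + 1)\<^sup>2\<close>.\<close>

lemma grad2_word_le:
  assumes f: "fin_nz G f" and w: "set w \<subseteq> X"
  shows "grad2 f (foldr (\<otimes>) w \<one>) \<le> (real (length w))\<^sup>2 * (2 * N * form u f)"
  using w
proof (induction w)
  case Nil
  show ?case by (simp add: grad2_def infsum_0)
next
  case (Cons a w)
  define y where "y = foldr (\<otimes>) w \<one>"
  have a: "a \<in> X" "a \<in> carrier G" and y: "y \<in> carrier G"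
    using Cons.prems word_closed[of w] X_in_carrier by (auto simp: y_def)
  let ?q = "2 * N * form u f"
  have ga: "grad2 f a \<le> ?q" by (rule grad2_X_le[OF f a(1)])
  have IH: "grad2 f y \<le> (real (length w))\<^sup>2 * ?q" using Cons by (simp add: y_def)
  show ?case
  proof (cases "w = []")
    case True
    then show ?thesis using ga a by simp
  next
    case False
    define k where "k = real (length w)"
    have k: "k > 0" using False by (simp add: k_def)
    have fay: "fin_nz G (\<lambda>x. f (x \<otimes> a \<otimes> y))"
      using fin_nz_shift[of "\<lambda>x. f (x \<otimes> y)" a] f a y by simp
    have "grad2 f (a \<otimes> y) \<le> total (\<lambda>x. (1 + 1 / k) * (f (x \<otimes> a \<otimes> y) - f (x \<otimes> a))\<^sup>2 + (1 + k) * (f (x \<otimes> a) - f x)\<^sup>2)"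
      unfolding grad2_def
    proof (intro total_mono)
      fix x assume x: "x \<in> carrier G"
      show "(f (x \<otimes> (a \<otimes> y)) - f x)\<^sup>2 \<le> (1 + 1 / k) * (f (x \<otimes> a \<otimes> y) - f (x \<otimes> a))\<^sup>2 + (1 + k) * (f (x \<otimes> a) - f x)\<^sup>2"
        using square_add_weighted[OF k, of "f (x \<otimes> a \<otimes> y) - f (x \<otimes> a)" "f (x \<otimes> a) - f x"] x a y
        by (simp add: m_assoc)
    qed (use f a y fay in auto)
    also have "\<dots> = (1 + 1 / k) * total (\<lambda>x. (f (x \<otimes> a \<otimes> y) - f (x \<otimes> a))\<^sup>2) + (1 + k) * grad2 f a"
      unfolding grad2_def using f a y fay
      by (subst total_add, simp, simp, simp only: total_cmult)
    also have "total (\<lambda>x. (f (x \<otimes> a \<otimes> y) - f (x \<otimes> a))\<^sup>2) = grad2 f y"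
      unfolding grad2_def using total_shift[OF a(2), of "\<lambda>x. (f (x \<otimes> y) - f x)\<^sup>2"] by simp
    also have "(1 + 1 / k) * grad2 f y + (1 + k) * grad2 f a \<le> (1 + 1 / k) * (k\<^sup>2 * ?q) + (1 + k) * ?q"
      using k ga IH by (intro add_mono mult_left_mono) (auto simp: k_def)
    also have "\<dots> = (k + 1)\<^sup>2 * ?q" using k by (simp add: field_simps power2_eq_square)
    finally show ?thesis by (simp add: y_def k_def add.commute)
  qed
qed

lemma dirichlet_le_split:
  assumes \<phi>: "set_pmf \<phi> \<subseteq> carrier G" and f: "fin_nz G f" "sq f = 1" and Q: "0 \<le> Q"
    and good: "\<And>y. y \<in> carrier G \<Longrightarrow> y \<notin> Z \<Longrightarrow> grad2 f y \<le> Q"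
  shows "form \<phi> f \<le> Q / 2 + 2 * prob \<phi> Z"
proof -
  have "mean \<phi> (grad2 f) \<le> mean \<phi> (\<lambda>y. Q + 4 * indicator Z y)"
  proof (rule integral_mono_AE)
    show "integrable (measure_pmf \<phi>) (grad2 f)" by (rule integrable_grad2[OF \<phi> f(1)])
    show "AE y in measure_pmf \<phi>. grad2 f y \<le> Q + 4 * indicator Z y"
      unfolding AE_measure_pmf_iff
    proof
      fix y assume "y \<in> set_pmf \<phi>"
      then have "y \<in> carrier G" using \<phi> by auto
      then show "grad2 f y \<le> Q + 4 * indicator Z y"
        using good[of y] grad2_le[OF f(1), of y] f(2) Q by (cases "y \<in> Z") auto
    qed
    show "integrable (measure_pmf \<phi>) (\<lambda>y. Q + 4 * indicator Z y)"
      using Q by (intro measure_pmf.integrable_const_bound[where B = "Q + 4"]) (auto simp: indicator_def)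
  qed
  also have "\<dots> = Q + 4 * prob \<phi> Z"
  proof -
    have "integrable (measure_pmf \<phi>) (\<lambda>y. 4 * indicator Z y :: real)"
      by (intro measure_pmf.integrable_const_bound[where B = 4]) (auto simp: indicator_def)
    then show ?thesis by simp
  qed
  finally show ?thesis by (simp add: dirichlet_grad2[OF \<phi> f(1)])
qed

end

section \<open>Subordinated walks\<close>

locale subordinated_walk = symmetric_walk +
  fixes c :: "nat \<Rightarrow> real"
  assumes c_nonneg: "\<And>n. 1 \<le> n \<Longrightarrow> 0 \<le> c n" and c_sums: "(\<lambda>n. c (Suc n)) sums 1"
begin

abbreviation u_sub :: "'a pmf" where "u_sub \<equiv> subordinated G c u"

lemma pmf_u_sub_sums: "(\<lambda>n. c (Suc n) * pmf (u_pow (Suc n)) x) sums pmf u_sub x"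
proof -
  have "summable (\<lambda>n. c (Suc n) * pmf (u_pow (Suc n)) x)"
    by (rule summable_comparison_test'[OF sums_summable[OF c_sums], of 0])
       (auto simp: c_nonneg abs_mult intro!: mult_left_le pmf_le_1)
  moreover have "pmf u_sub x = (\<Sum>n. c (Suc n) * pmf (u_pow (Suc n)) x)"
    by (rule pmf_subordinated[OF c_nonneg c_sums])
  ultimately show ?thesis by (simp only: summable_sums)
qed

lemma u_sub_carrier: "set_pmf u_sub \<subseteq> carrier G"
proof
  fix x assume x: "x \<in> set_pmf u_sub"
  show "x \<in> carrier G"
  proof (rule ccontr)
    assume "x \<notin> carrier G"
    then have "pmf (u_pow (Suc n)) x = 0" for n using u_pow_carrier[of "Suc n"] by (auto simp: set_pmf_eq)
    then have "pmf u_sub x = 0" using pmf_u_sub_sums[of x] by (simp add: sums_iff)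
    then show False using x by (simp add: set_pmf_eq)
  qed
qed

lemma dirichlet_u_sub:
  assumes "fin_nz G f"
  shows "(\<lambda>n. c (Suc n) * form (u_pow (Suc n)) f) sums form u_sub f"
  using assms c_sums u_pow_carrier u_sub_carrier pmf_u_sub_sums by (rule dirichlet_mixture)

lemma c_summable: "summable c" using sums_summable[OF c_sums] by (simp add: summable_Suc_iff)

lemma u_sub_form_lower:
  assumes f: "fin_nz G f" and m: "1 \<le> m" and b: "0 \<le> b"
    and low: "\<And>n. m \<le> n \<Longrightarrow> b \<le> form (u_pow n) f"
  shows "b * (\<Sum>k. c (k + m)) \<le> form u_sub f"
proof -
  let ?a = "\<lambda>n. c (Suc n) * form (u_pow (Suc n)) f"
  have sm: "summable ?a" using dirichlet_u_sub[OF f] by (rule sums_summable)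
  have "b * (\<Sum>k. c (k + m)) = (\<Sum>k. b * c (k + m))"
    using c_summable by (intro suminf_mult[symmetric]) (simp add: summable_iff_shift)
  also have "\<dots> \<le> (\<Sum>k. ?a (k + (m - 1)))"
  proof (rule suminf_le)
    show "summable (\<lambda>k. b * c (k + m))" using c_summable by (intro summable_mult) (simp add: summable_iff_shift)
    show "summable (\<lambda>k. ?a (k + (m - 1)))" by (rule summable_ignore_initial_segment[OF sm])
    fix k
    have e: "Suc (k + (m - 1)) = k + m" using m by simp
    show "b * c (k + m) \<le> ?a (k + (m - 1))"
      unfolding e using low[of "k + m"] c_nonneg[of "k+m"] m
      by (subst mult.commute) (intro mult_left_mono, auto)
  qed
  also have "\<dots> \<le> (\<Sum>k. ?a k)"
  proof -
    have "(\<Sum>k. ?a k) = (\<Sum>k. ?a (k + (m - 1))) + (\<Sum>k<m - 1. ?a k)"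
      by (rule suminf_split_initial_segment[OF sm])
    moreover have "0 \<le> (\<Sum>k<m - 1. ?a k)"
      by (intro sum_nonneg mult_nonneg_nonneg c_nonneg dirichlet_nonneg) auto
    ultimately show ?thesis by simp
  qed
  also have "\<dots> = form u_sub f" using dirichlet_u_sub[OF f] by (simp only: sums_iff)
  finally show ?thesis .
qed

lemma profile_u_sub_lower:
  assumes gen: "generate G X = carrier G" and inf: "infinite (carrier G)"
    and v: "1 \<le> v" and m: "1 \<le> m"
    and big: "2 * N * (16 * N) ^ 16 < profile u v ^ 16 * real m"
  shows "1/2 * (\<Sum>k. c (k + 2 * m)) \<le> profile u_sub v"
proof (rule profile_greatest[OF v])
  fix f assume f: "test_fun v f"
  then have fin: "fin_nz G f" by (simp add: test_fun_def)
  have fa: "test_fun v (\<lambda>x. \<bar>f x\<bar>)" using f by (simp add: test_fun_def)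
  have "sq ((avg ^^ m) (\<lambda>x. \<bar>f x\<bar>)) < 1/2"
    using slow_decay_imp_small_profile[OF gen inf fa _ v m] big by force
  then have "1/2 * (\<Sum>k. c (k + 2 * m)) \<le> form u_sub (\<lambda>x. \<bar>f x\<bar>)"
    using m fin by (intro u_sub_form_lower u_pow_form_lower[OF fa]) auto
  also have "\<dots> \<le> form u_sub f" by (rule dirichlet_abs_le[OF u_sub_carrier fin])
  finally show "1/2 * (\<Sum>k. c (k + 2 * m)) \<le> form u_sub f" .
qed

text \<open>The complement of \<open>Z\<close> contains a finite set that carries the first \<open>n - 1\<close> convolution powers.\<close>

lemma u_sub_prob_le:
  assumes n: "1 \<le> n" and avoid: "\<And>k. k < n \<Longrightarrow> Z \<inter> set_pmf (u_pow k) = {}"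
  shows "prob u_sub Z \<le> (\<Sum>k. c (k + n))"
proof -
  define U where "U = (\<Union>k<n. set_pmf (u_pow k))"
  have U: "finite U" using u_pow_finite by (simp add: U_def)
  have "(\<lambda>j. \<Sum>x\<in>U. c (Suc j) * pmf (u_pow (Suc j)) x) sums (\<Sum>x\<in>U. pmf u_sub x)"
    by (intro sums_sum pmf_u_sub_sums)
  then have s: "(\<lambda>j. c (Suc j) * prob (u_pow (Suc j)) U) sums prob u_sub U"
    using U by (simp add: measure_measure_pmf_finite sum_distrib_left)
  have "(\<Sum>j<n - 1. c (Suc j)) = (\<Sum>j<n - 1. c (Suc j) * prob (u_pow (Suc j)) U)"
  proof (rule sum.cong[OF refl])
    fix j assume "j \<in> {..<n - 1}"
    then have "set_pmf (u_pow (Suc j)) \<subseteq> U" unfolding U_def by (intro UN_upper) auto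
    then have "prob (u_pow (Suc j)) U = 1"
      by (subst measure_pmf.prob_eq_1) (auto simp: AE_measure_pmf_iff)
    then show "c (Suc j) = c (Suc j) * prob (u_pow (Suc j)) U" by simp
  qed
  also have "\<dots> \<le> (\<Sum>j. c (Suc j) * prob (u_pow (Suc j)) U)"
    using s by (intro sum_le_suminf) (auto simp: sums_iff c_nonneg)
  also have "\<dots> = prob u_sub U" using s by (simp only: sums_iff)
  finally have "(\<Sum>j<n - 1. c (Suc j)) \<le> prob u_sub U" .
  moreover have "prob u_sub Z \<le> prob u_sub (- U)"
    using avoid by (intro measure_pmf.finite_measure_mono) (auto simp: U_def)
  moreover have "prob u_sub (- U) = 1 - prob u_sub U"
    using measure_pmf.prob_compl[of U u_sub] by (simp add: Compl_eq_Diff_UNIV)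
  moreover have "1 = (\<Sum>k. c (k + n)) + (\<Sum>j<n - 1. c (Suc j))"
  proof -
    have "(\<Sum>k. c (Suc k)) = (\<Sum>k. c (Suc (k + (n - 1)))) + (\<Sum>j<n - 1. c (Suc j))"
      using c_sums by (intro suminf_split_initial_segment) (simp add: sums_iff)
    moreover have "Suc (k + (n - 1)) = k + n" for k using n by simp
    ultimately show ?thesis using c_sums by (simp add: sums_iff)
  qed
  ultimately show ?thesis by linarith
qed

end

section \<open>Word length\<close>

locale word_walk = group +
  fixes S :: "'a list"
  assumes S_gen: "generating_tuple G S"
begin

lemma S_carrier: "set S \<subseteq> carrier G" and S_generate: "generate G (set S) = carrier G"
  using S_gen by (auto simp: generating_tuple_def)

lemma letters_carrier: "letters G S \<subseteq> carrier G"
  using S_carrier by (auto simp: letters_def)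

end

sublocale word_walk \<subseteq> symmetric_walk G "S_star G S"
proof
  show "finite (S_star G S)" by (simp add: S_star_def letters_def)
  show "S_star G S \<subseteq> carrier G" using letters_carrier by (auto simp: S_star_def)
  show "\<one> \<in> S_star G S" by (simp add: S_star_def)
  show "inv x \<in> S_star G S" if "x \<in> S_star G S" for x
    using that S_carrier by (auto simp: S_star_def letters_def)
qed

context word_walk
begin

lemma S_star_generate: "generate G (S_star G S) = carrier G"
proof
  show "generate G (S_star G S) \<subseteq> carrier G" by (rule generate_incl[OF X_carrier])
  have "generate G (set S) \<subseteq> generate G (S_star G S)"
    by (rule mono_generate) (auto simp: S_star_def letters_def)
  then show "carrier G \<subseteq> generate G (S_star G S)" using S_generate by simp
qed

lemma uniform_step_eq: "uniform_step G S = u"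
  by (simp add: uniform_step_def)

lemma letters_S_star: "letters G S \<subseteq> S_star G S" by (auto simp: S_star_def)

lemma foldr_append:
  "set w \<subseteq> letters G S \<Longrightarrow> set w' \<subseteq> letters G S \<Longrightarrow>
    foldr (\<otimes>) (w @ w') \<one> = foldr (\<otimes>) w \<one> \<otimes> foldr (\<otimes>) w' \<one>"
proof (induction w)
  case Nil
  then show ?case using word_closed[of w'] letters_S_star by auto
next
  case (Cons a w)
  then have "a \<in> carrier G" "foldr (\<otimes>) w \<one> \<in> carrier G" "foldr (\<otimes>) w' \<one> \<in> carrier G"
    using letters_carrier word_closed[of w] word_closed[of w'] letters_S_star by auto
  then show ?case using Cons by (simp add: m_assoc)
qed

lemma word_exists:
  assumes "x \<in> carrier G"
  shows "\<exists>w. set w \<subseteq> letters G S \<and> foldr (\<otimes>) w \<one> = x"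
proof -
  have "x \<in> generate G (set S)" using assms S_generate by simp
  then show ?thesis
  proof (induction rule: generate.induct)
    case one
    show ?case by (intro exI[of _ "[]"]) simp
  next
    case (incl h)
    then show ?case using S_carrier by (intro exI[of _ "[h]"]) (auto simp: letters_def)
  next
    case (inv h)
    then show ?case using S_carrier by (intro exI[of _ "[inv h]"]) (auto simp: letters_def)
  next
    case (eng h1 h2)
    then obtain w1 w2 where "set w1 \<subseteq> letters G S" "foldr (\<otimes>) w1 \<one> = h1"
      "set w2 \<subseteq> letters G S" "foldr (\<otimes>) w2 \<one> = h2" by blast
    then show ?case using foldr_append[of w1 w2] by (intro exI[of _ "w1 @ w2"]) auto
  qed
qed

lemma word_length_word:
  assumes "x \<in> carrier G"
  obtains w where "length w = word_length G S x" "set w \<subseteq> letters G S" "foldr (\<otimes>) w \<one> = x"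
proof -
  let ?P = "\<lambda>n. \<exists>w. length w = n \<and> set w \<subseteq> letters G S \<and> foldr (\<otimes>) w \<one> = x"
  have "\<exists>n. ?P n" using word_exists[OF assms] by blast
  then have "?P (LEAST n. ?P n)" by (rule LeastI_ex)
  then show ?thesis using that unfolding word_length_def by blast
qed

lemma word_length_le:
  "set w \<subseteq> letters G S \<Longrightarrow> foldr (\<otimes>) w \<one> = x \<Longrightarrow> word_length G S x \<le> length w"
  unfolding word_length_def by (rule Least_le) auto

lemma word_length_one: "word_length G S \<one> = 0"
  using word_length_le[of "[]" \<one>] by simp

lemma word_length_u_pow: "x \<in> set_pmf (u_pow k) \<Longrightarrow> word_length G S x \<le> k"
proof -
  have "x \<in> set_pmf (u_pow k) \<Longrightarrow> \<exists>w. length w \<le> k \<and> set w \<subseteq> letters G S \<and> foldr (\<otimes>) w \<one> = x"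
  proof (induction k arbitrary: x)
    case 0
    then show ?case by (intro exI[of _ "[]"]) simp
  next
    case (Suc k)
    then obtain a y where ay: "a \<in> S_star G S" "y \<in> set_pmf (u_pow k)" "x = a \<otimes> y"
      unfolding u_pow_Suc by (auto simp: set_u)
    obtain w where w: "length w \<le> k" "set w \<subseteq> letters G S" "foldr (\<otimes>) w \<one> = y" using Suc.IH[OF ay(2)] by blast
    show ?case
    proof (cases "a = \<one>")
      case True
      then have "x = y" using ay u_pow_carrier[of k] by auto
      then show ?thesis using w by (intro exI[of _ w]) auto
    next
      case False
      then have "a \<in> letters G S" using ay by (auto simp: S_star_def)
      then show ?thesis using w ay by (intro exI[of _ "a # w"]) auto
    qed
  qed
  then show "x \<in> set_pmf (u_pow k) \<Longrightarrow> word_length G S x \<le> k" using word_length_le by fastforce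
qed

lemma word_in_u_pow: "set w \<subseteq> S_star G S \<Longrightarrow> foldr (\<otimes>) w \<one> \<in> set_pmf (u_pow (length w))"
  by (induction w) (auto simp: u_pow_Suc set_u)

lemma u_pow_mono: "m \<le> n \<Longrightarrow> set_pmf (u_pow m) \<subseteq> set_pmf (u_pow n)"
proof (induction n rule: dec_induct)
  case (step n)
  have "set_pmf (u_pow n) \<subseteq> set_pmf (u_pow (Suc n))"
  proof
    fix x assume x: "x \<in> set_pmf (u_pow n)"
    then have "x = \<one> \<otimes> x" using u_pow_carrier[of n] by auto
    then show "x \<in> set_pmf (u_pow (Suc n))" unfolding u_pow_Suc using x X_one by (auto simp: set_u)
  qed
  then show ?case using step by auto
qed simp

text \<open>The value of \<open>u_pow n\<close> at \<open>y\<close> is a matrix entry of the symmetric operator \<open>avg ^^ n\<close>.\<close>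

lemma u_pow_symmetric:
  assumes y: "y \<in> carrier G"
  shows "pmf (u_pow n) (inv y) = pmf (u_pow n) y"
proof -
  let ?d = "\<lambda>z. indicator {z} :: 'a \<Rightarrow> real"
  have ev: "ip (?d z) f = f z" if "z \<in> carrier G" for z f
    using that by (subst total_eq_sum[of "{z}"]) (auto simp: indicator_def)
  have "pmf (u_pow n) y = mean (u_pow n) (?d y)"
    by (simp add: measure_pmf_single)
  also have "\<dots> = mean (u_pow n) (\<lambda>z. ?d y (\<one> \<otimes> z))"
    using u_pow_carrier[of n] by (intro integral_cong_AE) (auto simp: AE_measure_pmf_iff subset_iff)
  also have "\<dots> = (avg ^^ n) (?d y) \<one>" by (rule u_pow_expectation) simp
  also have "\<dots> = ip (?d \<one>) ((avg ^^ n) (?d y))" by (simp add: ev)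
  also have "\<dots> = ip ((avg ^^ n) (?d \<one>)) (?d y)" by (intro ip_avg_pow) auto
  also have "\<dots> = ip (?d y) ((avg ^^ n) (?d \<one>))" by (simp add: mult.commute)
  also have "\<dots> = (avg ^^ n) (?d \<one>) y" by (rule ev[OF y])
  also have "\<dots> = mean (u_pow n) (\<lambda>z. ?d \<one> (y \<otimes> z))" by (rule u_pow_expectation[OF y, symmetric])
  also have "\<dots> = mean (u_pow n) (?d (inv y))"
  proof (intro integral_cong_AE)
    show "AE z in measure_pmf (u_pow n). ?d \<one> (y \<otimes> z) = ?d (inv y) z"
      unfolding AE_measure_pmf_iff
    proof
      fix z assume "z \<in> set_pmf (u_pow n)"
      then have z: "z \<in> carrier G" using u_pow_carrier by auto
      have "y \<otimes> z = \<one> \<longleftrightarrow> z = inv y" using y z by (metis inv_equality inv_comm l_inv r_inv)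
      then show "?d \<one> (y \<otimes> z) = ?d (inv y) z" by (simp add: indicator_def)
    qed
  qed auto
  also have "\<dots> = pmf (u_pow n) (inv y)" by (simp add: measure_pmf_single)
  finally show ?thesis by simp
qed

end

section \<open>Weak moments and profiles\<close>

locale moment_walk = word_walk + moment_scale
begin

abbreviation far :: "real \<Rightarrow> 'a set" where
  "far s \<equiv> {g \<in> carrier G. s < \<rho> (real (word_length G S g))}"

lemma weak_moment_leD:
  assumes "weak_moment G S \<rho> \<phi> \<le> ennreal K" "0 < s" "0 \<le> K"
  shows "s * prob \<phi> (far s) \<le> K"
proof -
  have "ennreal (s * prob \<phi> (far s)) \<le> weak_moment G S \<rho> \<phi>"
    unfolding weak_moment_def by (rule SUP_upper2[of s]) (use assms in auto)
  then have "ennreal (s * prob \<phi> (far s)) \<le> ennreal K" using assms(1) by (rule order_trans)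
  then show ?thesis using assms(3) by (simp add: ennreal_le_iff)
qed

lemma weak_moment_leI:
  assumes "\<And>s. 0 < s \<Longrightarrow> s * prob \<phi> (far s) \<le> K"
  shows "weak_moment G S \<rho> \<phi> \<le> ennreal K"
  unfolding weak_moment_def using assms by (intro SUP_least ennreal_leI) auto

text \<open>As \<open>\<rho> \<ge> 1\<close>, every element exceeds the level \<open>1/2\<close>. Hence \<open>K\<close> is bounded away from 0, and error
  terms without the factor \<open>K\<close> can be absorbed.\<close>

lemma weak_moment_bound_ge:
  assumes \<phi>: "set_pmf \<phi> \<subseteq> carrier G" and W: "weak_moment G S \<rho> \<phi> \<le> ennreal K"
  shows "1/2 \<le> K"
proof -
  have "1/2 < \<rho> (real n)" for n :: nat using rho_ge_1[of "real n"] by simp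
  then have far: "far (1/2) = carrier G" by auto
  have "prob \<phi> (far (1/2)) = 1"
    unfolding far using \<phi> by (subst measure_pmf.prob_eq_1) (auto simp: AE_measure_pmf_iff)
  moreover have "ennreal (1/2 * prob \<phi> (far (1/2))) \<le> weak_moment G S \<rho> \<phi>"
    unfolding weak_moment_def by (rule SUP_upper2[of "1/2"]) auto
  ultimately have "ennreal (1/2) \<le> ennreal K" using W by (metis mult.right_neutral order_trans)
  then show ?thesis by (metis ennreal_le_iff2 half_gt_zero_iff not_le zero_less_one linear)
qed

text \<open>The radius \<open>r\<close> is chosen with \<open>r\<^sup>p\<^sup>+\<^sup>2 = 1 / e\<close>. Then \<open>r\<^sup>2 e = r\<^sup>-\<^sup>p\<close> is at most a multiple of \<open>1 / \<rho>(r)\<close> by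
  the growth of \<open>\<rho>\<close>, and \<open>\<rho>(1 / e)\<close> is at most a multiple of \<open>\<rho>(r)\<close>.\<close>

lemma form_upper:
  assumes grow: "\<And>t. 0 \<le> t \<Longrightarrow> \<rho> t \<le> C1 * (1 + t) ^ p" and C1: "0 < C1"
    and poly: "\<And>s t. 0 \<le> t \<Longrightarrow> 0 \<le> s \<Longrightarrow> s \<le> 2 * (1 + t) ^ (p + 2) \<Longrightarrow> \<rho> s \<le> C2 * \<rho> t" and C2: "0 < C2"
    and \<phi>: "set_pmf \<phi> \<subseteq> carrier G" and W: "weak_moment G S \<rho> \<phi> \<le> ennreal K"
    and f: "test_fun v f" and e: "0 < e" "e \<le> 4" and E: "form u f \<le> e"
  shows "form \<phi> f \<le> ((2 * N * C1 * 3 ^ p + 4) * C2) * K / \<rho> (1 / e)"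
proof -
  have K: "1/2 \<le> K" by (rule weak_moment_bound_ge[OF \<phi> W])
  have fin: "fin_nz G f" "sq f = 1" using f by (auto simp: test_fun_def)
  define r where "r = root (p + 2) (1 / e)"
  have r: "0 < r" "r ^ (p + 2) = 1 / e" using e by (auto simp: r_def real_root_pow_pos2 simp del: power_Suc)
  have r_half: "1/2 \<le> r"
  proof (rule ccontr)
    assume "\<not> ?thesis"
    then have "r ^ (p + 2) \<le> r ^ 2" using r by (intro power_decreasing) auto
    also have "\<dots> < (1/2) ^ 2" using r \<open>\<not> 1/2 \<le> r\<close> by (intro power_strict_mono) auto
    finally have "1 / e < 1 / 4" using r by (simp add: power2_eq_square)
    then show False using e by (simp add: field_simps)
  qed
  define Z where "Z = {y \<in> carrier G. r < real (word_length G S y)}"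
  define Q where "Q = r\<^sup>2 * (2 * N * e)"
  have Q0: "0 \<le> Q" using e by (simp add: Q_def)
  have good: "grad2 f y \<le> Q" if y: "y \<in> carrier G" "y \<notin> Z" for y
  proof -
    obtain w where w: "length w = word_length G S y" "set w \<subseteq> letters G S" "foldr (\<otimes>) w \<one> = y"
      using word_length_word[OF y(1)] by blast
    have "grad2 f y \<le> (real (length w))\<^sup>2 * (2 * N * form u f)"
      using grad2_word_le[OF fin(1), of w] w letters_S_star by auto
    also have "\<dots> \<le> r\<^sup>2 * (2 * N * e)"
      using y w E N_ge_1 dirichlet_nonneg e by (intro mult_mono power_mono) (auto simp: Z_def)
    finally show ?thesis by (simp add: Q_def)
  qed
  have "form \<phi> f \<le> Q / 2 + 2 * prob \<phi> Z"
    by (rule dirichlet_le_split[OF \<phi> fin Q0 good])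
  moreover have "prob \<phi> Z \<le> 2 * K / \<rho> r"
  proof -
    have rr: "0 < \<rho> r" using r rho_pos by simp
    have "Z \<subseteq> far (\<rho> r / 2)"
    proof
      fix y assume "y \<in> Z"
      then have "y \<in> carrier G" "\<rho> r \<le> \<rho> (real (word_length G S y))"
        using r by (auto simp: Z_def intro: rho_mono)
      then show "y \<in> far (\<rho> r / 2)" using rr by auto
    qed
    then have "prob \<phi> Z \<le> prob \<phi> (far (\<rho> r / 2))"
      by (intro measure_pmf.finite_measure_mono) auto
    moreover have "\<rho> r / 2 * prob \<phi> (far (\<rho> r / 2)) \<le> K"
      using K rr by (intro weak_moment_leD[OF W]) auto
    ultimately have "\<rho> r / 2 * prob \<phi> Z \<le> K"
      using rr by (meson mult_left_mono order_trans half_gt_zero less_imp_le)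
    then show ?thesis using rr by (simp add: field_simps)
  qed
  moreover have "Q / 2 \<le> N * C1 * 3 ^ p / \<rho> r"
  proof -
    have "r ^ p * (r\<^sup>2 * e) = 1" using r(2) e by (simp add: power_add field_simps power2_eq_square)
    then have "r\<^sup>2 * e = 1 / r ^ p" using r by (simp add: field_simps)
    moreover have "Q / 2 = N * (r\<^sup>2 * e)" by (simp add: Q_def)
    ultimately have q: "Q / 2 = N / r ^ p" by simp
    have "\<rho> r \<le> C1 * (1 + r) ^ p" using r by (intro grow) auto
    also have "\<dots> \<le> C1 * (3 * r) ^ p" using r r_half C1 by (intro mult_left_mono power_mono) auto
    finally have "\<rho> r \<le> C1 * 3 ^ p * r ^ p" by (simp add: power_mult_distrib)
    then have "N * \<rho> r \<le> N * (C1 * 3 ^ p * r ^ p)" using N_ge_1 by (intro mult_left_mono) auto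
    then show ?thesis unfolding q using r rho_pos[of r] by (simp add: field_simps)
  qed
  moreover have "2 * (2 * K / \<rho> r) = 4 * K / \<rho> r" by simp
  ultimately have "form \<phi> f \<le> N * C1 * 3 ^ p / \<rho> r + 4 * K / \<rho> r" by linarith
  also have "\<dots> \<le> 2 * N * C1 * 3 ^ p * K / \<rho> r + 4 * K / \<rho> r"
  proof -
    have "N * C1 * 3 ^ p * 1 \<le> N * C1 * 3 ^ p * (2 * K)" using K C1 by (intro mult_left_mono) auto
    then have "N * C1 * 3 ^ p \<le> 2 * N * C1 * 3 ^ p * K" by (simp add: mult_ac)
    then show ?thesis using r rho_pos[of r] by (intro add_mono divide_right_mono) auto
  qed
  also have "\<dots> = (2 * N * C1 * 3 ^ p + 4) * K / \<rho> r" by (simp add: add_divide_distrib distrib_right)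
  also have "\<dots> \<le> (2 * N * C1 * 3 ^ p + 4) * K * (C2 / \<rho> (1 / e))"
  proof -
    have "r ^ (p + 2) \<le> (1 + r) ^ (p + 2)" using r by (intro power_mono) auto
    then have "1 / e \<le> 2 * (1 + r) ^ (p + 2)"
      using r(2) zero_le_power[of "1 + r" "p + 2"] r(1) by linarith
    then have "\<rho> (1 / e) \<le> C2 * \<rho> r" using r e by (intro poly) auto
    then have "1 / \<rho> r \<le> C2 / \<rho> (1 / e)" using rho_pos[of r] rho_pos[of "1 / e"] r e by (simp add: field_simps)
    moreover have "0 \<le> (2 * N * C1 * 3 ^ p + 4) * K" using C1 K by simp
    ultimately show ?thesis by (metis mult_left_mono times_divide_eq_right mult.right_neutral)
  qed
  finally show ?thesis by (simp add: mult_ac)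
qed

text \<open>If the profile of \<open>u\<close> vanishes, every \<open>e > 0\<close> may be used and \<open>\<rho>\<close> is unbounded; otherwise take \<open>e\<close>
  to be twice the profile.\<close>

lemma profile_upper:
  assumes grow: "\<And>t. 0 \<le> t \<Longrightarrow> \<rho> t \<le> C1 * (1 + t) ^ p" and C1: "0 < C1"
    and poly: "\<And>s t. 0 \<le> t \<Longrightarrow> 0 \<le> s \<Longrightarrow> s \<le> 2 * (1 + t) ^ (p + 2) \<Longrightarrow> \<rho> s \<le> C2 * \<rho> t" and C2: "0 < C2"
    and \<phi>: "set_pmf \<phi> \<subseteq> carrier G" and W: "weak_moment G S \<rho> \<phi> \<le> ennreal K" and v: "1 \<le> v"
  shows "profile \<phi> v \<le> ((2 * N * C1 * 3 ^ p + 4) * C2 * C2) * K * recip (profile u v)"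
proof -
  let ?L = "profile u v" and ?M = "(2 * N * C1 * 3 ^ p + 4) * C2"
  have K: "1/2 \<le> K" by (rule weak_moment_bound_ge[OF \<phi> W])
  have M: "0 < ?M" using C1 C2 by (intro mult_pos_pos add_nonneg_pos) auto
  have up: "profile \<phi> v \<le> ?M * K / \<rho> (1 / e)" if e: "?L < e" "0 < e" "e \<le> 4" for e
  proof -
    obtain f where f: "test_fun v f" "form u f < e" using profile_approx[OF v e(1)] by blast
    have "profile \<phi> v \<le> form \<phi> f" by (rule profile_le[OF f(1)])
    also have "\<dots> \<le> ?M * K / \<rho> (1 / e)"
      using f(2) by (intro form_upper[OF grow C1 poly C2 \<phi> W f(1) e(2,3)]) auto
    finally show ?thesis .
  qed
  show ?thesis
  proof (cases "?L = 0")
    case True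
    have "profile \<phi> v \<le> 0"
    proof (rule ccontr)
      assume "\<not> ?thesis"
      then have pos: "0 < profile \<phi> v" by simp
      obtain t where t: "0 \<le> t" "?M * K / profile \<phi> v < \<rho> t" using rho_unbounded by blast
      define e where "e = 1 / (t + 1)"
      have "?M * K / profile \<phi> v < \<rho> (1 / e)"
        using t rho_mono[of t "t + 1"] by (simp add: e_def)
      then have "?M * K / \<rho> (1 / e) < profile \<phi> v"
        using pos rho_pos[of "1 / e"] t by (simp add: e_def field_simps)
      moreover have "e \<le> 4" using t by (simp add: e_def field_simps)
      ultimately show False using up[of e] True t by (simp add: e_def)
    qed
    then show ?thesis by (simp add: True recip_rho_def)
  next
    case False
    then have L: "0 < ?L" using profile_nonneg[OF v, of u] by simp
    have L2: "?L \<le> 2" using X_carrier by (intro profile_le_2 v) (simp add: set_u)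
    have "profile \<phi> v \<le> ?M * K / \<rho> (1 / (2 * ?L))" using L L2 by (intro up) auto
    also have "\<dots> \<le> ?M * K * (C2 / \<rho> (1 / ?L))"
    proof -
      define t where "t = 1 / (2 * ?L)"
      have t: "t \<ge> 0" using L by (simp add: t_def)
      have "1 / ?L = 2 * t" using L by (simp add: t_def)
      also have "\<dots> \<le> 2 * (1 + t) ^ (p + 2)"
      proof -
        have "1 + t \<le> (1 + t) ^ (p + 2)" using t by (intro self_le_power) auto
        then show ?thesis using t by linarith
      qed
      finally have "\<rho> (1 / ?L) \<le> C2 * \<rho> t" using t L by (intro poly) auto
      then have "1 / \<rho> t \<le> C2 / \<rho> (1 / ?L)"
        using rho_pos[of t] rho_pos[of "1 / ?L"] t L by (simp add: field_simps)
      moreover have "0 \<le> ?M * K" using M K by simp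
      ultimately have "?M * K * (1 / \<rho> t) \<le> ?M * K * (C2 / \<rho> (1 / ?L))" by (intro mult_left_mono)
      then show ?thesis by (simp add: t_def)
    qed
    also have "\<dots> = (?M * C2) * K * recip ?L" using L by (simp add: recip_rho_def)
    finally show ?thesis .
  qed
qed

end

locale subordinated_moment_walk = moment_walk + subordinated_walk G "S_star G S"
begin

text \<open>With \<open>n\<close> the first integer at which \<open>\<rho>\<close> exceeds \<open>s\<close>, no walk of fewer than \<open>n\<close> steps reaches
  \<open>far s\<close>. The restriction to \<open>s \<ge> \<rho> 0\<close> excludes the identity from \<open>far s\<close>, which lets the bound scale
  under mixing with the point mass there.\<close>

lemma weak_moment_u_sub:
  assumes tail: "\<And>n::nat. 1 \<le> n \<Longrightarrow> \<rho> n * (\<Sum>k. c (k + n)) \<le> b" and b: "0 \<le> b"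
    and s: "\<rho> 0 \<le> s"
  shows "s * prob u_sub (far s) \<le> b"
proof (cases "far s = {}")
  case True
  show ?thesis unfolding True using b by simp
next
  case False
  have s0: "0 < s" using s rho_pos[of 0] by simp
  define n where "n = (LEAST n::nat. s < \<rho> n)"
  have "\<exists>n::nat. s < \<rho> n" using False by auto
  then have n: "s < \<rho> n" unfolding n_def by (rule LeastI_ex)
  have below: "\<rho> k \<le> s" if "k < n" for k :: nat
    using not_less_Least[of k "\<lambda>n. s < \<rho> (real n)"] that by (simp add: n_def not_less)
  have n1: "1 \<le> n" using n s by (cases n) auto
  have "far s \<inter> set_pmf (u_pow k) = {}" if k: "k < n" for k
  proof -
    have "\<rho> (real (word_length G S x)) \<le> s" if "x \<in> set_pmf (u_pow k)" for x
      using word_length_u_pow[OF that] below[OF k] rho_mono[of "real (word_length G S x)" "real k"] by simp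
    then show ?thesis by (auto simp: not_less[symmetric])
  qed
  then have p: "prob u_sub (far s) \<le> (\<Sum>k. c (k + n))" by (rule u_sub_prob_le[OF n1])
  have "s * prob u_sub (far s) \<le> \<rho> n * (\<Sum>k. c (k + n))"
    using n p s0 rho_pos[of n] by (intro mult_mono) auto
  also have "\<dots> \<le> b" by (rule tail[OF n1])
  finally show ?thesis .
qed

lemma weak_moment_u_sub_le:
  assumes tail: "\<And>n::nat. 1 \<le> n \<Longrightarrow> \<rho> n * (\<Sum>k. c (k + n)) \<le> b" and b: "\<rho> 0 \<le> b"
  shows "weak_moment G S \<rho> u_sub \<le> ennreal b"
proof (rule weak_moment_leI)
  fix s :: real assume s: "0 < s"
  have b0: "0 \<le> b" using b rho_pos[of 0] by simp
  show "s * prob u_sub (far s) \<le> b"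
  proof (cases "\<rho> 0 \<le> s")
    case True
    show ?thesis by (rule weak_moment_u_sub[OF tail b0 True])
  next
    case False
    have "s * prob u_sub (far s) \<le> s * 1" using s by (intro mult_left_mono) auto
    then show ?thesis using False b by simp
  qed
qed

text \<open>The walk forgets half of the squared norm of any admissible function within \<open>m\<close> steps, where \<open>m\<close> is
  of the order of the profile to the power \<open>-16\<close>; the weights beyond \<open>2 m\<close> then bound the form
  from below, and \<open>\<rho> (2 m)\<close> is comparable to \<open>\<rho>\<close> at the reciprocal of the profile.\<close>

lemma profile_lower_infinite:
  assumes inf: "infinite (carrier G)" and v: "1 \<le> v"
    and tail: "\<And>n::nat. 1 \<le> n \<Longrightarrow> a \<le> \<rho> n * (\<Sum>k. c (k + n))" and a: "0 < a"
    and poly: "\<And>s t. 0 \<le> t \<Longrightarrow> 0 \<le> s \<Longrightarrow> s \<le> (2 * (2 * N * (16 * N) ^ 16) + 2) * (1 + t) ^ 16 \<Longrightarrow> \<rho> s \<le> C * \<rho> t"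
    and C: "0 < C"
  shows "a / (2 * C) * recip (profile u v) \<le> profile u_sub v"
proof (cases "profile u v = 0")
  case True
  then show ?thesis using profile_nonneg[OF v] by (simp add: recip_rho_def)
next
  case False
  define L where "L = profile u v"
  have L: "0 < L" using False profile_nonneg[OF v, of u] by (simp add: L_def)
  define B where "B = 2 * N * (16 * N) ^ 16"
  have B: "0 \<le> B" by (simp add: B_def)
  define m where "m = nat \<lfloor>B / L ^ 16\<rfloor> + 1"
  have "0 \<le> B / L ^ 16" using B L by simp
  then have m: "B / L ^ 16 < real m" "real m \<le> B / L ^ 16 + 1" unfolding m_def by linarith+
  have big: "B < L ^ 16 * real m" using m(1) L by (simp add: field_simps)
  have m1: "1 \<le> m" by (simp add: m_def)
  have low: "1/2 * (\<Sum>k. c (k + 2 * m)) \<le> profile u_sub v"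
    using big unfolding B_def L_def by (rule profile_u_sub_lower[OF S_star_generate inf v m1])
  have "\<rho> (real (2 * m)) \<le> C * \<rho> (1 / L)"
  proof (rule poly)
    have "B * (1 / L) ^ 16 \<le> B * (1 + 1 / L) ^ 16" using B L by (intro mult_left_mono power_mono) auto
    moreover have "1 \<le> (1 + 1 / L) ^ 16" using L by (intro one_le_power) auto
    ultimately have "real (2 * m) \<le> 2 * (B * (1 + 1 / L) ^ 16) + 2 * (1 + 1 / L) ^ 16"
      using m(2) by (simp add: power_one_over field_simps)
    also have "\<dots> = (2 * B + 2) * (1 + 1 / L) ^ 16" by (simp add: distrib_right)
    finally show "real (2 * m) \<le> (2 * (2 * N * (16 * N) ^ 16) + 2) * (1 + 1 / L) ^ 16" by (simp add: B_def)
  qed (use L in auto)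
  moreover have "a \<le> \<rho> (real (2 * m)) * (\<Sum>k. c (k + 2 * m))" using m1 by (intro tail) auto
  moreover have sum0: "0 \<le> (\<Sum>k. c (k + 2 * m))"
    using c_summable m1 by (intro suminf_nonneg c_nonneg) (auto simp: summable_iff_shift)
  ultimately have "a \<le> C * \<rho> (1 / L) * (\<Sum>k. c (k + 2 * m))" by (meson mult_right_mono order_trans)
  then have "a / (2 * C) * (1 / \<rho> (1 / L)) \<le> 1/2 * (\<Sum>k. c (k + 2 * m))"
    using C rho_pos[of "1 / L"] L by (simp add: field_simps)
  then show ?thesis using low L by (simp add: recip_rho_def L_def)
qed

lemma u_sub_symmetric: "symmetric_measure G u_sub"
  unfolding symmetric_measure_def
proof (intro conjI ballI u_sub_carrier)
  fix x assume x: "x \<in> carrier G"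
  show "pmf u_sub (inv x) = pmf u_sub x"
    using pmf_u_sub_sums[of "inv x"] pmf_u_sub_sums[of x]
    unfolding u_pow_symmetric[OF x] by (rule sums_unique2)
qed

text \<open>Mixing with the point mass at the identity scales the form by \<open>\<alpha>\<close> (\<open>dirichlet_lazy\<close>) and the part of
  the weak moment above the level \<open>\<rho> 0\<close> as well, so that the constraint \<open>W \<le> 2 \<rho> 0\<close> can be met.\<close>

definition lazy :: "real \<Rightarrow> 'a pmf" where
  "lazy \<alpha> = bind_pmf (bernoulli_pmf \<alpha>) (\<lambda>b. if b then u_sub else return_pmf \<one>)"

lemma pmf_lazy:
  assumes "0 \<le> \<alpha>" "\<alpha> \<le> 1"
  shows "pmf (lazy \<alpha>) x = \<alpha> * pmf u_sub x + (1 - \<alpha>) * indicator {\<one>} x"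
  unfolding lazy_def pmf_bind using assms by (simp add: pmf_return indicator_def mult.commute)

lemma prob_lazy:
  assumes "0 \<le> \<alpha>" "\<alpha> \<le> 1"
  shows "prob (lazy \<alpha>) Z = \<alpha> * prob u_sub Z + (1 - \<alpha>) * indicator Z \<one>"
proof -
  have P: "pmf (map_pmf (\<lambda>x. x \<in> Z) q) True = prob q Z" for q :: "'a pmf"
    by (simp add: pmf_map vimage_def)
  have "prob (lazy \<alpha>) Z = pmf (map_pmf (\<lambda>x. x \<in> Z) (lazy \<alpha>)) True" by (simp add: P)
  also have "\<dots> = pmf (bind_pmf (bernoulli_pmf \<alpha>) (\<lambda>b. map_pmf (\<lambda>x. x \<in> Z) (if b then u_sub else return_pmf \<one>))) True"
    by (simp add: lazy_def map_bind_pmf)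
  also have "\<dots> = prob u_sub Z * \<alpha> + prob (return_pmf \<one>) Z * (1 - \<alpha>)"
    unfolding pmf_bind using assms by (simp del: map_return_pmf add: P)
  also have "prob (return_pmf \<one>) Z = indicator Z \<one>"
    by (simp add: measure_return_pmf)
  finally show ?thesis by (simp add: mult.commute)
qed

lemma lazy_symmetric:
  assumes "0 \<le> \<alpha>" "\<alpha> \<le> 1"
  shows "symmetric_measure G (lazy \<alpha>)"
  unfolding symmetric_measure_def
proof (intro conjI ballI)
  show "set_pmf (lazy \<alpha>) \<subseteq> carrier G"
    using u_sub_carrier by (auto simp: lazy_def split: if_splits)
  fix x assume x: "x \<in> carrier G"
  have "inv x = \<one> \<longleftrightarrow> x = \<one>" using x by (metis inv_inv inv_one)
  moreover have "pmf u_sub (inv x) = pmf u_sub x" using u_sub_symmetric x by (simp add: symmetric_measure_def)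
  ultimately show "pmf (lazy \<alpha>) (inv x) = pmf (lazy \<alpha>) x" by (simp add: pmf_lazy[OF assms] indicator_def)
qed

lemma dirichlet_lazy:
  assumes \<alpha>: "0 \<le> \<alpha>" "\<alpha> \<le> 1" and f: "fin_nz G f"
  shows "form (lazy \<alpha>) f = \<alpha> * form u_sub f"
proof -
  let ?w = "\<lambda>n. if n = 0 then \<alpha> else if n = 1 then 1 - \<alpha> else 0 :: real"
  let ?q = "\<lambda>n::nat. if n = 0 then u_sub else return_pmf \<one>"
  have two: "(\<lambda>n. ?w n * h n) sums (\<alpha> * h 0 + (1 - \<alpha>) * h 1)" for h :: "nat \<Rightarrow> real"
    using sums_finite[of "{0, 1::nat}" "\<lambda>n. ?w n * h n"] by simp
  have zero: "form (return_pmf \<one>) f = 0"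
    using f by (subst dirichlet_grad2) (auto simp: grad2_def intro!: infsum_0)
  have "(\<lambda>n. ?w n * form (?q n) f) sums form (lazy \<alpha>) f"
  proof (rule dirichlet_mixture[OF f])
    show "?w sums 1" using two[of "\<lambda>_. 1"] by simp
    show "set_pmf (?q n) \<subseteq> carrier G" for n using u_sub_carrier by auto
    show "set_pmf (lazy \<alpha>) \<subseteq> carrier G" using lazy_symmetric[OF \<alpha>] by (simp add: symmetric_measure_def)
    show "(\<lambda>n. ?w n * pmf (?q n) y) sums pmf (lazy \<alpha>) y" for y
      using two[of "\<lambda>n. pmf (?q n) y"] by (simp add: pmf_lazy[OF \<alpha>] pmf_return indicator_def eq_commute[of y])
  qed
  moreover have "(\<lambda>n. ?w n * form (?q n) f) sums (\<alpha> * form u_sub f)"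
    using two[of "\<lambda>n. form (?q n) f"] by (simp add: zero)
  ultimately show ?thesis by (rule sums_unique2)
qed

lemma weak_moment_lazy:
  assumes tail: "\<And>n::nat. 1 \<le> n \<Longrightarrow> \<rho> n * (\<Sum>k. c (k + n)) \<le> b" and b: "0 \<le> b"
    and \<alpha>: "0 \<le> \<alpha>" "\<alpha> \<le> 1" "\<alpha> * b \<le> 1"
  shows "weak_moment G S \<rho> (lazy \<alpha>) \<le> ennreal (2 * \<rho> 0)"
proof (rule weak_moment_leI)
  fix s :: real assume s: "0 < s"
  have rho0: "1 \<le> \<rho> 0" using rho_ge_1 by simp
  show "s * prob (lazy \<alpha>) (far s) \<le> 2 * \<rho> 0"
  proof (cases "\<rho> 0 \<le> s")
    case True
    then have "\<one> \<notin> far s" by (simp add: word_length_one)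
    then have "s * prob (lazy \<alpha>) (far s) = \<alpha> * (s * prob u_sub (far s))"
      by (simp add: prob_lazy[OF \<alpha>(1,2)])
    also have "\<dots> \<le> \<alpha> * b" using \<alpha> weak_moment_u_sub[OF tail b True] by (intro mult_left_mono)
    finally show ?thesis using \<alpha> rho0 by simp
  next
    case False
    have "s * prob (lazy \<alpha>) (far s) \<le> s * 1" using s by (intro mult_left_mono) auto
    then show ?thesis using False rho0 by simp
  qed
qed

lemma extremal_profile_bounds:
  assumes tail: "\<And>n::nat. 1 \<le> n \<Longrightarrow> \<rho> n * (\<Sum>k. c (k + n)) \<le> b" and b: "1 \<le> b" and v: "1 \<le> v"
    and low: "a * recip (profile u v) \<le> profile u_sub v"
    and up: "\<And>\<phi>. symmetric_measure G \<phi> \<Longrightarrow> weak_moment G S \<rho> \<phi> \<le> ennreal (2 * \<rho> 0) \<Longrightarrow>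
        profile \<phi> v \<le> C * recip (profile u v)"
  shows "a / b * recip (profile u v) \<le> extremal_profile G S \<rho> v"
    and "extremal_profile G S \<rho> v \<le> C * recip (profile u v)"
proof -
  let ?P = "\<lambda>\<phi>. symmetric_measure G \<phi> \<and> weak_moment G S \<rho> \<phi> \<le> ennreal (2 * \<rho> 0)"
  have lazyP: "?P (lazy (1 / b))"
    using b by (intro conjI lazy_symmetric weak_moment_lazy[OF tail]) auto
  have "a / b * recip (profile u v) \<le> profile (lazy (1 / b)) v"
  proof (rule profile_greatest[OF v])
    fix f assume f: "test_fun v f"
    have "a * recip (profile u v) \<le> form u_sub f"
      using low profile_le[OF f, of u_sub] by linarith
    then have "1 / b * (a * recip (profile u v)) \<le> 1 / b * form u_sub f"
      using b by (intro mult_left_mono) auto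
    also have "\<dots> = form (lazy (1 / b)) f"
      using b f by (intro dirichlet_lazy[symmetric]) (auto simp: test_fun_def)
    finally show "a / b * recip (profile u v) \<le> form (lazy (1 / b)) f" by simp
  qed
  also have "\<dots> \<le> extremal_profile G S \<rho> v"
    unfolding extremal_profile_def
  proof (rule cSup_upper)
    show "profile (lazy (1 / b)) v \<in> {profile \<phi> v |\<phi>. ?P \<phi>}" using lazyP by blast
    show "bdd_above {profile \<phi> v |\<phi>. ?P \<phi>}"
      using profile_le_2[OF v] by (intro bdd_aboveI[of _ 2]) (auto simp: symmetric_measure_def)
  qed
  finally show "a / b * recip (profile u v) \<le> extremal_profile G S \<rho> v" .
  show "extremal_profile G S \<rho> v \<le> C * recip (profile u v)"
    unfolding extremal_profile_def using lazyP up by (intro cSup_least) auto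
qed

lemma pmf_u_sub_pos:
  assumes ev: "\<exists>\<^sub>F n in sequentially. 0 < c n" and y: "y \<in> carrier G"
  shows "0 < pmf u_sub y"
proof -
  obtain w where w: "set w \<subseteq> letters G S" "foldr (\<otimes>) w \<one> = y" using word_exists[OF y] by blast
  obtain n where n: "Suc (length w) \<le> n" "0 < c n"
    using ev unfolding frequently_sequentially by blast
  then obtain k where k: "n = Suc k" by (cases n) auto
  have "y \<in> set_pmf (u_pow (length w))" using word_in_u_pow[of w] w letters_S_star by auto
  then have "y \<in> set_pmf (u_pow (Suc k))" using u_pow_mono[of "length w" "Suc k"] n k by auto
  then have p: "0 < pmf (u_pow (Suc k)) y" by (rule pmf_positive)
  have sm: "summable (\<lambda>n. c (Suc n) * pmf (u_pow (Suc n)) y)" using pmf_u_sub_sums by (rule sums_summable)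
  have "0 < (\<Sum>n. c (Suc n) * pmf (u_pow (Suc n)) y)"
    using n k p by (intro suminf_pos2[OF sm, of k]) (auto simp: c_nonneg)
  then show ?thesis using pmf_u_sub_sums[of y] by (simp only: sums_iff)
qed

text \<open>If the support of \<open>f\<close> misses a point \<open>z\<close>, every \<open>x\<close> has a \<open>y\<close> with \<open>x y = z\<close>, and this
  single difference contributes \<open>(f x)\<^sup>2\<close>. If the support may be everything, constants show that the
  profile of \<open>u\<close> is 0.\<close>

lemma profile_lower_finite:
  assumes fin: "finite (carrier G)" and v: "1 \<le> v"
    and \<kappa>: "\<And>y. y \<in> carrier G \<Longrightarrow> \<kappa> \<le> pmf u_sub y" and \<kappa>0: "0 < \<kappa>"
  shows "\<kappa> / 2 * recip (profile u v) \<le> profile u_sub v"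
proof (cases "real (card (carrier G)) \<le> v")
  case True
  have pos: "0 < card (carrier G)" using fin by (simp add: card_gt_0_iff) blast
  have "profile u v \<le> form u (\<lambda>_. 1) / sq (\<lambda>_. 1)"
    using fin True pos by (intro profile_le_quotient) (auto simp: fin_nz_def)
  also have "form u (\<lambda>_. 1) = 0" by (simp add: dirichlet_form_def case_prod_unfold)
  finally have "profile u v = 0" using profile_nonneg[OF v, of u] by simp
  then show ?thesis using profile_nonneg[OF v] by (simp add: recip_rho_def)
next
  case False
  have "\<kappa> / 2 \<le> profile u_sub v"
  proof (rule profile_greatest[OF v])
    fix f assume f: "test_fun v f"
    then have fnz: "fin_nz G f" "sq f = 1" and card: "real (card (supp f)) \<le> v"
      by (auto simp: test_fun_def)
    have "supp f \<noteq> carrier G" using card False by auto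
    then obtain z where z: "z \<in> carrier G" "f z = 0" by auto
    have "1 = (\<Sum>x\<in>carrier G. (f x)\<^sup>2)" using fnz(2) fin by (simp add: total_eq_sum[of "carrier G"])
    also have "\<dots> \<le> (\<Sum>x\<in>carrier G. \<Sum>y\<in>carrier G. (f (x \<otimes> y) - f x)\<^sup>2)"
    proof (rule sum_mono)
      fix x assume x: "x \<in> carrier G"
      have "x \<otimes> (inv x \<otimes> z) = z" using x z by (simp add: m_assoc[symmetric])
      then have "(f x)\<^sup>2 = (f (x \<otimes> (inv x \<otimes> z)) - f x)\<^sup>2" using z by simp
      also have "\<dots> \<le> (\<Sum>y\<in>carrier G. (f (x \<otimes> y) - f x)\<^sup>2)"
        using x z fin by (intro member_le_sum[where f = "\<lambda>y. (f (x \<otimes> y) - f x)\<^sup>2"]) auto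
      finally show "(f x)\<^sup>2 \<le> (\<Sum>y\<in>carrier G. (f (x \<otimes> y) - f x)\<^sup>2)" .
    qed
    also have "\<dots> = (\<Sum>y\<in>carrier G. grad2 f y)"
      unfolding grad2_def by (subst sum.swap) (simp add: fin)
    finally have g1: "1 \<le> (\<Sum>y\<in>carrier G. grad2 f y)" .
    have "\<kappa> * 1 \<le> \<kappa> * (\<Sum>y\<in>carrier G. grad2 f y)" using g1 \<kappa>0 by (intro mult_left_mono) auto
    also have "\<dots> \<le> (\<Sum>y\<in>carrier G. pmf u_sub y * grad2 f y)"
      unfolding sum_distrib_left by (intro sum_mono mult_right_mono \<kappa> grad2_nonneg)
    also have "\<dots> = mean u_sub (grad2 f)"
      using u_sub_carrier by (subst integral_measure_pmf[OF fin]) auto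
    finally show "\<kappa> / 2 \<le> form u_sub f" by (simp add: dirichlet_grad2[OF u_sub_carrier fnz(1)])
  qed
  moreover have "\<kappa> / 2 * recip (profile u v) \<le> \<kappa> / 2 * 1"
    using \<kappa>0 by (intro mult_left_mono recip_le_1 profile_nonneg v) auto
  ultimately show ?thesis by simp
qed

end

section \<open>Comparison of the profiles\<close>

theorem theorem2p15:
  fixes G :: "('a, 'b) monoid_scheme"
    and \<rho> l \<psi> :: "real \<Rightarrow> real"
    and coef :: "nat \<Rightarrow> real"
    and N :: nat
  assumes "group G" and "finitely_generated G" and "amenable G"
    and "continuous_on {0..} \<rho>" and "mono_on {0..} \<rho>" and "\<forall>t\<ge>0. \<rho> t \<ge> 1"
    and "continuous_on {0..} l" and "mono_on {0..} l" and "\<forall>t\<ge>0. l t \<ge> 1"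
    and "slowly_varying l"
    and "set_integrable lborel {0..} (\<lambda>s. 1 / ((1 + s) * l s))"
    and "\<forall>a>0. (\<lambda>t. l (t powr a)) \<simeq> l"
    and "\<rho> \<simeq> (\<lambda>t. inverse (LINT s:{t..}|lborel. 1 / ((1 + s) * l s)))"
    and "associated_bernstein l \<psi> coef"
  shows "\<exists>c>0. \<exists>C>0. \<forall>S. generating_tuple G S \<and> card (S_star G S) = N \<longrightarrow>
    (let u = uniform_step G S;
         u\<psi> = subordinated G coef u;
         \<Lambda> = spectral_profile G
     in weak_moment G S \<rho> u\<psi> \<le> ennreal C \<and>
        (\<forall>v\<ge>1. c * recip_rho \<rho> (\<Lambda> u v) \<le> \<Lambda> u\<psi> v \<and>
                \<Lambda> u\<psi> v \<le> C * recip_rho \<rho> (\<Lambda> u v)) \<and>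
        (\<forall>\<phi> K. symmetric_measure G \<phi> \<and> weak_moment G S \<rho> \<phi> \<le> ennreal K \<longrightarrow>
           (\<forall>v\<ge>1. \<Lambda> \<phi> v \<le> C * K * recip_rho \<rho> (\<Lambda> u v))) \<and>
        (\<forall>F \<in> Lambda_class G S.
           extremal_profile G S \<rho> \<simeq> (\<lambda>v. recip_rho \<rho> (F v))))"
proof -
  interpret group G by fact
  interpret log_regular l
    using assms(7-9,11,12) by unfold_locales auto
  have rho_tail_eq: "\<rho> \<simeq> (\<lambda>t. inverse (T t))" using assms(13) by (simp add: tail_def)
  interpret moment_scale \<rho> by (rule moment_scale_rho[OF assms(5,6) rho_tail_eq])
  obtain c1 where bern: "bernstein \<psi>" "\<psi> 0 = 0" "psi_coeffs \<psi> coef" "\<forall>n\<ge>1. 0 \<le> coef n"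
    and c1: "c1 > 0" "coef \<sim>[at_top] (\<lambda>n. c1 / (real n * l (real n)))"
    using assms(14) by (auto simp: associated_bernstein_def complete_bernstein_def)
  have sum1: "(\<lambda>n. coef (Suc n)) sums 1" by (rule bernstein_coeffs_sums_1[OF bern])
  have summ: "summable coef" using sums_summable[OF sum1] by (simp add: summable_Suc_iff)
  have nonneg: "\<And>n. 1 \<le> n \<Longrightarrow> 0 \<le> coef n" using bern(4) by auto
  obtain a1 b1 where ab1: "0 < a1" "0 < b1" "\<And>n. n \<ge> 1 \<Longrightarrow> a1 * T n \<le> (\<Sum>k. coef (k + n))"
    "\<And>n. n \<ge> 1 \<Longrightarrow> (\<Sum>k. coef (k + n)) \<le> b1 * T n"
    using weights_tail[OF nonneg summ c1] by blast
  obtain a2 b2 where ab2: "0 < a2" "0 < b2" "\<And>t. t \<ge> 0 \<Longrightarrow> a2 \<le> \<rho> t * T t" "\<And>t. t \<ge> 0 \<Longrightarrow> \<rho> t * T t \<le> b2"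
    using rho_tail[OF assms(5,6) rho_tail_eq] by blast
  define a where "a = a1 * a2"
  define b where "b = max (b1 * b2) (\<rho> 0)"
  have a: "0 < a" using ab1 ab2 by (simp add: a_def)
  have b: "1 \<le> b" "\<rho> 0 \<le> b" using rho_ge_1[of 0] by (auto simp: b_def)
  have tail_low: "a \<le> \<rho> n * (\<Sum>k. coef (k + n))" if "1 \<le> n" for n :: nat
  proof -
    have "a \<le> a1 * (\<rho> n * T n)" unfolding a_def using ab1 ab2 by (intro mult_left_mono) auto
    also have "\<dots> = \<rho> n * (a1 * T n)" by simp
    also have "\<dots> \<le> \<rho> n * (\<Sum>k. coef (k + n))"
      using that ab1 rho_pos[of n] by (intro mult_left_mono) auto
    finally show ?thesis .
  qed
  have tail_up: "\<rho> n * (\<Sum>k. coef (k + n)) \<le> b" if "1 \<le> n" for n :: nat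
  proof -
    have "\<rho> n * (\<Sum>k. coef (k + n)) \<le> \<rho> n * (b1 * T n)"
      using that ab1 rho_pos[of n] by (intro mult_left_mono) auto
    also have "\<dots> = b1 * (\<rho> n * T n)" by simp
    also have "\<dots> \<le> b1 * b2" using ab1 ab2 by (intro mult_left_mono) auto
    finally show ?thesis by (simp add: b_def)
  qed
  obtain C1 p where grow: "0 < C1" "\<And>t. 0 \<le> t \<Longrightarrow> \<rho> t \<le> C1 * (1 + t) ^ p" using rho_growth by blast
  obtain C2 where C2: "0 < C2" "\<And>s t. 0 \<le> t \<Longrightarrow> 0 \<le> s \<Longrightarrow> s \<le> 2 * (1 + t) ^ (p + 2) \<Longrightarrow> \<rho> s \<le> C2 * \<rho> t"
    using rho_poly[of 2 "p + 2"] by blast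
  obtain C3 where C3: "0 < C3"
    "\<And>s t. 0 \<le> t \<Longrightarrow> 0 \<le> s \<Longrightarrow> s \<le> (2 * (2 * real N * (16 * real N) ^ 16) + 2) * (1 + t) ^ 16 \<Longrightarrow> \<rho> s \<le> C3 * \<rho> t"
    using rho_poly[of "2 * (2 * real N * (16 * real N) ^ 16) + 2" 16] by blast
  define M where "M = (2 * real N * C1 * 3 ^ p + 4) * C2 * C2"
  have M: "0 < M" unfolding M_def using grow(1) C2(1) by (intro mult_pos_pos add_nonneg_pos) auto
  have walk: "subordinated_moment_walk G S \<rho> coef" if "generating_tuple G S" for S
  proof -
    interpret word_walk G S by unfold_locales (rule that)
    show ?thesis by unfold_locales (use nonneg sum1 in auto)
  qed
  have freq: "\<exists>\<^sub>F n in sequentially. 0 < coef n"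
  proof (rule ccontr)
    assume "\<not> ?thesis"
    then have "\<forall>\<^sub>F n in sequentially. \<not> 0 < coef n" by (simp only: not_frequently)
    then obtain m where m: "\<And>n. m \<le> n \<Longrightarrow> \<not> 0 < coef n" unfolding eventually_sequentially by blast
    have "coef (k + (m + 1)) = 0" for k using m[of "k + (m + 1)"] nonneg[of "k + (m + 1)"] by simp
    then show False using tail_low[of "m + 1"] a by simp
  qed
  let ?low = "\<lambda>c S v. c * recip (profile (uniform_step G S) v)
      \<le> profile (subordinated G coef (uniform_step G S)) v"
  have "\<exists>c>0. \<forall>S v. generating_tuple G S \<longrightarrow> card (S_star G S) = N \<longrightarrow> 1 \<le> v \<longrightarrow> ?low c S v"
  proof (cases "finite (carrier G)")
    case False
    have "?low (a / (2 * C3)) S v"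
      if S: "generating_tuple G S" "card (S_star G S) = N" and v: "1 \<le> v" for S v
    proof -
      interpret W: subordinated_moment_walk G S \<rho> coef by (rule walk[OF S(1)])
      show ?thesis
        unfolding W.uniform_step_eq
        by (rule W.profile_lower_infinite[OF False v tail_low a _ C3(1)]) (use C3(2) S(2) in auto)
    qed
    then show ?thesis using a C3(1) by (intro exI[of _ "a / (2 * C3)"]) auto
  next
    case True
    define \<kappa> where "\<kappa> X = Min (pmf (subordinated G coef (pmf_of_set X)) ` carrier G)" for X
    \<comment> \<open>The measures depend on \<open>S\<close> only through \<open>S_star G S\<close>, which takes finitely many values.\<close>
    define XS where "XS = {S_star G S |S. generating_tuple G S}"
    have "XS \<subseteq> Pow (carrier G)"
    proof
      fix X assume "X \<in> XS"
      then obtain S where S: "generating_tuple G S" "X = S_star G S" by (auto simp: XS_def)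
      interpret W: subordinated_moment_walk G S \<rho> coef by (rule walk[OF S(1)])
      show "X \<in> Pow (carrier G)" using W.X_carrier S by simp
    qed
    then have fin: "finite XS" using True by (meson finite_Pow_iff finite_subset)
    define c where "c = Min (insert 1 (\<kappa> ` XS))"
    have ne: "carrier G \<noteq> {}" using one_closed by blast
    have "0 < \<kappa> X" if X: "X \<in> XS" for X
    proof -
      obtain S where S: "generating_tuple G S" "X = S_star G S" using X by (auto simp: XS_def)
      interpret W: subordinated_moment_walk G S \<rho> coef by (rule walk[OF S(1)])
      show ?thesis unfolding \<kappa>_def using True ne W.pmf_u_sub_pos[OF freq] S(2) by (subst Min_gr_iff) auto
    qed
    then have c: "0 < c" unfolding c_def using fin by (subst Min_gr_iff) auto
    have "?low (c / 2) S v"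
      if S: "generating_tuple G S" and v: "1 \<le> v" for S v
    proof -
      interpret W: subordinated_moment_walk G S \<rho> coef by (rule walk[OF S])
      have "c \<le> \<kappa> (S_star G S)" unfolding c_def using fin S by (intro Min_le) (auto simp: XS_def)
      moreover have "\<kappa> (S_star G S) \<le> pmf W.u_sub y" if "y \<in> carrier G" for y
        unfolding \<kappa>_def using True that by (intro Min_le) auto
      ultimately have "c \<le> pmf W.u_sub y" if "y \<in> carrier G" for y using that by (meson order_trans)
      from W.profile_lower_finite[OF True v this c] show ?thesis unfolding W.uniform_step_eq .
    qed
    then show ?thesis using c by (intro exI[of _ "c / 2"]) auto
  qed
  then obtain c where c: "0 < c" and lower: "\<And>S v. generating_tuple G S \<Longrightarrow> card (S_star G S) = N \<Longrightarrow> 1 \<le> v \<Longrightarrow> ?low c S v"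
    by blast
  define C where "C = max b (max (M * b) M)"
  have C: "b \<le> C" "M * b \<le> C" "M \<le> C" "0 < C" using M by (auto simp: C_def)
  show ?thesis
  proof (rule exI[of _ c], intro conjI[OF c] exI[of _ C] conjI[OF C(4)] allI impI)
    fix S assume S': "generating_tuple G S \<and> card (S_star G S) = N"
    then have S: "generating_tuple G S" "card (S_star G S) = N" by auto
    interpret W: subordinated_moment_walk G S \<rho> coef by (rule walk[OF S(1)])
    let ?L = "profile W.u"
    have Lpos: "0 \<le> ?L v" if "1 \<le> v" for v by (rule profile_nonneg[OF that])
    have up: "profile \<phi> v \<le> M * K * recip (?L v)"
      if "set_pmf \<phi> \<subseteq> carrier G" "weak_moment G S \<rho> \<phi> \<le> ennreal K" "1 \<le> v" for \<phi> K v
      using W.profile_upper[OF grow(2,1) C2(2,1) that] by (simp add: M_def S(2))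
    have Wb: "weak_moment G S \<rho> W.u_sub \<le> ennreal b"
      by (rule W.weak_moment_u_sub_le[OF tail_up b(2)])
    have low: "c * recip (?L v) \<le> profile W.u_sub v" if "1 \<le> v" for v
      using lower[OF S that] by (simp add: W.uniform_step_eq)
    have 1: "weak_moment G S \<rho> W.u_sub \<le> ennreal C"
      using Wb ennreal_leI[OF C(1)] by (rule order_trans)
    have 2: "profile W.u_sub v \<le> C * recip (?L v)" if v: "1 \<le> v" for v
    proof -
      have "profile W.u_sub v \<le> M * b * recip (?L v)" by (rule up[OF W.u_sub_carrier Wb v])
      also have "\<dots> \<le> C * recip (?L v)" by (rule mult_right_mono[OF C(2) recip_nonneg[OF Lpos[OF v]]])
      finally show ?thesis .
    qed
    have 3: "profile \<phi> v \<le> C * K * recip (?L v)"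
      if \<phi>: "symmetric_measure G \<phi>" "weak_moment G S \<rho> \<phi> \<le> ennreal K" and v: "1 \<le> v" for \<phi> K v
    proof -
      have carr: "set_pmf \<phi> \<subseteq> carrier G" using \<phi>(1) by (simp add: symmetric_measure_def)
      have K: "1/2 \<le> K" by (rule W.weak_moment_bound_ge[OF carr \<phi>(2)])
      have "profile \<phi> v \<le> M * K * recip (?L v)" by (rule up[OF carr \<phi>(2) v])
      also have "\<dots> \<le> C * K * recip (?L v)"
        using K C(3) recip_nonneg[OF Lpos[OF v]] by (intro mult_right_mono) auto
      finally show ?thesis .
    qed
    have 4: "extremal_profile G S \<rho> \<simeq> (\<lambda>v. recip (F v))" if F: "F \<in> Lambda_class G S" for F
    proof (rule simeq_recip[where ?k1.0 = "c / b" and ?k2.0 = "M * (2 * \<rho> 0)" and L = ?L])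
      show "0 < c / b" "0 < M * (2 * \<rho> 0)" using c b M rho_pos[of 0] by auto
      show "F \<simeq> ?L" using F by (simp add: Lambda_class_def W.uniform_step_eq)
      show "0 \<le> ?L v" if "1 \<le> v" for v by (rule Lpos[OF that])
      fix v :: real assume v: "1 \<le> v"
      have ups: "profile \<phi> v \<le> M * (2 * \<rho> 0) * recip (?L v)"
        if "symmetric_measure G \<phi>" "weak_moment G S \<rho> \<phi> \<le> ennreal (2 * \<rho> 0)" for \<phi>
        using that v by (intro up) (auto simp: symmetric_measure_def)
      show "c / b * recip (?L v) \<le> extremal_profile G S \<rho> v"
        by (rule W.extremal_profile_bounds(1)[OF tail_up b(1) v low[OF v] ups])
      show "extremal_profile G S \<rho> v \<le> M * (2 * \<rho> 0) * recip (?L v)"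
        by (rule W.extremal_profile_bounds(2)[OF tail_up b(1) v low[OF v] ups])
    qed
    show "let u = uniform_step G S; u\<psi> = subordinated G coef u; \<Lambda> = spectral_profile G
      in weak_moment G S \<rho> u\<psi> \<le> ennreal C \<and>
        (\<forall>v\<ge>1. c * recip_rho \<rho> (\<Lambda> u v) \<le> \<Lambda> u\<psi> v \<and> \<Lambda> u\<psi> v \<le> C * recip_rho \<rho> (\<Lambda> u v)) \<and>
        (\<forall>\<phi> K. symmetric_measure G \<phi> \<and> weak_moment G S \<rho> \<phi> \<le> ennreal K \<longrightarrow>
           (\<forall>v\<ge>1. \<Lambda> \<phi> v \<le> C * K * recip_rho \<rho> (\<Lambda> u v))) \<and>
        (\<forall>F \<in> Lambda_class G S. extremal_profile G S \<rho> \<simeq> (\<lambda>v. recip_rho \<rho> (F v)))"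
      unfolding Let_def W.uniform_step_eq using 1 low 2 3 4 by blast
  qed
qed

end
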